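(* Let $B\subset\mathbb{S}^3$ be a spherical ball such that a regular spherical tetrahedron $T_{\mathrm{reg}}$ circumscribed about $B$ exists. Then for every spherical tetrahedron $T\subset\mathbb{S}^3$ containing $B$, $\mathrm{vol}_3(T)\ge\mathrm{vol}_3(T_{\mathrm{reg}})$, with equality if and only if $T$ is congruent to $T_{\mathrm{reg}}$.
   Context: $\mathbb{S}^3$ is the unit sphere of $\mathbb{E}^4$ with its spherical metric; a spherical tetrahedron is the spherical convex hull of four points in an open hemisphere not lying on a common great $2$-sphere. A regular tetrahedron has all edges of equal length; circumscribed about $B$ means it contains $B$ and each face touches $B$. $\mathrm{vol}_3$ is spherical volume. *)

theory Defs
  imports "HOL-Analysis.Analysis"
begin

definition sph_dist :: "real^4 \<Rightarrow> real^4 \<Rightarrow> real" where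
  "sph_dist x y = arccos (x \<bullet> y)"

definition sph_ball :: "real^4 \<Rightarrow> real \<Rightarrow> (real^4) set" where
  "sph_ball c r = {x \<in> sphere 0 1. sph_dist c x \<le> r}"

definition is_sph_ball :: "(real^4) set \<Rightarrow> bool" where
  "is_sph_ball B \<longleftrightarrow> (\<exists>c r. c \<in> sphere 0 1 \<and> 0 < r \<and> r < pi \<and> B = sph_ball c r)"

definition sph_hull :: "(real^4) set \<Rightarrow> (real^4) set" where
  "sph_hull S = sphere 0 1 \<inter> {t *\<^sub>R x | t x. 0 \<le> t \<and> x \<in> convex hull S}"

text \<open>Admissible vertex data of a spherical tetrahedron: four distinct points of S^3
  in an open hemisphere, not on a common great 2-sphere (= linearly independent).\<close>
definition tet_vertices :: "(nat \<Rightarrow> real^4) \<Rightarrow> bool" where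
  "tet_vertices v \<longleftrightarrow>
     (\<forall>i<4. v i \<in> sphere 0 1) \<and>
     inj_on v {..<4} \<and>
     (\<exists>u. \<forall>i<4. u \<bullet> v i > 0) \<and>
     independent (v ` {..<4})"

definition sph_tetrahedron :: "(real^4) set \<Rightarrow> bool" where
  "sph_tetrahedron T \<longleftrightarrow> (\<exists>v. tet_vertices v \<and> T = sph_hull (v ` {..<4}))"

definition regular_vertices :: "(nat \<Rightarrow> real^4) \<Rightarrow> bool" where
  "regular_vertices v \<longleftrightarrow>
     (\<forall>i<4. \<forall>j<4. \<forall>k<4. \<forall>l<4. i \<noteq> j \<longrightarrow> k \<noteq> l \<longrightarrow>
        sph_dist (v i) (v j) = sph_dist (v k) (v l))"

definition circumscribed_vertices :: "(nat \<Rightarrow> real^4) \<Rightarrow> (real^4) set \<Rightarrow> bool" where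
  "circumscribed_vertices v B \<longleftrightarrow>
     B \<subseteq> sph_hull (v ` {..<4}) \<and>
     (\<forall>i<4. sph_hull (v ` ({..<4} - {i})) \<inter> B \<noteq> {})"

definition regular_circumscribed :: "(real^4) set \<Rightarrow> (real^4) set \<Rightarrow> bool" where
  "regular_circumscribed T B \<longleftrightarrow>
     (\<exists>v. tet_vertices v \<and> regular_vertices v \<and> circumscribed_vertices v B \<and>
          T = sph_hull (v ` {..<4}))"

text \<open>Spherical 3-volume of A \<subseteq> S^3: 4 times the Lebesgue measure of the solid cone
  {t x | 0 \<le> t \<le> 1, x \<in> A} (this equals the 3-dim Hausdorff measure of A).\<close>
definition sph_vol :: "(real^4) set \<Rightarrow> real" where
  "sph_vol A = 4 * measure lebesgue {t *\<^sub>R x | t x. 0 \<le> t \<and> t \<le> 1 \<and> x \<in> A}"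

definition sph_congruent :: "(real^4) set \<Rightarrow> (real^4) set \<Rightarrow> bool" where
  "sph_congruent S T \<longleftrightarrow> (\<exists>f. orthogonal_transformation f \<and> f ` S = T)"

end

theory Submission
  imports Defs
begin

text \<open>
  Let \<open>c\<close>, \<open>r\<close> be the centre and radius of the ball. Inside the cone over \<open>T\<close> sits the cone
  \<open>{x. x \<bullet> p \<le> tan r * (x \<bullet> c) for p \<in> N}\<close> of a (possibly unbounded) tetrahedron tangent to the ball,
  where \<open>N\<close> consists of four distinct unit vectors orthogonal to \<open>c\<close>. Its volume is a moment
  \<open>\<integral> g (max {u \<bullet> p | p \<in> N}) du\<close> over the directions \<open>u \<in> S^2\<close> at \<open>c\<close>, with \<open>g\<close> strictly decreasing, and
  L. Fejes Toth's moment theorem says that this is smallest for a regular \<open>N\<close>.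

  The proof of the moment theorem subtracts a constant \<open>\<mu>\<close> from \<open>g\<close> (the total area is fixed). The Dirichlet cell
  of \<open>p\<close> within the disc about \<open>p\<close> reaching the cell vertices of the regular configuration is the disc
  minus the segments cut off by the bisectors with the other points. In the central projection a segment
  is a half plane \<open>{y \<ge> z}\<close> within the disc. Choosing \<open>\<mu>\<close> as the mean of \<open>g\<close> over the chord of the regular
  configuration, the integral of \<open>g - \<mu>\<close> along a chord is negative for chords nearer to the centre and positive for
  those farther away, so the segment integral is maximal for the regular chord. Where segments overlap, they
  overlap in outward star-shaped sets, on which \<open>g - \<mu>\<close>, truncated near the centre, has nonnegative integral.
  Hence the twelve segments together cost at most twelve times the regular segment.
\<close>

section \<open>Radial profiles along chords\<close>

text \<open>In a regular configuration \<open>p \<bullet> q = - 1 / 3\<close>, so in the central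
  projection from \<open>c\<close> centred at \<open>p\<close> every bisector lies at distance sqrt
  2 and every cell vertex at distance sqrt 8: these are the constants 2 and 8. The density becomes
  \<open>k\<close>, a function of \<tau> = tan^2 of the angle to \<open>p\<close>, and is therefore
  increasing. In the regular case all three bisectors bound each cell, so segments can be compared
  one at a time, without counting edges. The obstacle is the overlaps. Subadditivity over a union
  needs nonnegative integrals over intersections, but an outward set that reaches the centre may
  collect too much of the negative part of \<open>\<kappa>\<close>. Cutting \<open>\<kappa>\<close>
  off below \<sigma> cures this. As \<sigma> < 2, regular segments are untouched, and elsewhere only
  negative values are dropped, which enlarges the integrals that are being bounded from above.
  Chords that meet the cut must still have nonpositive integral; this follows because
  \<open>\<kappa>\<close> changes sign once along a chord, so that the uniform weight can be
  compared with the radial weight v. Cell parts beyond the disc only help, because \<open>k\<close>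
  exceeds \<mu> there.\<close>

lemma integral_strict_mono_continuous:
  fixes f g :: "real \<Rightarrow> real"
  assumes "a < b" "continuous_on {a..b} f" "continuous_on {a..b} g"
    and le: "\<And>x. x \<in> {a..b} \<Longrightarrow> f x \<le> g x" and c: "c \<in> {a..b}" "f c < g c"
  shows "integral {a..b} f < integral {a..b} g"
proof -
  have i: "f integrable_on {a..b}" "g integrable_on {a..b}"
    using assms by (auto intro: integrable_continuous_real)
  have "integral {a..b} (\<lambda>x. g x - f x) \<noteq> 0"
  proof
    assume z: "integral {a..b} (\<lambda>x. g x - f x) = 0"
    have "((\<lambda>x. g x - f x) has_integral 0) (cbox a b)"
      using i z by (metis cbox_interval has_integral_integral integrable_diff)
    then have "g c - f c = 0"
      by (rule has_integral_0_cbox_imp_0[rotated 2]) (use assms in \<open>auto intro!: continuous_intros\<close>)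
    then show False using c by simp
  qed
  moreover have "integral {a..b} (\<lambda>x. g x - f x) \<ge> 0"
    by (rule integral_nonneg) (use i le in \<open>auto intro: integrable_diff\<close>)
  ultimately show ?thesis using i by (simp add: integral_diff)
qed

text \<open>In the disc of squared radius \<open>8 = tan^2 (arccos (1/3))\<close>, consider the chord at distance \<open>z\<close> from the
  centre, \<open>A = 1 + z^2\<close>. It is the projection of a great circle arc; \<open>\<theta>\<close> measures the sine of the arc length from
  its midpoint relative to the endpoint, and the value is the squared distance from the centre. In terms
  of \<open>\<theta>\<close> the spherical area swept by a moving chord is uniformly distributed.\<close>
definition chord_param :: "real \<Rightarrow> real \<Rightarrow> real" where
  "chord_param A \<theta> = 1 / ((1 - \<theta>\<^sup>2) / A + \<theta>\<^sup>2 / 9) - 1"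

lemma chord_param_denom_pos:
  fixes A \<theta> :: real
  assumes "1 \<le> A" "0 \<le> \<theta>" "\<theta> \<le> 1"
  shows "(1 - \<theta>\<^sup>2) / A + \<theta>\<^sup>2 / 9 > 0"
proof -
  have "\<theta>\<^sup>2 \<le> 1" by (rule power_le_one) (use assms in auto)
  show ?thesis
  proof (cases "\<theta>\<^sup>2 = 1")
    case False
    then show ?thesis using \<open>\<theta>\<^sup>2 \<le> 1\<close> assms
      by (intro add_pos_nonneg divide_pos_pos) auto
  qed auto
qed

lemma chord_param_bounds:
  assumes "1 \<le> A" "A \<le> 9" "0 \<le> \<theta>" "\<theta> \<le> 1"
  shows "A - 1 \<le> chord_param A \<theta>" "chord_param A \<theta> \<le> 8"
proof -
  let ?D = "(1 - \<theta>\<^sup>2) / A + \<theta>\<^sup>2 / 9"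
  have t: "\<theta>\<^sup>2 \<le> 1" by (rule power_le_one) (use assms in auto)
  have "1 / 9 \<le> 1 / A" using assms by (simp add: divide_simps)
  then have "(1 - \<theta>\<^sup>2) * (1 / 9) \<le> (1 - \<theta>\<^sup>2) * (1 / A)" "\<theta>\<^sup>2 * (1/9) \<le> \<theta>\<^sup>2 * (1/A)"
    by (intro mult_left_mono; use t in simp)+
  moreover have "?D = (1 - \<theta>\<^sup>2) * (1 / A) + \<theta>\<^sup>2 * (1 / 9)" by simp
  moreover have "(1 - \<theta>\<^sup>2) * x + \<theta>\<^sup>2 * x = x" for x by (simp add: algebra_simps)
  ultimately have D: "1 / 9 \<le> ?D" "?D \<le> 1 / A"
    by (metis add_mono order_refl)+
  have Dp: "?D > 0" using D(1) by linarith
  have "1 / (1 / A) \<le> 1 / ?D"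
    by (rule divide_left_mono[OF D(2) _ mult_pos_pos[OF _ Dp]]) (use assms in auto)
  then show "A - 1 \<le> chord_param A \<theta>" by (simp add: chord_param_def)
  have "1 / ?D \<le> 1 / (1 / 9)"
    by (rule divide_left_mono[OF D(1) _ mult_pos_pos[OF Dp]]) auto
  then show "chord_param A \<theta> \<le> 8" by (simp add: chord_param_def)
qed

text \<open>Raising \<open>A\<close> lowers the term with weight \<open>1 - \<theta>\<^sup>2\<close>
  in the denominator. Strictness fails at \<open>\<theta> = 1\<close>, where the value is always 8:
  all chords end on the rim of the disc.\<close>

lemma chord_param_mono:
  assumes "1 \<le> A" "A < B" "0 \<le> \<theta>" "\<theta> \<le> 1"
  shows "chord_param A \<theta> \<le> chord_param B \<theta>" "\<theta> < 1 \<Longrightarrow> chord_param A \<theta> < chord_param B \<theta>"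
proof -
  let ?D = "\<lambda>A. (1 - \<theta>\<^sup>2) / A + \<theta>\<^sup>2 / 9"
  have t: "\<theta>\<^sup>2 \<le> 1" by (rule power_le_one) (use assms in auto)
  have p: "?D A > 0" "?D B > 0" using assms by (auto intro!: chord_param_denom_pos)
  have "?D B \<le> ?D A" using t assms by (intro add_mono divide_left_mono) auto
  then show "chord_param A \<theta> \<le> chord_param B \<theta>"
    unfolding chord_param_def using p by (intro diff_mono divide_left_mono) auto
  assume "\<theta> < 1"
  then have "\<theta>\<^sup>2 < 1" using assms by (simp add: power_less_one_iff)
  then have "?D B < ?D A" using assms by (intro add_less_le_mono divide_strict_left_mono) auto
  then show "chord_param A \<theta> < chord_param B \<theta>"
    unfolding chord_param_def using p by (intro diff_strict_right_mono divide_strict_left_mono) auto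
qed

lemma continuous_on_chord_param:
  assumes "1 \<le> A"
  shows "continuous_on {0..1} (chord_param A)"
  unfolding chord_param_def
  using chord_param_denom_pos[OF assms] assms
  by (intro continuous_intros) (auto simp: less_le)

text \<open>\<open>k \<tau>\<close> stands for the volume density of the tangent body in a direction
  at squared projected distance \<tau>. The sign analysis along chords needs only continuity and
  strict growth; the explicit density enters later.\<close>

locale radial_profile =
  fixes k :: "real \<Rightarrow> real"
  assumes k_cont: "continuous_on {0..} k"
    and k_mono: "\<And>s t. 0 \<le> s \<Longrightarrow> s < t \<Longrightarrow> k s < k t"
begin

text \<open>The value \<open>A = 3\<close> is the regular chord, at squared distance 2. This
  constant makes the integral of \<open>\<kappa>\<close> along that chord vanish.\<close>

definition \<mu> :: real where "\<mu> = integral {0..1} (\<lambda>\<theta>. k (chord_param 3 \<theta>))"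

text \<open>The factor \<open>1 / sqrt (1 + \<tau>) ^ 3\<close> is the density of spherical area in
  the central projection.\<close>

definition \<kappa> :: "real \<Rightarrow> real" where "\<kappa> \<tau> = (k \<tau> - \<mu>) / sqrt (1 + \<tau>) ^ 3"

lemma k_mono_le: "0 \<le> s \<Longrightarrow> s \<le> t \<Longrightarrow> k s \<le> k t"
  using k_mono[of s t] by (cases "s = t") auto

lemma continuous_on_k_comp [continuous_intros]:
  assumes "continuous_on S f" "\<And>x. x \<in> S \<Longrightarrow> 0 \<le> f x"
  shows "continuous_on S (\<lambda>x. k (f x))"
  by (rule continuous_on_compose2[OF k_cont assms(1)]) (use assms(2) in auto)

lemma continuous_on_\<kappa>: "continuous_on {0..} \<kappa>"
  unfolding \<kappa>_def by (intro continuous_intros) auto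

lemma continuous_on_\<kappa>_comp [continuous_intros]:
  assumes "continuous_on S f" "\<And>x. x \<in> S \<Longrightarrow> 0 \<le> f x"
  shows "continuous_on S (\<lambda>x. \<kappa> (f x))"
  by (rule continuous_on_compose2[OF continuous_on_\<kappa> assms(1)]) (use assms(2) in auto)

lemma continuous_on_k_chord: 
  assumes "1 \<le> A" "A \<le> 9" shows "continuous_on {0..1} (\<lambda>\<theta>. k (chord_param A \<theta>))"
proof (rule continuous_on_k_comp)
  show "continuous_on {0..1} (chord_param A)" using assms(1) by (rule continuous_on_chord_param)
  show "\<And>x. x \<in> {0..1} \<Longrightarrow> 0 \<le> chord_param A x" using chord_param_bounds(1)[OF assms] assms by force
qed

text \<open>Under the substitution \<open>\<theta> = g v\<close> the differential of \<theta> is a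
  constant times dv / (A + v^2)^(3/2), which is exactly the weight inside \<open>\<kappa>\<close>.
  So the weight disappears and an unweighted mean of \<open>k\<close> remains, whose sign relative
  to \<open>\<mu>\<close> is easy to decide.\<close>

lemma chord_integral:
  assumes z: "0 \<le> z" "z\<^sup>2 < 8"
  shows "integral {0..sqrt (8 - z\<^sup>2)} (\<lambda>v. \<kappa> (z\<^sup>2 + v\<^sup>2)) =
    sqrt (8 - z\<^sup>2) / (3 * (1 + z\<^sup>2)) * (integral {0..1} (\<lambda>\<theta>. k (chord_param (1 + z\<^sup>2) \<theta>)) - \<mu>)"
proof -
  define A where "A = 1 + z\<^sup>2"
  define V where "V = sqrt (8 - z\<^sup>2)"
  \<comment> \<open>Sine of the arc from the midpoint of the chord, divided by its value V / 3 at
    the endpoint, where \<open>A + V\<^sup>2 = 9\<close>.\<close>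
  define g where "g = (\<lambda>v. (3 / V) * (v / sqrt (A + v\<^sup>2)))"
  define g' where "g' = (\<lambda>v. (3 / V) * (A / sqrt (A + v\<^sup>2) ^ 3))"
  define f where "f = (\<lambda>\<theta>. k (chord_param A \<theta>) - \<mu>)"
  have A: "1 \<le> A" "A < 9" and V: "V > 0" "V\<^sup>2 = 9 - A" using z by (auto simp: A_def V_def)
  have AV: "A + v\<^sup>2 > 0" for v using A by (simp add: add_pos_nonneg)
  have g2: "(g v)\<^sup>2 = 9 / (9 - A) * (v\<^sup>2 / (A + v\<^sup>2))" for v
    using A AV[of v] V by (simp add: g_def power_mult_distrib power_divide)
  have gV: "g V = 1" using V A by (simp add: g_def)
  have g0: "g 0 = 0" by (simp add: g_def)
  have key: "chord_param A (g v) = z\<^sup>2 + v\<^sup>2" for v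
  proof -
    have "(1 - (g v)\<^sup>2) / A + (g v)\<^sup>2 / 9 = 1 / A - (g v)\<^sup>2 * ((9 - A) / (9 * A))"
      using A by (simp add: field_simps)
    also have "\<dots> = 1 / A - v\<^sup>2 / (A * (A + v\<^sup>2))"
    proof -
      have "9 / (9 - A) * w * ((9 - A) / (9 * A)) = w / A" for w using A by simp
      from this[of "v\<^sup>2 / (A + v\<^sup>2)"] show ?thesis unfolding g2 by (simp add: mult.commute)
    qed
    also have "\<dots> = 1 / (A + v\<^sup>2)"
    proof -
      have "1 / A - (B - A) / (A * B) = 1 / B" if "B > 0" for B
        using that A by (simp add: diff_divide_distrib)
      from this[OF AV[of v]] show ?thesis by simp
    qed
    finally show ?thesis by (simp add: chord_param_def A_def)
  qed
  have gpos: "0 \<le> g v" if "0 \<le> v" for v using that V A by (auto simp: g_def)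
  have gle: "g v \<le> 1" if "0 \<le> v" "v \<le> V" for v
  proof -
    have "v\<^sup>2 \<le> 9 - A" using power_mono[OF that(2,1), of 2] V by simp
    then have "9 * v\<^sup>2 \<le> (9 - A) * (A + v\<^sup>2)" using mult_left_mono[of "v\<^sup>2" "9-A" A] A by (simp add: algebra_simps)
    then have "(g v)\<^sup>2 \<le> 1" unfolding g2 using A AV[of v] by (simp add: divide_simps)
    then show ?thesis by (rule power2_le_imp_le[where y=1, simplified])
  qed
  have deriv: "(g has_field_derivative g' v) (at v within {0..V})" for v
    unfolding g_def g'_def
  proof (rule DERIV_cmult)
    have p: "sqrt (A + v\<^sup>2) > 0" using AV[of v] by simp
    have sq: "sqrt (A + v\<^sup>2) * sqrt (A + v\<^sup>2) = A + v * v" using AV[of v] by (simp add: power2_eq_square)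
    show "((\<lambda>v. v / sqrt (A + v\<^sup>2)) has_real_derivative A / sqrt (A + v\<^sup>2) ^ 3) (at v within {0..V})"
      using AV[of v] p sq
      by (auto intro!: derivative_eq_intros simp: field_simps power2_eq_square power3_eq_cube)
  qed
  have "((\<lambda>v. g' v *\<^sub>R f (g v)) has_integral integral {g 0..g V} f) {0..V}"
  proof (rule has_integral_substitution[where c=0 and d=1])
    show "continuous_on {0..1} f" unfolding f_def using A by (intro continuous_intros continuous_on_k_chord) auto
  qed (use V gV g0 gpos gle deriv in auto)
  moreover have "g' v *\<^sub>R f (g v) = (3 * A / V) * \<kappa> (z\<^sup>2 + v\<^sup>2)" for v
    unfolding f_def key \<kappa>_def g'_def unfolding A_def by (simp add: add.assoc)
  ultimately have "((\<lambda>v. (3 * A / V) * \<kappa> (z\<^sup>2 + v\<^sup>2)) has_integral integral {0..1} f) {0..V}"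
    using gV g0 by simp
  from has_integral_mult_right[OF this, of "V / (3 * A)"]
  have "((\<lambda>v. \<kappa> (z\<^sup>2 + v\<^sup>2)) has_integral V / (3 * A) * integral {0..1} f) {0..V}"
    using V A by simp
  moreover have "integral {0..1} f = integral {0..1} (\<lambda>\<theta>. k (chord_param A \<theta>)) - \<mu>"
    unfolding f_def using A
    by (subst integral_diff) (auto intro!: integrable_continuous_real continuous_on_k_chord)
  ultimately show ?thesis unfolding A_def V_def by (simp add: has_integral_iff)
qed

lemma mean_k_chord_strict_mono:
  assumes "1 \<le> A" "A < B" "B \<le> 9"
  shows "integral {0..1} (\<lambda>\<theta>. k (chord_param A \<theta>)) < integral {0..1} (\<lambda>\<theta>. k (chord_param B \<theta>))"
proof (rule integral_strict_mono_continuous[where c=0])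
  fix x :: real assume "x \<in> {0..1}"
  then show "k (chord_param A x) \<le> k (chord_param B x)"
    using assms chord_param_bounds(1)[of A x] by (intro k_mono_le chord_param_mono) auto
next
  show "k (chord_param A 0) < k (chord_param B 0)"
    using assms chord_param_bounds(1)[of A 0] by (intro k_mono chord_param_mono) auto
qed (use assms in \<open>auto intro!: continuous_on_k_chord\<close>)

lemma chord_integral_neg:
  assumes "0 \<le> z" "z\<^sup>2 < 2"
  shows "integral {0..sqrt (8 - z\<^sup>2)} (\<lambda>v. \<kappa> (z\<^sup>2 + v\<^sup>2)) < 0"
proof -
  have "integral {0..1} (\<lambda>\<theta>. k (chord_param (1 + z\<^sup>2) \<theta>)) < \<mu>"
    unfolding \<mu>_def using assms by (intro mean_k_chord_strict_mono) auto
  moreover have "sqrt (8 - z\<^sup>2) / (3 * (1 + z\<^sup>2)) > 0"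
    using assms by (intro divide_pos_pos mult_pos_pos add_pos_nonneg) auto
  ultimately show ?thesis using assms
    by (subst chord_integral) (auto intro!: mult_pos_neg simp del: times_divide_eq_left)
qed

lemma chord_integral_zero: "integral {0..sqrt 6} (\<lambda>v. \<kappa> (2 + v\<^sup>2)) = 0"
  using chord_integral[of "sqrt 2"] by (simp add: \<mu>_def)

lemma chord_integral_pos:
  assumes "0 \<le> z" "2 < z\<^sup>2" "z\<^sup>2 < 8"
  shows "integral {0..sqrt (8 - z\<^sup>2)} (\<lambda>v. \<kappa> (z\<^sup>2 + v\<^sup>2)) > 0"
proof -
  have "integral {0..1} (\<lambda>\<theta>. k (chord_param (1 + z\<^sup>2) \<theta>)) > \<mu>"
    unfolding \<mu>_def using assms by (intro mean_k_chord_strict_mono) auto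
  moreover have "sqrt (8 - z\<^sup>2) / (3 * (1 + z\<^sup>2)) > 0"
    using assms by (intro divide_pos_pos mult_pos_pos add_pos_nonneg) auto
  ultimately show ?thesis using assms
    by (subst chord_integral) (auto intro!: mult_pos_pos simp del: times_divide_eq_left)
qed

text \<open>Along the regular chord \<tau> runs from 2 to 8, and a mean lies strictly between the
  extreme values.\<close>

lemma k_between: "k 2 < \<mu>" "\<mu> < k 8"
proof -
  have c: "continuous_on {0..1} (\<lambda>\<theta>. k (chord_param 3 \<theta>))" by (rule continuous_on_k_chord) auto
  have b: "2 \<le> chord_param 3 \<theta> \<and> chord_param 3 \<theta> \<le> 8" if "\<theta> \<in> {0..1}" for \<theta>
    using chord_param_bounds[of 3 \<theta>] that by auto
  have "integral {0..1} (\<lambda>\<theta>::real. k 2) < \<mu>" unfolding \<mu>_def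
    by (rule integral_strict_mono_continuous[where c=1])
       (use c b in \<open>auto intro!: k_mono_le k_mono simp: chord_param_def\<close>)
  then show "k 2 < \<mu>" by simp
  have "\<mu> < integral {0..1} (\<lambda>\<theta>::real. k 8)" unfolding \<mu>_def
    by (rule integral_strict_mono_continuous[where c=0])
       (use c b in \<open>force intro!: k_mono_le k_mono simp: chord_param_def\<close>)+
  then show "\<mu> < k 8" by simp
qed

lemma threshold_exists:
  obtains \<tau>\<^sub>0 where "2 < \<tau>\<^sub>0" "\<tau>\<^sub>0 < 8" "k \<tau>\<^sub>0 = \<mu>"
    "\<And>\<tau>. 0 \<le> \<tau> \<Longrightarrow> \<tau> < \<tau>\<^sub>0 \<Longrightarrow> \<kappa> \<tau> < 0" "\<And>\<tau>. \<tau>\<^sub>0 < \<tau> \<Longrightarrow> 0 < \<kappa> \<tau>"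
proof -
  have "\<exists>x\<ge>2. x \<le> 8 \<and> k x = \<mu>"
    by (rule IVT') (use k_between in \<open>auto intro!: continuous_intros simp: less_imp_le\<close>)
  then obtain x where x: "2 \<le> x" "x \<le> 8" "k x = \<mu>" by auto
  show ?thesis
  proof (rule that[of x])
    show "2 < x" "x < 8" using x k_between by (auto simp: order.strict_iff_order)
    show "\<kappa> \<tau> < 0" if "0 \<le> \<tau>" "\<tau> < x" for \<tau>
      using k_mono[OF that] x that by (simp add: \<kappa>_def divide_neg_pos)
    show "0 < \<kappa> \<tau>" if "x < \<tau>" for \<tau>
      using k_mono[of x \<tau>] x that by (simp add: \<kappa>_def)
  qed (use x in auto)
qed

lemma \<kappa>_neg: "0 \<le> \<tau> \<Longrightarrow> \<tau> \<le> 2 \<Longrightarrow> \<kappa> \<tau> < 0"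
  by (rule threshold_exists) (metis order_le_less_trans)

text \<open>Along a chord at squared distance \<open>a\<close> the sign of \<open>\<kappa>\<close>
  changes once, from negative to positive, at v = w; hence (v - w) times \<open>\<kappa>\<close> is
  never negative. Since the threshold exceeds 2, \<open>a \<le> 2\<close> gives w > 0. Integrated,
  this compares the uniform weight on a chord with the weight v, which is the one occurring in
  radial integrals.\<close>

lemma \<kappa>_crossing:
  assumes a: "0 \<le> a" "a \<le> 2"
  shows "\<exists>w>0. \<forall>v\<ge>0. w * \<kappa> (a + v\<^sup>2) \<le> v * \<kappa> (a + v\<^sup>2)"
proof -
  obtain x where x: "2 < x" "k x = \<mu>" "\<And>\<tau>. 0 \<le> \<tau> \<Longrightarrow> \<tau> < x \<Longrightarrow> \<kappa> \<tau> < 0" "\<And>\<tau>. x < \<tau> \<Longrightarrow> 0 < \<kappa> \<tau>"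
    by (rule threshold_exists) blast
  define w where "w = sqrt (x - a)"
  have w: "w > 0" "w\<^sup>2 = x - a" using x(1) a by (auto simp: w_def)
  have "w * \<kappa> (a + v\<^sup>2) \<le> v * \<kappa> (a + v\<^sup>2)" if "0 \<le> v" for v
  proof (cases "v \<le> w")
    case True
    then have "v\<^sup>2 \<le> x - a" using that w power_mono[of v w 2] by simp
    then have "\<kappa> (a + v\<^sup>2) \<le> 0"
      using x(2) x(3)[of "a + v\<^sup>2"] a by (cases "v\<^sup>2 = x - a") (auto simp: \<kappa>_def[of x])
    then show ?thesis using True by (auto intro: mult_right_mono_neg)
  next
    case False
    then have "v\<^sup>2 > x - a" using w power_strict_mono[of w v 2] by simp
    then have "\<kappa> (a + v\<^sup>2) > 0" using x(4)[of "a + v\<^sup>2"] by simp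
    then show ?thesis using False by (auto intro: mult_right_mono)
  qed
  then show ?thesis using w(1) by blast
qed

lemma radial_substitution:
  assumes "0 \<le> a" "a \<le> b" "0 \<le> w" "0 \<le> c"
  shows "((\<lambda>v. (2 * c * v) * \<kappa> (w + c * v\<^sup>2)) has_integral integral {w + c * a\<^sup>2..w + c * b\<^sup>2} \<kappa>) {a..b}"
proof -
  have "((\<lambda>v. (2 * c * v) *\<^sub>R \<kappa> (w + c * v\<^sup>2)) has_integral integral {w + c * a\<^sup>2..w + c * b\<^sup>2} \<kappa>) {a..b}"
  proof (rule has_integral_substitution[where c="w + c * a\<^sup>2" and d="w + c * b\<^sup>2"])
    show "w + c * a\<^sup>2 \<le> w + c * b\<^sup>2" using assms by (auto intro!: mult_left_mono power_mono)
    show "(\<lambda>v. w + c * v\<^sup>2) ` {a..b} \<subseteq> {w + c * a\<^sup>2..w + c * b\<^sup>2}"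
      using assms by (auto intro!: mult_left_mono power_mono)
    show "continuous_on {w + c * a\<^sup>2..w + c * b\<^sup>2} \<kappa>"
      by (rule continuous_on_subset[OF continuous_on_\<kappa>]) (use assms in \<open>auto intro: order_trans[OF add_nonneg_nonneg]\<close>)
  qed (use assms in \<open>auto intro!: derivative_eq_intros\<close>)
  then show ?thesis by simp
qed

text \<open>On the regular chord the uniform weight gives zero, so the weight v, which favours the
  positive outer part, gives more than zero. With \<tau> = 2 + v^2 the weight v produces the plain
  integral over \<tau>.\<close>

lemma integral_\<kappa>_2_8_pos: "integral {2..8} \<kappa> > 0"
proof -
  obtain w where w: "0 < w" "\<And>v. 0 \<le> v \<Longrightarrow> w * \<kappa> (2 + v\<^sup>2) \<le> v * \<kappa> (2 + v\<^sup>2)"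
    using \<kappa>_crossing[of 2] by auto
  have "integral {0..sqrt 6} (\<lambda>v. w * \<kappa> (2 + v\<^sup>2)) < integral {0..sqrt 6} (\<lambda>v. v * \<kappa> (2 + v\<^sup>2))"
  proof (rule integral_strict_mono_continuous[where c="0"])
    show "w * \<kappa> (2 + 0\<^sup>2) < 0 * \<kappa> (2 + 0\<^sup>2)" using w \<kappa>_neg[of 2] by (auto simp: mult_less_0_iff)
  qed (use w in \<open>auto intro!: continuous_intros\<close>)
  moreover have "((\<lambda>v. 2 * (v * \<kappa> (2 + v\<^sup>2))) has_integral integral {2..8} \<kappa>) {0..sqrt 6}"
    using radial_substitution[of 0 "sqrt 6" 2 1] by (simp add: mult.assoc)
  ultimately show ?thesis using chord_integral_zero by (simp add: has_integral_iff)
qed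

text \<open>Near the centre, up to squared radius \<open>\<sigma>\<close>, the function \<open>\<kappa>\<close> will be discarded, which makes all outward
  radial integrals nonnegative.\<close>
lemma cutoff_exists:
  obtains \<sigma> where "0 \<le> \<sigma>" "\<sigma> < 2" "0 \<le> integral {\<sigma>..8} \<kappa>" "0 < \<sigma> \<Longrightarrow> integral {\<sigma>..8} \<kappa> = 0"
proof (cases "0 \<le> integral {0..8} \<kappa>")
  case True
  then show ?thesis by (intro that[of 0]) auto
next
  case False
  have "continuous_on {0..8} (\<lambda>s. integral {s..8} \<kappa>)"
    by (rule indefinite_integral_continuous_1') (auto intro!: integrable_continuous_real continuous_on_subset[OF continuous_on_\<kappa>])
  then have "continuous_on {0..2} (\<lambda>s. integral {s..8} \<kappa>)" by (rule continuous_on_subset) auto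
  then have "\<exists>s\<ge>0. s \<le> 2 \<and> integral {s..8} \<kappa> = 0"
    using False integral_\<kappa>_2_8_pos by (intro IVT') auto
  then obtain s where "0 \<le> s" "s \<le> 2" "integral {s..8} \<kappa> = 0" by auto
  moreover from this have "s \<noteq> 2" using integral_\<kappa>_2_8_pos by auto
  ultimately show ?thesis by (intro that[of s]) auto
qed

text \<open>The part of the chord outside the cut circle has \<tau> running from \<sigma> to 8, so
  with weight v its integral is half of \<open>integral {\<sigma>..8} \<kappa>\<close>, which is
  zero. By the crossing inequality the uniform weight can only give less.\<close>

lemma chord_integral_cut:
  assumes \<sigma>: "\<sigma> < 2" "integral {\<sigma>..8} \<kappa> = 0" and z: "0 \<le> z" "z\<^sup>2 < \<sigma>"
  shows "integral {sqrt (\<sigma> - z\<^sup>2)..sqrt (8 - z\<^sup>2)} (\<lambda>v. \<kappa> (z\<^sup>2 + v\<^sup>2)) \<le> 0"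
proof -
  define a where "a = sqrt (\<sigma> - z\<^sup>2)"
  define b where "b = sqrt (8 - z\<^sup>2)"
  have ab: "0 \<le> a" "a \<le> b" "z\<^sup>2 + a\<^sup>2 = \<sigma>" "z\<^sup>2 + b\<^sup>2 = 8" using \<sigma> z by (auto simp: a_def b_def)
  have "z\<^sup>2 \<le> 2" using z \<sigma> by simp
  then obtain w where w: "0 < w" "\<And>v. 0 \<le> v \<Longrightarrow> w * \<kappa> (z\<^sup>2 + v\<^sup>2) \<le> v * \<kappa> (z\<^sup>2 + v\<^sup>2)"
    using \<kappa>_crossing[of "z\<^sup>2"] by auto
  have "integral {a..b} (\<lambda>v. w * \<kappa> (z\<^sup>2 + v\<^sup>2)) \<le> integral {a..b} (\<lambda>v. v * \<kappa> (z\<^sup>2 + v\<^sup>2))"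
    by (rule integral_le) (use w ab in \<open>auto intro!: integrable_continuous_real continuous_intros\<close>)
  moreover have "((\<lambda>v. 2 * (v * \<kappa> (z\<^sup>2 + v\<^sup>2))) has_integral 0) {a..b}"
    using radial_substitution[of a b "z\<^sup>2" 1] ab \<sigma> by (simp add: mult.assoc)
  ultimately show ?thesis using w unfolding a_def[symmetric] b_def[symmetric]
    by (simp add: has_integral_iff mult_le_0_iff)
qed

end

section \<open>Planar Lebesgue measure\<close>

text \<open>Relabelling coordinates takes boxes to boxes with the same side lengths. This moves
  volume between vectors and iterated pairs, where Fubini can be applied.\<close>

lemma distr_lborel_Basis_map:
  fixes f :: "'a::euclidean_space \<Rightarrow> 'b::euclidean_space"
  assumes f: "linear f" and b: "bij_betw f Basis Basis"
  shows "distr lborel borel f = lborel"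
proof (rule lborel_eqI[symmetric])
  fix l u :: 'b assume le: "\<And>b. b \<in> Basis \<Longrightarrow> l \<bullet> b \<le> u \<bullet> b"
  have [measurable]: "f \<in> borel_measurable borel"
    using f by (intro borel_measurable_continuous_onI linear_continuous_on linear_conv_bounded_linear[THEN iffD1])
  \<comment> \<open>The adjoint of \<open>f\<close>; it gives the corners of the preimage of a
    box.\<close>
  define adj where "adj = (\<lambda>y. \<Sum>b\<in>Basis. (y \<bullet> f b) *\<^sub>R b)"
  have fb: "f b \<in> Basis" if "b \<in> Basis" for b using b that by (auto simp: bij_betw_def)
  have inner_f: "f x \<bullet> f b = x \<bullet> b" if "b \<in> Basis" for x b
  proof -
    have "f x = f (\<Sum>c\<in>Basis. (x \<bullet> c) *\<^sub>R c)" by (simp add: euclidean_representation)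
    also have "\<dots> = (\<Sum>c\<in>Basis. (x \<bullet> c) *\<^sub>R f c)" by (simp add: linear_sum[OF f] linear_scale[OF f])
    finally have "f x \<bullet> f b = (\<Sum>c\<in>Basis. (x \<bullet> c) * (f c \<bullet> f b))" by (simp add: inner_sum_left)
    also have "\<dots> = (\<Sum>c\<in>Basis. if c = b then x \<bullet> c else 0)"
      using b that fb by (intro sum.cong) (auto simp: inner_Basis bij_betw_def dest: inj_onD)
    finally show ?thesis using that by simp
  qed
  have adj: "adj y \<bullet> b = y \<bullet> f b" if "b \<in> Basis" for y b
    using that by (simp add: adj_def inner_sum_left inner_Basis if_distrib cong: if_cong)
  have "f -` box l u = box (adj l) (adj u)"
  proof (rule set_eqI)
    fix x
    have "x \<in> f -` box l u \<longleftrightarrow> (\<forall>c\<in>f ` Basis. l \<bullet> c < f x \<bullet> c \<and> f x \<bullet> c < u \<bullet> c)"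
      using b by (simp add: mem_box bij_betw_def)
    then show "x \<in> f -` box l u \<longleftrightarrow> x \<in> box (adj l) (adj u)"
      by (simp add: mem_box inner_f adj)
  qed
  then have "emeasure (distr lborel borel f) (box l u) = emeasure lborel (box (adj l) (adj u))"
    by (simp add: emeasure_distr)
  also have "\<dots> = (\<Prod>b\<in>Basis. (adj u - adj l) \<bullet> b)"
    using le fb by (subst emeasure_lborel_box) (auto simp: adj)
  also have "(\<Prod>b\<in>Basis. (adj u - adj l) \<bullet> b) = (\<Prod>b\<in>Basis. (u - l) \<bullet> f b)"
    by (intro prod.cong) (auto simp: adj inner_diff_left)
  also have "\<dots> = (\<Prod>c\<in>Basis. (u - l) \<bullet> c)"
    by (rule prod.reindex_bij_betw[OF b])
  finally show "emeasure (distr lborel borel f) (box l u) = (\<Prod>b\<in>Basis. (u - l) \<bullet> b)" .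
qed simp

lemma distr_lborel_orthogonal:
  fixes f :: "real^'n::{finite,wellorder} \<Rightarrow> real^'n::{finite,wellorder}"
  assumes f: "orthogonal_transformation f"
  shows "distr lborel borel f = lborel"
proof (rule lborel_eqI[symmetric])
  fix l u :: "real^'n::{finite,wellorder}" assume le: "\<And>b. b \<in> Basis \<Longrightarrow> l \<bullet> b \<le> u \<bullet> b"
  have lin: "linear f" using f by (rule orthogonal_transformation_linear)
  have [measurable]: "f \<in> borel_measurable borel"
    using lin by (intro borel_measurable_continuous_onI linear_continuous_on linear_conv_bounded_linear[THEN iffD1])
  define g where "g = inv f"
  have g: "orthogonal_transformation g" unfolding g_def using f by (rule orthogonal_transformation_inv)
  have "f -` box l u = g ` box l u"
    unfolding g_def by (rule bij_vimage_eq_inv_image) (rule orthogonal_transformation_bij[OF f])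
  moreover have "emeasure lborel (g ` box l u) = emeasure lborel (box l u)"
  proof -
    have m: "f -` box l u \<in> sets borel" by (rule measurable_sets_borel[of f borel]) auto
    then have b: "g ` box l u \<in> sets borel" by (simp add: calculation)
    have lm: "g ` box l u \<in> lmeasurable" by (rule measurable_orthogonal_image[OF g]) simp
    have "emeasure lborel (g ` box l u) = emeasure lebesgue (g ` box l u)" using b by simp
    also have "\<dots> = measure lebesgue (g ` box l u)" using lm by (simp add: emeasure_eq_measure2)
    also have "measure lebesgue (g ` box l u) = measure lebesgue (box l u)"
      by (rule measure_orthogonal_image[OF g]) simp
    also have "ennreal \<dots> = emeasure lebesgue (box l u)" 
      using lmeasurable_box[of l u] by (simp add: emeasure_eq_measure2)
    finally show ?thesis by simp
  qed
  ultimately have "emeasure (distr lborel borel f) (box l u) = emeasure lborel (box l u)"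
    by (simp add: emeasure_distr)
  then show "emeasure (distr lborel borel f) (box l u) = (\<Prod>b\<in>Basis. (u - l) \<bullet> b)"
    using le by (subst (asm) emeasure_lborel_box) auto
qed simp

lemma distr_lborel_coords2: "distr lborel borel (\<lambda>x::real^2. (x$1, x$2)) = lborel"
proof (rule distr_lborel_Basis_map)
  show "linear (\<lambda>x::real^2. (x$1, x$2))" by (rule linearI) auto
  show "bij_betw (\<lambda>x::real^2. (x$1, x$2)) Basis Basis"
    unfolding bij_betw_def
    by (auto simp: inj_on_def Basis_vec_def Basis_prod_def axis_def UNIV_2 vec_eq_iff image_iff forall_2)
qed

lemma distr_lborel_coords4: "distr lborel borel (\<lambda>x::real^4. (x$1, x$2, x$3, x$4)) = lborel"
proof (rule distr_lborel_Basis_map)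
  show "linear (\<lambda>x::real^4. (x$1, x$2, x$3, x$4))" by (rule linearI) auto
  show "bij_betw (\<lambda>x::real^4. (x$1, x$2, x$3, x$4)) Basis Basis"
    unfolding bij_betw_def
  proof
    show "inj_on (\<lambda>x::real^4. (x$1, x$2, x$3, x$4)) Basis"
      by (rule inj_onI) (simp add: vec_eq_iff forall_4)
    have b1: "(Basis :: (real^4) set) = {axis (1::4) (1::real), axis 2 1, axis 3 1, axis 4 1}"
      by (auto simp: Basis_vec_def UNIV_4)
    have b2: "(Basis :: (real \<times> real \<times> real \<times> real) set) =
        {(1, 0, 0, 0), (0, 1, 0, 0), (0, 0, 1, 0), (0, 0, 0, 1)}"
      by (simp add: Basis_prod_def zero_prod_def insert_commute)
    show "(\<lambda>x::real^4. (x$1, x$2, x$3, x$4)) ` Basis = Basis"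
      unfolding b1 b2 by (simp add: axis_def)
  qed
qed

text \<open>This rotation takes the second axis to the direction \<open>(p, q)\<close>. It is
  carried over from \<open>real^2\<close>, where invariance under orthogonal maps is
  available.\<close>

lemma distr_lborel_plane_rotation:
  fixes p q :: real
  assumes pq: "p\<^sup>2 + q\<^sup>2 = 1"
  shows "distr lborel borel (\<lambda>v::real\<times>real. (q * fst v + p * snd v, q * snd v - p * fst v)) = lborel"
    (is "distr _ _ ?L = _")
proof -
  define f where "f = (\<lambda>x::real^2. (x$1, x$2))"
  define R where "R = (\<lambda>x::real^2. vector [q * x$1 + p * x$2, q * x$2 - p * x$1] :: real^2)"
  have R: "orthogonal_transformation R"
    unfolding orthogonal_transformation
  proof
    show "linear R" by (rule linearI) (auto simp: R_def vec_eq_iff forall_2 algebra_simps)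
    have "(R x) \<bullet> (R x) = (p\<^sup>2 + q\<^sup>2) * (x \<bullet> x)" for x
      by (simp add: R_def inner_vec_def sum_2 power2_eq_square algebra_simps)
    then show "\<forall>v. norm (R v) = norm v" using pq by (simp add: norm_eq_sqrt_inner)
  qed
  have [measurable]: "f \<in> borel_measurable borel" unfolding f_def
    by (intro borel_measurable_continuous_onI continuous_intros)
  have [measurable]: "R \<in> borel_measurable borel" 
    using orthogonal_transformation_linear[OF R]
    by (intro borel_measurable_continuous_onI linear_continuous_on linear_conv_bounded_linear[THEN iffD1])
  have [measurable]: "?L \<in> borel_measurable borel"
    by (intro borel_measurable_continuous_onI continuous_intros)
  have "distr lborel borel ?L = distr (distr lborel borel f) borel ?L"
    by (simp add: f_def distr_lborel_coords2)
  also have "\<dots> = distr lborel borel (?L \<circ> f)" by (subst distr_distr) auto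
  also have "?L \<circ> f = f \<circ> R" by (auto simp: f_def R_def fun_eq_iff)
  also have "distr lborel borel (f \<circ> R) = distr (distr lborel borel R) borel f"
    by (subst distr_distr) auto
  also have "\<dots> = lborel" using distr_lborel_orthogonal[OF R] by (simp add: f_def distr_lborel_coords2)
  finally show ?thesis .
qed

lemma lborel_slope:
  "(lborel :: (real\<times>real) measure) =
    distr (density lborel (\<lambda>w. ennreal \<bar>fst w\<bar>)) borel (\<lambda>w. (fst w, fst w * snd w))"
proof (rule measure_eqI)
  fix X :: "(real\<times>real) set" assume "X \<in> sets lborel"
  then have X[measurable]: "X \<in> sets borel" by simp
  have m: "(\<lambda>w::real\<times>real. (fst w, fst w * snd w)) \<in> borel_measurable borel"
    by (intro borel_measurable_continuous_onI continuous_intros)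
  define L where "L = (\<lambda>w::real\<times>real. (fst w, fst w * snd w))"
  have L[measurable]: "L \<in> borel_measurable borel" using m by (simp add: L_def)
  have LX: "L -` X \<in> sets borel" by (rule measurable_sets_borel[OF L X])
  have "emeasure (distr (density lborel (\<lambda>w. ennreal \<bar>fst w\<bar>)) borel L) X
      = emeasure (density lborel (\<lambda>w. ennreal \<bar>fst w\<bar>)) (L -` X)"
    by (subst emeasure_distr) auto
  also have "\<dots> = (\<integral>\<^sup>+ w. ennreal \<bar>fst w\<bar> * indicator (L -` X) w \<partial>lborel)"
  proof -
    have "(\<lambda>w::real\<times>real. \<bar>fst w\<bar>) \<in> borel_measurable borel"
      by (intro borel_measurable_continuous_onI continuous_intros)
    then show ?thesis using LX by (subst emeasure_density) simp_all
  qed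
  also have "\<dots> = (\<integral>\<^sup>+ w. ennreal \<bar>fst w\<bar> * indicator (L -` X) w \<partial>(lborel \<Otimes>\<^sub>M lborel))"
    by (simp add: lborel_prod)
  also have "\<dots> = (\<integral>\<^sup>+ a. \<integral>\<^sup>+ s. ennreal \<bar>a\<bar> * indicator X (a, a * s) \<partial>lborel \<partial>lborel)"
  proof -
    have [measurable]: "(\<lambda>w::real\<times>real. \<bar>fst w\<bar>) \<in> borel_measurable borel"
      by (intro borel_measurable_continuous_onI continuous_intros)
    have "(\<lambda>w. ennreal \<bar>fst w\<bar> * indicator (L -` X) w) \<in> borel_measurable borel"
      using LX by simp
    then have "(\<integral>\<^sup>+ w. ennreal \<bar>fst w\<bar> * indicator (L -` X) w \<partial>(lborel \<Otimes>\<^sub>M lborel)) =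
       (\<integral>\<^sup>+ a. \<integral>\<^sup>+ s. ennreal \<bar>a\<bar> * indicator (L -` X) (a, s) \<partial>lborel \<partial>lborel)"
      by (subst lborel.nn_integral_fst[symmetric]) (simp_all add: lborel_prod del: vimage_eq)
    then show ?thesis by (simp add: L_def indicator_def)
  qed
  also have "\<dots> = (\<integral>\<^sup>+ a. \<integral>\<^sup>+ t. indicator X (a, t) \<partial>lborel \<partial>lborel)"
  proof (rule nn_integral_cong_AE)
    have "AE a in lborel. a \<noteq> (0::real)" by (rule AE_lborel_singleton)
    then show "AE a in lborel. (\<integral>\<^sup>+ s. ennreal \<bar>a\<bar> * indicator X (a, a * s) \<partial>lborel) =
        (\<integral>\<^sup>+ t. indicator X (a, t) \<partial>lborel)"
    proof eventually_elim
      case (elim a)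
      have "Pair a \<in> borel_measurable borel" "(\<lambda>s. (a, a * s)) \<in> borel_measurable borel"
        by (intro borel_measurable_continuous_onI continuous_intros)+
      then have p: "Pair a -` X \<in> sets borel" "(\<lambda>s. (a, a * s)) -` X \<in> sets borel"
        by (auto intro: measurable_sets_borel[OF _ X])
      have "(\<integral>\<^sup>+ t. indicator (Pair a -` X) t \<partial>lborel) =
          \<bar>a\<bar> * (\<integral>\<^sup>+ s. indicator (Pair a -` X) (0 + a * s) \<partial>lborel)"
        using elim p by (intro nn_integral_real_affine) auto
      also have "(\<integral>\<^sup>+ s. indicator (Pair a -` X) (0 + a * s) \<partial>lborel) =
          (\<integral>\<^sup>+ s. indicator ((\<lambda>s. (a, a * s)) -` X) s \<partial>lborel)"
        by (simp add: indicator_def)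
      also have "\<bar>a\<bar> * \<dots> = (\<integral>\<^sup>+ s. ennreal \<bar>a\<bar> * indicator ((\<lambda>s. (a, a * s)) -` X) s \<partial>lborel)"
        using p by (subst nn_integral_cmult) auto
      finally show ?case by (simp add: indicator_def)
    qed
  qed
  also have "\<dots> = (\<integral>\<^sup>+ w. indicator X w \<partial>(lborel \<Otimes>\<^sub>M lborel))"
    using X by (subst lborel.nn_integral_fst[symmetric]) (simp_all add: lborel_prod)
  also have "\<dots> = emeasure lborel X" using X by (simp add: lborel_prod)
  finally show "emeasure lborel X =
    emeasure (distr (density lborel (\<lambda>w. ennreal \<bar>fst w\<bar>)) borel (\<lambda>w. (fst w, fst w * snd w))) X"
    by (simp add: L_def)
qed simp

lemma has_bochner_integral_interval:
  fixes f :: "real \<Rightarrow> real"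
  assumes "continuous_on {a..b} f"
  shows "integrable lborel (\<lambda>x. indicator {a..b} x * f x)"
    "(\<integral>x. indicator {a..b} x * f x \<partial>lborel) = integral {a..b} f"
proof -
  have s: "set_integrable lborel {a..b} f"
    using assms by (rule borel_integrable_atLeastAtMost')
  then show "integrable lborel (\<lambda>x. indicator {a..b} x * f x)" by (simp add: set_integrable_def)
  show "(\<integral>x. indicator {a..b} x * f x \<partial>lborel) = integral {a..b} f"
    using set_borel_integral_eq_integral(2)[OF s] by (simp add: set_lebesgue_integral_def)
qed

lemma integral_pos_on_interval:
  fixes f :: "real \<Rightarrow> real"
  assumes i: "integrable lborel f" and nn: "\<And>x. 0 \<le> f x" and ab: "a < b"
    and pos: "\<And>x. a < x \<Longrightarrow> x < b \<Longrightarrow> 0 < f x"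
  shows "0 < (\<integral>x. f x \<partial>lborel)"
proof (rule ccontr)
  assume "\<not> ?thesis"
  then have "(\<integral>x. f x \<partial>lborel) = 0" using nn by (simp add: order.antisym)
  then have "AE x in lborel. f x = 0"
    using i nn by (subst (asm) integral_nonneg_eq_0_iff_AE) auto
  then have "AE x in lborel. x \<notin> {a<..<b}"
    by eventually_elim (use pos in force)
  then have "emeasure lborel {a<..<b} = 0"
    by (subst (asm) AE_iff_measurable[of "{a<..<b}"]) auto
  then show False using ab by simp
qed

section \<open>The truncated profile: outward sets, overlaps and half planes\<close>

locale cutoff_profile = radial_profile +
  fixes \<sigma> :: real
  assumes \<sigma>_bounds: "0 \<le> \<sigma>" "\<sigma> < 2"
    and \<sigma>_nonneg: "0 \<le> integral {\<sigma>..8} \<kappa>"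
    and \<sigma>_zero: "0 < \<sigma> \<Longrightarrow> integral {\<sigma>..8} \<kappa> = 0"
begin

definition \<kappa>c :: "real \<Rightarrow> real" where "\<kappa>c \<tau> = indicator {\<sigma>..8} \<tau> * \<kappa> \<tau>"

lemma \<kappa>_measurable_restrict: "(\<lambda>\<tau>. indicator {a..b} \<tau> * \<kappa> \<tau>) \<in> borel_measurable borel" if "0 \<le> a"
  using borel_measurable_continuous_on_indicator[of "{a..b}" \<kappa>] continuous_on_subset[OF continuous_on_\<kappa>, of "{a..b}"] that
  by auto

lemma \<kappa>c_measurable [measurable]: "\<kappa>c \<in> borel_measurable borel"
  unfolding \<kappa>c_def using \<kappa>_measurable_restrict \<sigma>_bounds by blast

lemma \<kappa>_bounded: obtains M where "0 < M" "\<And>\<tau>. 0 \<le> \<tau> \<Longrightarrow> \<tau> \<le> 8 \<Longrightarrow> \<bar>\<kappa> \<tau>\<bar> \<le> M"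
proof -
  have "compact (\<kappa> ` {0..8})"
    by (rule compact_continuous_image) (auto intro: continuous_on_subset[OF continuous_on_\<kappa>])
  then obtain M where "0 < M" "\<And>x. x \<in> \<kappa> ` {0..8} \<Longrightarrow> norm x \<le> M"
    using compact_imp_bounded bounded_pos by metis
  then show ?thesis by (intro that[of M]) auto
qed

lemma \<kappa>c_bounded: obtains M where "0 < M" "\<And>\<tau>. \<bar>\<kappa>c \<tau>\<bar> \<le> M"
proof -
  obtain M where M: "0 < M" "\<And>\<tau>. 0 \<le> \<tau> \<Longrightarrow> \<tau> \<le> 8 \<Longrightarrow> \<bar>\<kappa> \<tau>\<bar> \<le> M" by (rule \<kappa>_bounded) blast
  then show ?thesis using \<sigma>_bounds
    by (intro that[of M]) (auto simp: \<kappa>c_def indicator_def)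
qed

lemma \<kappa>c_support: "\<kappa>c \<tau> \<noteq> 0 \<Longrightarrow> \<sigma> \<le> \<tau> \<and> \<tau> \<le> 8"
  by (auto simp: \<kappa>c_def indicator_def split: if_splits)

abbreviation \<kappa>p :: "real \<times> real \<Rightarrow> real" where "\<kappa>p v \<equiv> \<kappa>c ((norm v)\<^sup>2)"

lemma integrable_\<kappa>p:
  assumes "X \<in> sets borel"
  shows "integrable lborel (\<lambda>v. indicator X v * \<kappa>p v)"
proof -
  obtain M where M: "0 < M" "\<And>\<tau>. \<bar>\<kappa>c \<tau>\<bar> \<le> M" by (rule \<kappa>c_bounded) blast
  show ?thesis
  proof (rule Bochner_Integration.integrable_bound)
    show "integrable lborel (\<lambda>v::real\<times>real. M * indicator (cball 0 (sqrt 8)) v)"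
      by (intro integrable_mult_right integrable_real_indicator emeasure_lborel_cball_finite) auto
    show "(\<lambda>v. indicator X v * \<kappa>p v) \<in> borel_measurable lborel" using assms by simp
    show "AE v in lborel. norm (indicator X v * \<kappa>p v) \<le> norm (M * indicator (cball 0 (sqrt 8)) v)"
    proof (intro always_eventually allI)
      fix v :: "real \<times> real"
      show "norm (indicator X v * \<kappa>p v) \<le> norm (M * indicator (cball 0 (sqrt 8)) v)"
        using M(1) M(2)[of "(norm v)\<^sup>2"] \<kappa>c_support[of "(norm v)\<^sup>2"] real_le_rsqrt[of "norm v" 8]
        by (auto simp: indicator_def)
    qed
  qed
qed

text \<open>\<open>\<kappa>\<close> is negative before the threshold and nonnegative from there on.
  If \<open>U\<close> has no positive point before the threshold, the integrand is nonnegative.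
  Otherwise the positive points missing from \<open>U\<close> all lie before the threshold, so
  enlarging \<open>U\<close> to the full ray only lowers the integral, and the full ray gives
  \<open>integral {\<sigma>..8} \<kappa>\<close> divided by 2c.\<close>

lemma ray_integral_nonneg:
  assumes c: "0 < c" and U: "U \<in> sets borel"
    and up: "\<And>a b. a \<in> U \<Longrightarrow> 0 < a \<Longrightarrow> a \<le> b \<Longrightarrow> b \<in> U"
  shows "integrable lborel (\<lambda>a. indicator U a * (indicator {0<..} a * (a * \<kappa>c (c * a\<^sup>2))))"
    and "0 \<le> (\<integral>a. indicator U a * (indicator {0<..} a * (a * \<kappa>c (c * a\<^sup>2))) \<partial>lborel)"
proof -
  define a0 where "a0 = sqrt (\<sigma> / c)"
  define b0 where "b0 = sqrt (8 / c)"
  have ab: "0 \<le> a0" "a0 \<le> b0" "c * a0\<^sup>2 = \<sigma>" "c * b0\<^sup>2 = 8"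
    using c \<sigma>_bounds by (auto simp: a0_def b0_def divide_right_mono)
  define f where "f = (\<lambda>a. indicator {0<..} a * (a * \<kappa>c (c * a\<^sup>2)))"
  have f_eq: "f a = indicator {a0..b0} a * (a * \<kappa> (c * a\<^sup>2))" for a
  proof (cases "a > 0")
    case True
    have "a0 \<le> a \<longleftrightarrow> \<sigma> \<le> c * a\<^sup>2"
    proof -
      have "a0 \<le> a \<longleftrightarrow> a0\<^sup>2 \<le> a\<^sup>2" using True ab by (simp add: power_mono_iff)
      also have "\<dots> \<longleftrightarrow> c * a0\<^sup>2 \<le> c * a\<^sup>2" using c by simp
      finally show ?thesis using ab by simp
    qed
    moreover have "a \<le> b0 \<longleftrightarrow> c * a\<^sup>2 \<le> 8"
    proof -
      have "a \<le> b0 \<longleftrightarrow> a\<^sup>2 \<le> b0\<^sup>2" using True ab by (simp add: power_mono_iff)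
      also have "\<dots> \<longleftrightarrow> c * a\<^sup>2 \<le> c * b0\<^sup>2" using c by simp
      finally show ?thesis using ab by simp
    qed
    ultimately show ?thesis using True by (auto simp: f_def \<kappa>c_def indicator_def)
  qed (use ab in \<open>auto simp: f_def indicator_def\<close>)
  have cont: "continuous_on {a0..b0} (\<lambda>a. a * \<kappa> (c * a\<^sup>2))"
    using c by (intro continuous_intros) auto
  have int_f: "integrable lborel f"
    using has_bochner_integral_interval(1)[OF cont] by (simp add: f_eq[abs_def])
  have "((\<lambda>a. (2 * c) * (a * \<kappa> (c * a\<^sup>2))) has_integral integral {\<sigma>..8} \<kappa>) {a0..b0}"
    using radial_substitution[of a0 b0 0 c] ab c by (simp add: mult.assoc)
  then have "(2 * c) * integral {a0..b0} (\<lambda>a. a * \<kappa> (c * a\<^sup>2)) = integral {\<sigma>..8} \<kappa>"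
    by (simp add: has_integral_iff)
  then have "0 \<le> integral {a0..b0} (\<lambda>a. a * \<kappa> (c * a\<^sup>2))"
    using \<sigma>_nonneg c by (metis mult_pos_pos zero_le_mult_iff zero_less_numeral not_le)
  then have nonneg: "0 \<le> (\<integral>a. f a \<partial>lborel)"
    using has_bochner_integral_interval(2)[OF cont] by (simp add: f_eq[abs_def])
  have int_U: "integrable lborel (\<lambda>a. indicator U a * f a)"
    using integrable_mult_indicator[OF _ int_f, of U] U by simp
  then show "integrable lborel (\<lambda>a. indicator U a * (indicator {0<..} a * (a * \<kappa>c (c * a\<^sup>2))))"
    by (simp add: f_def)
  obtain x where x: "2 < x" "x < 8" "\<And>\<tau>. 0 \<le> \<tau> \<Longrightarrow> \<tau> < x \<Longrightarrow> \<kappa> \<tau> < 0" "\<And>\<tau>. x < \<tau> \<Longrightarrow> 0 < \<kappa> \<tau>" "k x = \<mu>"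
    by (rule threshold_exists) blast
  have kx: "0 \<le> \<kappa> \<tau>" if "x \<le> \<tau>" for \<tau>
  proof (cases "x = \<tau>")
    case True
    then show ?thesis using x(5) by (simp add: \<kappa>_def)
  next
    case False
    then show ?thesis using x(4)[of \<tau>] that by simp
  qed
  have "0 \<le> (\<integral>a. indicator U a * f a \<partial>lborel)"
  proof (cases "\<exists>a\<in>U. 0 < a \<and> c * a\<^sup>2 < x")
    case False
    have "0 \<le> indicator U a * f a" for a
      using False kx[of "c * a\<^sup>2"] by (auto simp: f_def indicator_def \<kappa>c_def not_less)
    then show ?thesis by (intro Bochner_Integration.integral_nonneg) auto
  next
    case True
    then obtain d where d: "d \<in> U" "0 < d" "c * d\<^sup>2 < x" by auto
    have "f a \<le> indicator U a * f a" for a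
    proof (cases "a \<in> U \<or> a \<le> 0")
      case False
      then have "0 < a" "a < d" using up[of d a] d by force+
      then have "c * a\<^sup>2 \<le> c * d\<^sup>2" using c by (intro mult_left_mono power_mono) auto
      then have "c * a\<^sup>2 < x" using d(3) by linarith
      then have "\<kappa> (c * a\<^sup>2) < 0" using c by (intro x(3)) auto
      then show ?thesis using False by (auto simp: f_def \<kappa>c_def indicator_def mult_le_0_iff)
    qed (auto simp: f_def)
    then have "(\<integral>a. f a \<partial>lborel) \<le> (\<integral>a. indicator U a * f a \<partial>lborel)"
      using int_f int_U by (intro integral_mono) auto
    then show ?thesis using nonneg by simp
  qed
  then show "0 \<le> (\<integral>a. indicator U a * (indicator {0<..} a * (a * \<kappa>c (c * a\<^sup>2))) \<partial>lborel)"
    by (simp add: f_def)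
qed

text \<open>In slope coordinates the plane splits into pairs of opposite rays; an outward set meets
  each ray in an upward closed set, and the weight \<bar>a\<bar> is the one of the ray
  integral.\<close>

lemma outward_integral_nonneg:
  fixes X :: "(real \<times> real) set"
  assumes X: "X \<in> sets borel" and up: "\<And>v l. v \<in> X \<Longrightarrow> 1 \<le> l \<Longrightarrow> l *\<^sub>R v \<in> X"
  shows "0 \<le> (\<integral>v. indicator X v * \<kappa>p v \<partial>lborel)"
proof -
  define F where "F = (\<lambda>v. indicator X v * \<kappa>p v)"
  define L where "L = (\<lambda>w::real\<times>real. (fst w, fst w * snd w))"
  have L: "L \<in> borel_measurable borel" unfolding L_def
    by (intro borel_measurable_continuous_onI continuous_intros)
  have d: "(\<lambda>w::real\<times>real. \<bar>fst w\<bar>) \<in> borel_measurable borel"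
    by (intro borel_measurable_continuous_onI continuous_intros)
  have F: "F \<in> borel_measurable borel" using X by (simp add: F_def)
  have FL: "(\<lambda>w. F (L w)) \<in> borel_measurable borel" using measurable_compose[OF L F] .
  have slope: "lborel = distr (density lborel (\<lambda>w. ennreal \<bar>fst w\<bar>)) borel L"
    unfolding L_def by (rule lborel_slope)
  have int: "integrable lborel F" unfolding F_def by (rule integrable_\<kappa>p[OF X])
  have "integrable (distr (density lborel (\<lambda>w. ennreal \<bar>fst w\<bar>)) borel L) F" using int slope by simp
  then have "integrable (density lborel (\<lambda>w. ennreal \<bar>fst w\<bar>)) (\<lambda>w. F (L w))"
    by (subst (asm) integrable_distr_eq) (use L F in auto)
  then have int': "integrable lborel (\<lambda>w. \<bar>fst w\<bar> * F (L w))"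
    by (subst (asm) integrable_density) (use FL d in auto)
  have "(\<integral>v. F v \<partial>lborel) = (\<integral>v. F v \<partial>(distr (density lborel (\<lambda>w. ennreal \<bar>fst w\<bar>)) borel L))"
    using slope by simp
  also have "\<dots> = (\<integral>w. F (L w) \<partial>(density lborel (\<lambda>w. ennreal \<bar>fst w\<bar>)))"
    by (subst integral_distr) (use L F in auto)
  also have "\<dots> = (\<integral>w. \<bar>fst w\<bar> * F (L w) \<partial>lborel)"
    by (subst integral_density) (use FL d in auto)
  also have "\<dots> = (\<integral>s. (\<integral>a. \<bar>a\<bar> * F (a, a * s) \<partial>lborel) \<partial>lborel)"
  proof -
    have "(\<lambda>(a, s). \<bar>a\<bar> * F (a, a * s)) = (\<lambda>w. \<bar>fst w\<bar> * F (L w))" by (auto simp: L_def)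
    then show ?thesis using int' by (subst lborel_pair.integral_snd) (simp_all add: lborel_prod)
  qed
  finally have eq: "(\<integral>v. F v \<partial>lborel) = (\<integral>s. (\<integral>a. \<bar>a\<bar> * F (a, a * s) \<partial>lborel) \<partial>lborel)" .
  have "0 \<le> (\<integral>a. \<bar>a\<bar> * F (a, a * s) \<partial>lborel)" for s
  proof -
    define U where "U = (\<lambda>a. (a, a * s)) -` X"
    define V where "V = (\<lambda>a. (- a, - a * s)) -` X"
    have c: "0 < 1 + s\<^sup>2" by (simp add: add_pos_nonneg)
    have "(\<lambda>a. (a, a * s)) \<in> borel_measurable borel" "(\<lambda>a. (- a, - a * s)) \<in> borel_measurable borel"
      by (intro borel_measurable_continuous_onI continuous_intros)+
    then have UV: "U \<in> sets borel" "V \<in> sets borel"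
      unfolding U_def V_def by (auto intro: measurable_sets_borel[OF _ X])
    have upU: "b \<in> U" if "a \<in> U" "0 < a" "a \<le> b" for a b
      using up[of "(a, a * s)" "b / a"] that by (auto simp: U_def)
    have upV: "b \<in> V" if "a \<in> V" "0 < a" "a \<le> b" for a b
      using up[of "(- a, - a * s)" "b / a"] that by (auto simp: V_def)
    define f where "f = (\<lambda>a. indicator {0<..} a * (a * \<kappa>c ((1 + s\<^sup>2) * a\<^sup>2)))"
    have n: "(norm (a, a * s))\<^sup>2 = (1 + s\<^sup>2) * a\<^sup>2" for a
      by (simp add: norm_Pair power_mult_distrib algebra_simps)
    have split: "\<bar>a\<bar> * F (a, a * s) = indicator U a * f a + indicator V (- a) * f (- a)" for a
      unfolding F_def n by (auto simp: U_def V_def f_def indicator_def)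
    note rU = ray_integral_nonneg[OF c UV(1) upU] and rV = ray_integral_nonneg[OF c UV(2) upV]
    have iU: "integrable lborel (\<lambda>a. indicator U a * f a)" "0 \<le> (\<integral>a. indicator U a * f a \<partial>lborel)"
      using rU by (simp_all add: f_def)
    have iV: "integrable lborel (\<lambda>a. indicator V a * f a)" "0 \<le> (\<integral>a. indicator V a * f a \<partial>lborel)"
      using rV by (simp_all add: f_def)
    have iV': "integrable lborel (\<lambda>a. indicator V (- a) * f (- a))"
      using lborel_integrable_real_affine[OF iV(1), of "-1" 0] by simp
    have "(\<integral>a. indicator V a * f a \<partial>lborel) = (\<integral>a. indicator V (- a) * f (- a) \<partial>lborel)"
      using lborel_integral_real_affine[of "-1" "\<lambda>a. indicator V a * f a" 0] by simp
    then show ?thesis unfolding split using iU iV iV' by simp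
  qed
  then show ?thesis using eq by (simp add: F_def Bochner_Integration.integral_nonneg)
qed

text \<open>Inclusion and exclusion, one set at a time: the new set and the union of the old ones
  meet in an outward set, so the subtracted term is nonnegative and may be dropped.\<close>

lemma union_outward_integral_le:
  fixes X :: "'i \<Rightarrow> (real \<times> real) set"
  assumes J: "finite J" and X: "\<And>j. j \<in> J \<Longrightarrow> X j \<in> sets borel"
    and up: "\<And>j v l. j \<in> J \<Longrightarrow> v \<in> X j \<Longrightarrow> 1 \<le> l \<Longrightarrow> l *\<^sub>R v \<in> X j"
  shows "(\<integral>v. indicator (\<Union>j\<in>J. X j) v * \<kappa>p v \<partial>lborel) \<le> (\<Sum>j\<in>J. \<integral>v. indicator (X j) v * \<kappa>p v \<partial>lborel)"
  using J X up
proof (induction J)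
  case (insert j J)
  let ?U = "\<Union>i\<in>J. X i"
  have U: "?U \<in> sets borel" using insert by auto
  have Xj: "X j \<in> sets borel" using insert by auto
  have "0 \<le> (\<integral>v. indicator (X j \<inter> ?U) v * \<kappa>p v \<partial>lborel)"
  proof (rule outward_integral_nonneg)
    fix v :: "real \<times> real" and l :: real assume v: "v \<in> X j \<inter> ?U" and l: "1 \<le> l"
    then obtain i where "i \<in> J" "v \<in> X i" by auto
    then show "l *\<^sub>R v \<in> X j \<inter> ?U" using insert.prems(2)[OF _ _ l, of _ v] v by blast
  qed (use U Xj in auto)
  moreover have "(\<integral>v. indicator (\<Union>i\<in>insert j J. X i) v * \<kappa>p v \<partial>lborel) =
      (\<integral>v. indicator (X j) v * \<kappa>p v + indicator ?U v * \<kappa>p v - indicator (X j \<inter> ?U) v * \<kappa>p v \<partial>lborel)"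
    by (intro Bochner_Integration.integral_cong) (auto simp: indicator_def)
  moreover have "\<dots> = (\<integral>v. indicator (X j) v * \<kappa>p v \<partial>lborel) + (\<integral>v. indicator ?U v * \<kappa>p v \<partial>lborel)
     - (\<integral>v. indicator (X j \<inter> ?U) v * \<kappa>p v \<partial>lborel)"
    using integrable_\<kappa>p[OF U] integrable_\<kappa>p[OF Xj] integrable_\<kappa>p[OF sets.Int[OF Xj U]] by simp
  moreover have "(\<integral>v. indicator ?U v * \<kappa>p v \<partial>lborel) \<le> (\<Sum>i\<in>J. \<integral>v. indicator (X i) v * \<kappa>p v \<partial>lborel)"
    using insert by auto
  ultimately show ?case using insert.hyps by simp
qed simp


section \<open>The integral over a half plane as a function of its distance from the centre\<close>

definition chord :: "real \<Rightarrow> real" where "chord z = (\<integral>v. \<kappa>c (v\<^sup>2 + z\<^sup>2) \<partial>lborel)"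

definition halfplane :: "real \<Rightarrow> real" where
  "halfplane z = (\<integral>v. indicator {v. z \<le> snd v} v * \<kappa>p v \<partial>lborel)"

text \<open>The truncated profile lives on a symmetric pair of intervals; the gap between them is
  nonempty only when the chord meets the cut disc, which is the purpose of the
  \<open>max\<close>.\<close>

lemma chord_symmetric_interval:
  assumes z: "z\<^sup>2 \<le> 8" and a: "a = sqrt (max 0 (\<sigma> - z\<^sup>2))"
  shows "chord z = 2 * integral {a..sqrt (8 - z\<^sup>2)} (\<lambda>v. \<kappa> (z\<^sup>2 + v\<^sup>2))"
proof -
  define b where "b = sqrt (8 - z\<^sup>2)"
  have ab: "0 \<le> a" "0 \<le> b" "a\<^sup>2 = max 0 (\<sigma> - z\<^sup>2)" "b\<^sup>2 = 8 - z\<^sup>2" 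
    using z by (auto simp: a b_def)
  define h where "h = (\<lambda>v. indicator {a..b} v * \<kappa> (z\<^sup>2 + v\<^sup>2))"
  have cont: "continuous_on {a..b} (\<lambda>v. \<kappa> (z\<^sup>2 + v\<^sup>2))" by (intro continuous_intros) auto
  have h: "integrable lborel h" "(\<integral>v. h v \<partial>lborel) = integral {a..b} (\<lambda>v. \<kappa> (z\<^sup>2 + v\<^sup>2))"
    unfolding h_def by (rule has_bochner_integral_interval[OF cont])+
  have h': "integrable lborel (\<lambda>v. h (- v))" "(\<integral>v. h (- v) \<partial>lborel) = (\<integral>v. h v \<partial>lborel)"
    using lborel_integrable_real_affine[OF h(1), of "-1" 0] lborel_integral_real_affine[of "-1" h 0] by auto
  have le: "a \<le> \<bar>v\<bar> \<longleftrightarrow> \<sigma> \<le> v\<^sup>2 + z\<^sup>2" "\<bar>v\<bar> \<le> b \<longleftrightarrow> v\<^sup>2 + z\<^sup>2 \<le> 8" for v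
  proof -
    have "a \<le> \<bar>v\<bar> \<longleftrightarrow> a\<^sup>2 \<le> v\<^sup>2" using ab(1) by (metis abs_ge_zero abs_le_square_iff abs_of_nonneg)
    then show "a \<le> \<bar>v\<bar> \<longleftrightarrow> \<sigma> \<le> v\<^sup>2 + z\<^sup>2" unfolding ab by auto
    have "\<bar>v\<bar> \<le> b \<longleftrightarrow> v\<^sup>2 \<le> b\<^sup>2" using ab(2) by (metis abs_le_square_iff abs_of_nonneg)
    then show "\<bar>v\<bar> \<le> b \<longleftrightarrow> v\<^sup>2 + z\<^sup>2 \<le> 8" unfolding ab by auto
  qed
  \<comment> \<open>For a = 0 the point v = 0 belongs to both halves and would be counted
    twice.\<close>
  have eq: "\<kappa>c (v\<^sup>2 + z\<^sup>2) = h v + h (- v)" if "v \<noteq> 0" for v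
  proof -
    have "\<kappa>c (v\<^sup>2 + z\<^sup>2) = indicator {a..b} \<bar>v\<bar> * \<kappa> (z\<^sup>2 + v\<^sup>2)"
      using le[of v] by (simp add: \<kappa>c_def indicator_def add.commute)
    also have "\<dots> = h v + h (- v)" using ab(1) that by (auto simp: h_def indicator_def abs_if)
    finally show ?thesis .
  qed
  have "chord z = (\<integral>v. h v + h (- v) \<partial>lborel)"
    unfolding chord_def
  proof (rule integral_cong_AE)
    have "AE v in lborel. v \<noteq> (0::real)" by (rule AE_lborel_singleton)
    then show "AE v in lborel. \<kappa>c (v\<^sup>2 + z\<^sup>2) = h v + h (- v)" by eventually_elim (rule eq)
  qed (use h(1) h'(1) in \<open>auto dest: borel_measurable_integrable\<close>)
  also have "\<dots> = 2 * integral {a..b} (\<lambda>v. \<kappa> (z\<^sup>2 + v\<^sup>2))"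
    using h h' by simp
  finally show ?thesis by (simp add: b_def)
qed

lemma chord_zero: "8 \<le> z\<^sup>2 \<Longrightarrow> chord z = 0"
proof (cases "z\<^sup>2 = 8")
  case True
  then show ?thesis using \<sigma>_bounds by (subst chord_symmetric_interval[OF _ refl]) auto
next
  case False
  assume "8 \<le> z\<^sup>2"
  then have "\<kappa>c (v\<^sup>2 + z\<^sup>2) = 0" for v
    using False \<kappa>c_support[of "v\<^sup>2 + z\<^sup>2"] zero_le_power2[of v] by fastforce
  then show ?thesis by (simp add: chord_def)
qed

lemma chord_nonpos:
  assumes "0 \<le> z" "z \<le> sqrt 2" shows "chord z \<le> 0"
proof -
  have z2: "z\<^sup>2 \<le> 2" using power_mono[OF assms(2,1), of 2] by simp
  show ?thesis
  proof (cases "z\<^sup>2 < \<sigma>")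
    case True
    then have "0 < \<sigma>" using zero_le_power2[of z] by linarith
    then show ?thesis
      using chord_symmetric_interval[OF _ refl, of z] chord_integral_cut[OF \<sigma>_bounds(2) \<sigma>_zero assms(1) True] True z2
      by (simp add: max_absorb2)
  next
    case False
    then show ?thesis
      using chord_symmetric_interval[OF _ refl, of z] chord_integral_neg[OF assms(1)] chord_integral_zero z2
      by (cases "z\<^sup>2 = 2") (auto simp: max_absorb1)
  qed
qed

lemma chord_neg:
  assumes "0 \<le> z" "\<sigma> \<le> z\<^sup>2" "z\<^sup>2 < 2" shows "chord z < 0"
  using chord_symmetric_interval[OF _ refl, of z] chord_integral_neg[OF assms(1,3)] assms
  by (simp add: max_absorb1)

lemma chord_pos:
  assumes "0 \<le> z" "2 < z\<^sup>2" "z\<^sup>2 < 8" shows "0 < chord z"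
  using chord_symmetric_interval[OF _ refl, of z] chord_integral_pos[OF assms] assms \<sigma>_bounds
  by (simp add: max_absorb1)

lemma chord_nonneg:
  assumes "sqrt 2 \<le> z" shows "0 \<le> chord z"
proof -
  have "z\<^sup>2 \<ge> 2" using power_mono[OF assms, of 2] by simp
  moreover have "0 \<le> z" using assms order_trans[OF _ assms, of 0] by simp
  moreover have "chord z = 0" if "z\<^sup>2 = 2"
    using chord_symmetric_interval[OF _ refl, of z] that chord_integral_zero \<sigma>_bounds by (simp add: max_absorb1)
  ultimately show ?thesis using chord_pos[of z] chord_zero[of z] by force
qed

lemma halfplane_chord:
  "integrable lborel (\<lambda>y. indicator {z..} y * chord y)"
  "halfplane z = (\<integral>y. indicator {z..} y * chord y \<partial>lborel)"
proof -
  have "{v::real\<times>real. z \<le> snd v} \<in> sets borel"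
    by (intro borel_closed closed_Collect_le continuous_intros)
  then have i: "integrable (lborel \<Otimes>\<^sub>M lborel) (\<lambda>(x, y). indicator {z..} y * \<kappa>c (x\<^sup>2 + y\<^sup>2))"
    using integrable_\<kappa>p[of "{v. z \<le> snd v}"]
    by (simp add: lborel_prod case_prod_beta' norm_prod_def indicator_def)
  from lborel_pair.integrable_snd[OF i] lborel_pair.integral_snd[OF i]
  show "integrable lborel (\<lambda>y. indicator {z..} y * chord y)"
    "halfplane z = (\<integral>y. indicator {z..} y * chord y \<partial>lborel)"
    by (simp_all add: chord_def halfplane_def lborel_prod case_prod_beta' norm_prod_def indicator_def)
qed

text \<open>A half plane is swept by its chords, which have nonpositive integral up to distance sqrt
  2 and nonnegative integral beyond. Moving the boundary line to sqrt 2 therefore drops the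
  unfavourable chords and keeps or adds the favourable ones.\<close>

lemma halfplane_le:
  assumes "0 \<le> z"
  shows "halfplane z \<le> halfplane (sqrt 2)" "z \<noteq> sqrt 2 \<Longrightarrow> halfplane z < halfplane (sqrt 2)"
proof -
  define f where "f = (\<lambda>y. indicator {sqrt 2..} y * chord y - indicator {z..} y * chord y)"
  have f: "integrable lborel f" "(\<integral>y. f y \<partial>lborel) = halfplane (sqrt 2) - halfplane z"
    unfolding f_def using halfplane_chord[of z] halfplane_chord[of "sqrt 2"] by simp_all
  have nn: "0 \<le> f y" for y
    using chord_nonpos[of y] chord_nonneg[of y] assms by (auto simp: f_def indicator_def)
  have "0 \<le> (\<integral>y. f y \<partial>lborel)" using nn by (intro Bochner_Integration.integral_nonneg)
  then show "halfplane z \<le> halfplane (sqrt 2)" using f by simp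
  assume ne: "z \<noteq> sqrt 2"
  have "0 < (\<integral>y. f y \<partial>lborel)"
  proof (cases "z < sqrt 2")
    case True
    show ?thesis
    proof (rule integral_pos_on_interval[OF f(1) nn])
      \<comment> \<open>Chords meeting the cut disc are only known to be nonpositive; strictness
        comes from those between sqrt \<sigma> and sqrt 2, an interval that exists because \<sigma>
        < 2.\<close>
      show "max z (sqrt \<sigma>) < sqrt 2" using True \<sigma>_bounds by simp
      fix y assume y: "max z (sqrt \<sigma>) < y" "y < sqrt 2"
      have "0 \<le> y" using y assms by linarith
      then have "\<sigma> \<le> y\<^sup>2" "y\<^sup>2 < 2"
        using y real_le_lsqrt[of \<sigma> y] power_mono[of "sqrt \<sigma>" y 2] power_strict_mono[of y "sqrt 2" 2] \<sigma>_bounds by auto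
      then show "0 < f y" using chord_neg[OF \<open>0 \<le> y\<close>] y by (simp add: f_def)
    qed
  next
    case False
    show ?thesis
    proof (rule integral_pos_on_interval[OF f(1) nn])
      show "sqrt 2 < min z (sqrt 8)" using False ne by simp
      fix y assume y: "sqrt 2 < y" "y < min z (sqrt 8)"
      have "0 \<le> y" using y(1) by (meson dual_order.trans less_imp_le real_sqrt_ge_zero zero_le_numeral)
      then have "2 < y\<^sup>2" "y\<^sup>2 < 8"
        using y power_strict_mono[of "sqrt 2" y 2] power_strict_mono[of y "sqrt 8" 2] by auto
      then show "0 < f y" using chord_pos[OF \<open>0 \<le> y\<close>] y by (simp add: f_def)
    qed
  qed
  then show "halfplane z < halfplane (sqrt 2)" using f by simp
qed

text \<open>A half plane at distance sqrt 8 cuts nothing off the disc and gives zero, yet it is not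
  the optimal one.\<close>

lemma halfplane_sqrt2_pos: "0 < halfplane (sqrt 2)"
proof -
  have "indicator {sqrt 8..} y * chord y = 0" for y
  proof (cases "sqrt 8 \<le> y")
    case True
    then have "8 \<le> y\<^sup>2" using power_mono[of "sqrt 8" y 2] by simp
    then show ?thesis by (simp add: chord_zero)
  qed simp
  then have "halfplane (sqrt 8) = 0" unfolding halfplane_chord(2) by (simp only: integral_zero)
  then show ?thesis using halfplane_le(2)[of "sqrt 8"] by simp
qed

lemma rotated_halfplane:
  assumes d: "\<delta> \<noteq> (0::real\<times>real)"
  shows "(\<integral>v. indicator {v. \<beta> \<le> \<delta> \<bullet> v} v * \<kappa>p v \<partial>lborel) = halfplane (\<beta> / norm \<delta>)"
proof -
  define p where "p = fst \<delta> / norm \<delta>"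
  define q where "q = snd \<delta> / norm \<delta>"
  have n: "norm \<delta> > 0" "(norm \<delta>)\<^sup>2 = (fst \<delta>)\<^sup>2 + (snd \<delta>)\<^sup>2"
    using d by (simp, simp add: norm_prod_def)
  have pq: "p\<^sup>2 + q\<^sup>2 = 1" "fst \<delta> = norm \<delta> * p" "snd \<delta> = norm \<delta> * q"
    using n(1) by (simp_all add: p_def q_def power_divide n(2)[symmetric] flip: add_divide_distrib)
  define R where "R = (\<lambda>v::real\<times>real. (q * fst v + p * snd v, q * snd v - p * fst v))"
  have R: "R \<in> borel_measurable borel" unfolding R_def
    by (intro borel_measurable_continuous_onI continuous_intros)
  have n2: "(norm w)\<^sup>2 = (fst w)\<^sup>2 + (snd w)\<^sup>2" for w :: "real \<times> real"
    by (simp add: norm_prod_def)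
  have nR: "(norm (R v))\<^sup>2 = (norm v)\<^sup>2" for v
  proof -
    have "(norm (R v))\<^sup>2 = (p\<^sup>2 + q\<^sup>2) * ((fst v)\<^sup>2 + (snd v)\<^sup>2)"
      unfolding n2 by (simp add: R_def power2_eq_square algebra_simps)
    then show ?thesis using pq by (simp add: n2)
  qed
  have iR: "\<delta> \<bullet> R v = norm \<delta> * snd v" for v
  proof -
    have "\<delta> \<bullet> R v = norm \<delta> * ((p\<^sup>2 + q\<^sup>2) * snd v)"
      by (simp add: R_def inner_prod_def pq(2,3) power2_eq_square algebra_simps)
    then show ?thesis using pq by simp
  qed
  have m: "{v. \<beta> \<le> \<delta> \<bullet> v} \<in> sets borel"
    by (intro borel_closed closed_Collect_le continuous_intros)
  have "(\<integral>v. indicator {v. \<beta> \<le> \<delta> \<bullet> v} v * \<kappa>p v \<partial>lborel)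
      = (\<integral>v. indicator {v. \<beta> \<le> \<delta> \<bullet> v} v * \<kappa>p v \<partial>(distr lborel borel R))"
    unfolding R_def by (subst distr_lborel_plane_rotation[OF pq(1)]) simp
  also have "\<dots> = (\<integral>v. indicator {v. \<beta> \<le> \<delta> \<bullet> v} (R v) * \<kappa>p (R v) \<partial>lborel)"
    by (subst integral_distr) (use R m in auto)
  also have "\<dots> = halfplane (\<beta> / norm \<delta>)"
    unfolding halfplane_def nR using n
    by (intro Bochner_Integration.integral_cong) (auto simp: indicator_def iR divide_le_eq mult.commute)
  finally show ?thesis .
qed

end

section \<open>The half ball in polar charts\<close>

text \<open>For x = tan \<phi> this is the integral of sin^2 from 0 to \<phi>: the volume per solid
  angle of a cone of geodesics of length \<phi> in the 3-sphere.\<close>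

definition capH :: "real \<Rightarrow> real" where "capH x = (arctan x - x / (1 + x\<^sup>2)) / 2"

lemma capH_deriv: "(capH has_real_derivative x\<^sup>2 / (1 + x\<^sup>2)\<^sup>2) (at x)"
proof -
  have p: "1 + x\<^sup>2 \<noteq> 0" by (metis add_pos_nonneg less_irrefl zero_le_power2 zero_less_one)
  have e: "(1 / (1 + x\<^sup>2) - (1 * (1 + x\<^sup>2) - x * (2 * x)) / ((1 + x\<^sup>2) * (1 + x\<^sup>2))) / 2 = x\<^sup>2 / (1 + x\<^sup>2)\<^sup>2"
    using p by (simp add: divide_simps power2_eq_square)
  show ?thesis unfolding capH_def e[symmetric]
    using p by (auto intro!: derivative_eq_intros simp: field_simps)
qed

lemma capH_0: "capH 0 = 0" by (simp add: capH_def)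

lemma capH_strict_mono: "0 \<le> x \<Longrightarrow> x < y \<Longrightarrow> capH x < capH y"
proof -
  assume xy: "0 \<le> x" "x < y"
  show ?thesis
  proof (rule DERIV_pos_imp_increasing_open[OF xy(2)])
    show "continuous_on {x..y} capH" by (rule DERIV_continuous_on) (rule has_field_derivative_at_within[OF capH_deriv])
    fix z assume "x < z" "z < y"
    then show "\<exists>d. (capH has_real_derivative d) (at z) \<and> 0 < d"
    proof (intro exI conjI)
      show "(capH has_real_derivative z\<^sup>2 / (1 + z\<^sup>2)\<^sup>2) (at z)" by (rule capH_deriv)
      show "0 < z\<^sup>2 / (1 + z\<^sup>2)\<^sup>2"
        using \<open>x < z\<close> xy by (intro divide_pos_pos zero_less_power add_pos_nonneg) auto
    qed
  qed
qed

lemma capH_pos: "0 < x \<Longrightarrow> 0 < capH x"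
  using capH_strict_mono[of 0 x] by (simp add: capH_0)

lemma continuous_on_capH: "continuous_on S capH"
  by (rule DERIV_continuous_on) (rule has_field_derivative_at_within[OF capH_deriv])

lemma quarter_power_nn_integral:
  assumes "0 \<le> r"
  shows "(\<integral>\<^sup>+ a. ennreal (a ^ 3) * indicator {0..r} a \<partial>lborel) = ennreal (r ^ 4 / 4)"
proof -
  have "(\<integral>\<^sup>+ a. ennreal (a ^ 3) * indicator {0..r} a \<partial>lborel) = ennreal (r ^ 4 / 4 - 0 ^ 4 / 4)"
    by (rule nn_integral_FTC_Icc) (use assms in \<open>auto intro!: derivative_eq_intros\<close>)
  then show ?thesis by simp
qed

text \<open>Substituting t = a \<alpha> separates the variables: the \<open>a\<close>-integral of
  \<open>a ^ 3\<close> up to the unit sphere gives r^4 / 4, and what remains in \<alpha> is the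
  derivative of \<open>capH\<close> up to scaling. The 1/4 is the factor between the volume of a
  cone and the spherical volume under it.\<close>

lemma slice_integral:
  assumes s: "0 < s" and b: "0 < b"
  shows "(\<integral>\<^sup>+ a. \<integral>\<^sup>+ t. ennreal (t\<^sup>2) * indicator {(a, t). 0 < a \<and> 0 < t \<and> a\<^sup>2 + s * t\<^sup>2 \<le> 1 \<and> t \<le> b * a} (a, t) \<partial>lborel \<partial>lborel)
    = ennreal (capH (b * sqrt s) / (4 * sqrt s ^ 3))" (is "?I = _")
proof -
  define r where "r = (\<lambda>\<alpha>::real. 1 / sqrt (1 + s * \<alpha>\<^sup>2))"
  have q: "1 + s * \<alpha>\<^sup>2 > 0" for \<alpha> using s by (simp add: add_pos_nonneg)
  define g :: "real \<Rightarrow> real \<Rightarrow> ennreal" where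
    "g = (\<lambda>a \<alpha>. ennreal (a ^ 3) * ennreal (\<alpha>\<^sup>2) * indicator {0<..} a * indicator {0<..b} \<alpha> * indicator {(a, \<alpha>). a \<le> r \<alpha>} (a, \<alpha>))"
  have r_iff: "a \<le> r \<alpha> \<longleftrightarrow> a\<^sup>2 + s * (a * \<alpha>)\<^sup>2 \<le> 1" if "0 < a" for a \<alpha>
  proof -
    have "a \<le> r \<alpha> \<longleftrightarrow> a * sqrt (1 + s * \<alpha>\<^sup>2) \<le> 1" using q[of \<alpha>] by (simp add: r_def le_divide_eq)
    also have "\<dots> \<longleftrightarrow> (a * sqrt (1 + s * \<alpha>\<^sup>2))\<^sup>2 \<le> 1\<^sup>2"
      using that q[of \<alpha>] by (subst power_mono_iff) auto
    also have "(a * sqrt (1 + s * \<alpha>\<^sup>2))\<^sup>2 = a\<^sup>2 + s * (a * \<alpha>)\<^sup>2"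
      using q[of \<alpha>] by (simp add: power_mult_distrib algebra_simps)
    finally show ?thesis by simp
  qed
  have inner: "(\<integral>\<^sup>+ t. ennreal (t\<^sup>2) * indicator {(a, t). 0 < a \<and> 0 < t \<and> a\<^sup>2 + s * t\<^sup>2 \<le> 1 \<and> t \<le> b * a} (a, t) \<partial>lborel)
     = (\<integral>\<^sup>+ \<alpha>. g a \<alpha> \<partial>lborel)" for a :: real
  proof (cases "0 < a")
    case True
    define f where "f = (\<lambda>t. ennreal (t\<^sup>2) * indicator {t. 0 < t \<and> a\<^sup>2 + s * t\<^sup>2 \<le> 1 \<and> t \<le> b * a} t)"
    have [measurable]: "f \<in> borel_measurable borel" unfolding f_def by measurable
    have "(\<integral>\<^sup>+ t. f t \<partial>lborel) = \<bar>a\<bar> * (\<integral>\<^sup>+ \<alpha>. f (0 + a * \<alpha>) \<partial>lborel)"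
      using True by (intro nn_integral_real_affine) auto
    also have "\<dots> = (\<integral>\<^sup>+ \<alpha>. ennreal \<bar>a\<bar> * f (0 + a * \<alpha>) \<partial>lborel)" by (subst nn_integral_cmult) auto
    also have "\<dots> = (\<integral>\<^sup>+ \<alpha>. g a \<alpha> \<partial>lborel)"
    proof (rule nn_integral_cong)
      fix \<alpha> :: real
      have "ennreal \<bar>a\<bar> * ennreal ((a * \<alpha>)\<^sup>2) = ennreal (a ^ 3) * ennreal (\<alpha>\<^sup>2)"
      proof -
        have "\<bar>a\<bar> * (a * \<alpha>)\<^sup>2 = a ^ 3 * \<alpha>\<^sup>2"
          using True by (simp add: power2_eq_square power3_eq_cube mult_ac)
        then show ?thesis using True by (simp flip: ennreal_mult')
      qed
      moreover have "a * \<alpha> \<le> b * a \<longleftrightarrow> \<alpha> \<le> b" using True by (simp add: mult.commute)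
      ultimately show "ennreal \<bar>a\<bar> * f (0 + a * \<alpha>) = g a \<alpha>"
        using True r_iff[OF True, of \<alpha>] by (auto simp: f_def g_def indicator_def zero_less_mult_iff mult.assoc[symmetric])
    qed
    finally show ?thesis using True by (simp add: f_def indicator_def)
  qed (simp add: g_def)
  have r_meas: "r \<in> borel_measurable borel"
    unfolding r_def using q by (intro borel_measurable_continuous_onI continuous_intros) (auto simp: less_imp_neq[symmetric])
  note [measurable] = r_meas
  have gm: "case_prod g \<in> borel_measurable (lborel \<Otimes>\<^sub>M lborel)"
    unfolding g_def by measurable
  have "?I = (\<integral>\<^sup>+ a. \<integral>\<^sup>+ \<alpha>. g a \<alpha> \<partial>lborel \<partial>lborel)" by (simp only: inner)
  also have "\<dots> = (\<integral>\<^sup>+ \<alpha>. \<integral>\<^sup>+ a. g a \<alpha> \<partial>lborel \<partial>lborel)"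
    using lborel_pair.Fubini[OF gm] by simp
  also have "\<dots> = (\<integral>\<^sup>+ \<alpha>. ennreal (\<alpha>\<^sup>2 / (4 * (1 + s * \<alpha>\<^sup>2)\<^sup>2)) * indicator {0..b} \<alpha> \<partial>lborel)"
  proof (rule nn_integral_cong)
    fix \<alpha> :: real
    have rpos: "0 < r \<alpha>" using q[of \<alpha>] by (simp add: r_def)
    have "(\<integral>\<^sup>+ a. g a \<alpha> \<partial>lborel) = (\<integral>\<^sup>+ a. ennreal (\<alpha>\<^sup>2) * indicator {0<..b} \<alpha> * (ennreal (a ^ 3) * indicator {0..r \<alpha>} a) \<partial>lborel)"
      by (intro nn_integral_cong) (auto simp: g_def indicator_def mult_ac)
    also have "\<dots> = ennreal (\<alpha>\<^sup>2) * indicator {0<..b} \<alpha> * ennreal (r \<alpha> ^ 4 / 4)"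
      using rpos by (subst nn_integral_cmult) (auto simp: quarter_power_nn_integral)
    also have "r \<alpha> ^ 4 = 1 / (1 + s * \<alpha>\<^sup>2)\<^sup>2"
    proof -
      have "r \<alpha> ^ 4 = ((r \<alpha>)\<^sup>2)\<^sup>2" by simp
      also have "(r \<alpha>)\<^sup>2 = 1 / (1 + s * \<alpha>\<^sup>2)" using q[of \<alpha>] by (simp add: r_def power_divide)
      finally show ?thesis by (simp add: power_divide)
    qed
    finally show "(\<integral>\<^sup>+ a. g a \<alpha> \<partial>lborel) = ennreal (\<alpha>\<^sup>2 / (4 * (1 + s * \<alpha>\<^sup>2)\<^sup>2)) * indicator {0..b} \<alpha>"
      by (auto simp: indicator_def ennreal_mult[symmetric] mult_ac)
  qed
  also have "\<dots> = ennreal (capH (b * sqrt s) / (4 * sqrt s ^ 3) - capH (0 * sqrt s) / (4 * sqrt s ^ 3))"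
  proof (rule nn_integral_FTC_Icc)
    show "(\<lambda>\<alpha>. \<alpha>\<^sup>2 / (4 * (1 + s * \<alpha>\<^sup>2)\<^sup>2)) \<in> borel_measurable borel" by measurable
    fix \<alpha> :: real
    have "((\<lambda>\<alpha>. capH (\<alpha> * sqrt s)) has_real_derivative (\<alpha> * sqrt s)\<^sup>2 / (1 + (\<alpha> * sqrt s)\<^sup>2)\<^sup>2 * sqrt s) (at \<alpha>)"
      by (rule DERIV_chain'[OF _ capH_deriv]) (auto intro!: derivative_eq_intros)
    from DERIV_cdivide[OF this, of "4 * sqrt s ^ 3"]
    show "((\<lambda>\<alpha>. capH (\<alpha> * sqrt s) / (4 * sqrt s ^ 3)) has_real_derivative \<alpha>\<^sup>2 / (4 * (1 + s * \<alpha>\<^sup>2)\<^sup>2)) (at \<alpha>)"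
    proof (rule DERIV_cong)
      have "(\<alpha> * sqrt s)\<^sup>2 = s * \<alpha>\<^sup>2" "sqrt s ^ 3 = s * sqrt s"
        using s by (simp_all add: power_mult_distrib power3_eq_cube)
      then show "(\<alpha> * sqrt s)\<^sup>2 / (1 + (\<alpha> * sqrt s)\<^sup>2)\<^sup>2 * sqrt s / (4 * sqrt s ^ 3) = \<alpha>\<^sup>2 / (4 * (1 + s * \<alpha>\<^sup>2)\<^sup>2)"
        using s by (simp add: field_simps)
    qed
  qed (use b in auto)
  finally show ?thesis by (simp add: capH_0)
qed

definition orthonormal4 :: "real^4 \<Rightarrow> real^4 \<Rightarrow> real^4 \<Rightarrow> real^4 \<Rightarrow> bool" where
  "orthonormal4 c p d e \<longleftrightarrow> c \<bullet> c = 1 \<and> p \<bullet> p = 1 \<and> d \<bullet> d = 1 \<and> e \<bullet> e = 1 \<and>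
    c \<bullet> p = 0 \<and> c \<bullet> d = 0 \<and> c \<bullet> e = 0 \<and> p \<bullet> d = 0 \<and> p \<bullet> e = 0 \<and> d \<bullet> e = 0"

lemma
  assumes o: "orthonormal4 c p d e"
  shows orthonormal4_expansion: "x = (x \<bullet> c) *\<^sub>R c + (x \<bullet> p) *\<^sub>R p + (x \<bullet> d) *\<^sub>R d + (x \<bullet> e) *\<^sub>R e"
    and orthonormal4_lborel: "distr lborel borel (\<lambda>x. (x \<bullet> c, x \<bullet> p, x \<bullet> d, x \<bullet> e)) = lborel"
proof -
  define S where "S = (\<lambda>y::real^4. y$1 *\<^sub>R c + y$2 *\<^sub>R p + y$3 *\<^sub>R d + y$4 *\<^sub>R e)"
  have S_app: "S y = y$1 *\<^sub>R c + y$2 *\<^sub>R p + y$3 *\<^sub>R d + y$4 *\<^sub>R e" for y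
    by (simp add: S_def)
  note oo = o[unfolded orthonormal4_def]
  have oo': "p \<bullet> c = 0" "d \<bullet> c = 0" "e \<bullet> c = 0" "d \<bullet> p = 0" "e \<bullet> p = 0" "e \<bullet> d = 0"
    using oo by (simp_all add: inner_commute)
  have S: "orthogonal_transformation S"
    unfolding orthogonal_transformation
  proof
    show "linear S" by (rule linearI) (auto simp: S_def algebra_simps)
    have "S x \<bullet> S x = x \<bullet> x" for x
    proof -
      have "S x \<bullet> S x = x$1 * x$1 + x$2 * x$2 + x$3 * x$3 + x$4 * x$4"
        using oo oo' by (simp add: S_def inner_add_left inner_add_right)
      then show ?thesis by (simp add: inner_vec_def sum_4)
    qed
    then show "\<forall>v. norm (S v) = norm v" by (simp add: norm_eq_sqrt_inner)
  qed
  have i: "orthogonal_transformation (inv S)" using S by (rule orthogonal_transformation_inv)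
  have surj: "S (inv S x) = x" for x
    using orthogonal_transformation_surj[OF S] by (rule surj_f_inv_f)
  have coord: "S y \<bullet> c = y$1" "S y \<bullet> p = y$2" "S y \<bullet> d = y$3" "S y \<bullet> e = y$4" for y
    using oo oo' by (simp_all add: S_def inner_add_left)
  have coord': "inv S x $ 1 = x \<bullet> c" "inv S x $ 2 = x \<bullet> p" "inv S x $ 3 = x \<bullet> d" "inv S x $ 4 = x \<bullet> e" for x
    using coord[of "inv S x"] by (simp_all add: surj)
  show "x = (x \<bullet> c) *\<^sub>R c + (x \<bullet> p) *\<^sub>R p + (x \<bullet> d) *\<^sub>R d + (x \<bullet> e) *\<^sub>R e"
    using surj[of x] S_app[of "inv S x"] coord' by simp
  have m: "inv S \<in> borel_measurable borel" 
    using orthogonal_transformation_linear[OF i]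
    by (intro borel_measurable_continuous_onI linear_continuous_on linear_conv_bounded_linear[THEN iffD1])
  have m2: "(\<lambda>x::real^4. (x$1, x$2, x$3, x$4)) \<in> borel_measurable borel"
    by (intro borel_measurable_continuous_onI continuous_intros)
  have "distr lborel borel (\<lambda>x. (x \<bullet> c, x \<bullet> p, x \<bullet> d, x \<bullet> e)) =
      distr lborel borel ((\<lambda>x. (x$1, x$2, x$3, x$4)) \<circ> inv S)"
    by (simp add: o_def coord')
  also have "\<dots> = distr (distr lborel borel (inv S)) borel (\<lambda>x. (x$1, x$2, x$3, x$4))"
    using m m2 by (subst distr_distr) auto
  also have "\<dots> = lborel" by (simp add: distr_lborel_orthogonal[OF i] distr_lborel_coords4)
  finally show "distr lborel borel (\<lambda>x. (x \<bullet> c, x \<bullet> p, x \<bullet> d, x \<bullet> e)) = lborel" .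
qed

lemma orthonormal4_inner:
  assumes "orthonormal4 c p d e"
  shows "x \<bullet> y = (x \<bullet> c) * (y \<bullet> c) + (x \<bullet> p) * (y \<bullet> p) + (x \<bullet> d) * (y \<bullet> d) + (x \<bullet> e) * (y \<bullet> e)"
proof -
  have "x \<bullet> y = ((x \<bullet> c) *\<^sub>R c + (x \<bullet> p) *\<^sub>R p + (x \<bullet> d) *\<^sub>R d + (x \<bullet> e) *\<^sub>R e) \<bullet> y"
    using orthonormal4_expansion[OF assms, of x] by simp
  then show ?thesis
    by (simp only: inner_add_left inner_scaleR_left inner_commute[of c y] inner_commute[of p y]
        inner_commute[of d y] inner_commute[of e y])
qed

lemma orthonormal4_norm:
  assumes "orthonormal4 c p d e"
  shows "(norm x)\<^sup>2 = (x \<bullet> c)\<^sup>2 + (x \<bullet> p)\<^sup>2 + (x \<bullet> d)\<^sup>2 + (x \<bullet> e)\<^sup>2"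
  using orthonormal4_inner[OF assms, of x x] unfolding power2_norm_eq_inner by (simp add: power2_eq_square)

text \<open>Coordinates \<open>x = x\<^sub>0 (c + \<alpha> (p + v))\<close> on the half ball; the volume element is
  \<open>x\<^sub>0^3 \<alpha>^2 dx\<^sub>0 d\<alpha> dv\<close>.\<close>
lemma emeasure_chart_region:
  fixes E :: "(real \<times> real) set" and b :: "real \<times> real \<Rightarrow> real"
  assumes o: "orthonormal4 c p d e" and E: "E \<in> sets borel"
    and b: "b \<in> borel_measurable borel" "\<And>v. 0 < b v"
  shows "emeasure lborel {x. 0 < x \<bullet> c \<and> 0 < x \<bullet> p \<and> norm x \<le> 1 \<and>
        (x \<bullet> d / (x \<bullet> p), x \<bullet> e / (x \<bullet> p)) \<in> E \<and>
        x \<bullet> p \<le> b (x \<bullet> d / (x \<bullet> p), x \<bullet> e / (x \<bullet> p)) * (x \<bullet> c)} =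
    (\<integral>\<^sup>+ v. indicator E v * ennreal (capH (b v * sqrt (1 + (norm v)\<^sup>2)) / (4 * sqrt (1 + (norm v)\<^sup>2) ^ 3)) \<partial>lborel)"
    (is "emeasure lborel ?S = _")
proof -
  define P where "P = (\<lambda>x. (x \<bullet> c, x \<bullet> p, x \<bullet> d, x \<bullet> e))"
  define W :: "(real \<times> real \<times> (real \<times> real)) set" where
    "W = {(a, t, v). 0 < a \<and> 0 < t \<and> a\<^sup>2 + t\<^sup>2 + (norm v)\<^sup>2 \<le> 1 \<and> (1 / t) *\<^sub>R v \<in> E \<and> t \<le> b ((1 / t) *\<^sub>R v) * a}"
  \<comment> \<open>The integrand after replacing the last two coordinates by t times v;
    \<open>t\<^sup>2\<close> is the Jacobian.\<close>
  define G :: "real \<Rightarrow> real \<Rightarrow> real \<times> real \<Rightarrow> ennreal" where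
    "G = (\<lambda>a t v. indicator E v * (ennreal (t\<^sup>2) *
      (if 0 < a \<and> 0 < t \<and> a\<^sup>2 + (1 + (norm v)\<^sup>2) * t\<^sup>2 \<le> 1 \<and> t \<le> b v * a then 1 else 0)))"
  note [measurable] = E b(1)
  have P: "P \<in> borel_measurable borel" unfolding P_def
    by (intro borel_measurable_continuous_onI continuous_intros)
  have S_eq: "?S = P -` W"
  proof (rule set_eqI)
    fix x :: "real^4"
    have "norm x \<le> 1 \<longleftrightarrow> (norm x)\<^sup>2 \<le> 1" by (simp add: abs_square_le_1)
    then show "x \<in> ?S \<longleftrightarrow> x \<in> P -` W"
      by (simp add: W_def P_def orthonormal4_norm[OF o, of x] norm_Pair add.assoc)
  qed
  have W: "W \<in> sets (borel \<Otimes>\<^sub>M (borel \<Otimes>\<^sub>M borel))"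
  proof -
    have "Measurable.pred (borel \<Otimes>\<^sub>M (borel \<Otimes>\<^sub>M borel)) (\<lambda>w::real \<times> real \<times> (real \<times> real). w \<in> W)"
      unfolding W_def by measurable
    then show ?thesis by (simp add: pred_def space_pair_measure)
  qed
  then have W': "W \<in> sets borel" unfolding borel_prod .
  have "emeasure lborel ?S = emeasure (distr lborel borel P) W"
    unfolding S_eq using P W' by (subst emeasure_distr) auto
  also have "\<dots> = emeasure lborel W" unfolding P_def orthonormal4_lborel[OF o] ..
  also have "\<dots> = (\<integral>\<^sup>+ a. \<integral>\<^sup>+ t. \<integral>\<^sup>+ v. indicator W (a, t, v) \<partial>lborel \<partial>lborel \<partial>lborel)"
  proof -
    have "emeasure lborel W = (\<integral>\<^sup>+ w. indicator W w \<partial>(lborel \<Otimes>\<^sub>M lborel))"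
      using W' by (simp add: lborel_prod)
    also have "\<dots> = (\<integral>\<^sup>+ a. \<integral>\<^sup>+ w. indicator W (a, w) \<partial>lborel \<partial>lborel)"
      by (rule lborel.nn_integral_fst[symmetric]) (use W' in \<open>simp add: lborel_prod\<close>)
    also have "\<dots> = (\<integral>\<^sup>+ a. \<integral>\<^sup>+ t. \<integral>\<^sup>+ v. indicator W (a, t, v) \<partial>lborel \<partial>lborel \<partial>lborel)"
    proof (intro nn_integral_cong)
      fix a :: real
      have "(\<lambda>w. indicator W (a, w) :: ennreal) \<in> borel_measurable (lborel \<Otimes>\<^sub>M lborel)"
        using W by measurable
      from lborel.nn_integral_fst[OF this]
      show "(\<integral>\<^sup>+ w. indicator W (a, w) \<partial>lborel) =
        (\<integral>\<^sup>+ t. \<integral>\<^sup>+ v. indicator W (a, t, v) \<partial>lborel \<partial>lborel)" unfolding lborel_prod ..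
    qed
    finally show ?thesis .
  qed
  also have "\<dots> = (\<integral>\<^sup>+ a. \<integral>\<^sup>+ t. \<integral>\<^sup>+ v. G a t v \<partial>lborel \<partial>lborel \<partial>lborel)"
  proof (rule nn_integral_cong, rule nn_integral_cong)
    fix a t :: real
    show "(\<integral>\<^sup>+ v. indicator W (a, t, v) \<partial>lborel) = (\<integral>\<^sup>+ v. G a t v \<partial>lborel)"
    proof (cases "0 < t")
      case True
      have m: "(\<lambda>v. indicator W (a, t, v) :: ennreal) \<in> borel_measurable borel"
        using W by measurable
      have "(\<integral>\<^sup>+ v. indicator W (a, t, v) \<partial>lborel) =
        (\<integral>\<^sup>+ v. indicator W (a, t, v) \<partial>(density (distr lborel borel (\<lambda>x::real\<times>real. 0 + t *\<^sub>R x)) (\<lambda>_. \<bar>t\<bar> ^ DIM(real\<times>real))))"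
        using True by (subst lborel_affine[of t 0, symmetric]) auto
      also have "\<dots> = (\<integral>\<^sup>+ v. ennreal (t\<^sup>2) * indicator W (a, t, t *\<^sub>R v) \<partial>lborel)"
        using m by (simp add: nn_integral_density nn_integral_distr power2_eq_square)
      also have "\<dots> = (\<integral>\<^sup>+ v. G a t v \<partial>lborel)"
        using True by (intro nn_integral_cong) (auto simp: W_def G_def indicator_def power_mult_distrib algebra_simps)
      finally show ?thesis .
    qed (simp add: W_def G_def indicator_def)
  qed
  \<comment> \<open>With the direction v outermost, the two inner integrals form one planar slice
    for each v.\<close>
  also have "\<dots> = (\<integral>\<^sup>+ v. \<integral>\<^sup>+ a. \<integral>\<^sup>+ t. G a t v \<partial>lborel \<partial>lborel \<partial>lborel)"
  proof -
    have m1: "(\<lambda>(v, t). G a t v) \<in> borel_measurable (lborel \<Otimes>\<^sub>M lborel)" for a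
      unfolding G_def by measurable
    have m2: "(\<lambda>(v, a). \<integral>\<^sup>+ t. G a t v \<partial>lborel) \<in> borel_measurable (lborel \<Otimes>\<^sub>M lborel)"
      unfolding G_def by measurable
    have "(\<integral>\<^sup>+ t. \<integral>\<^sup>+ v. G a t v \<partial>lborel \<partial>lborel) = (\<integral>\<^sup>+ v. \<integral>\<^sup>+ t. G a t v \<partial>lborel \<partial>lborel)" for a
      by (rule lborel_pair.Fubini'[OF m1])
    moreover have "(\<integral>\<^sup>+ a. \<integral>\<^sup>+ v. \<integral>\<^sup>+ t. G a t v \<partial>lborel \<partial>lborel \<partial>lborel) =
       (\<integral>\<^sup>+ v. \<integral>\<^sup>+ a. \<integral>\<^sup>+ t. G a t v \<partial>lborel \<partial>lborel \<partial>lborel)"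
      by (rule lborel_pair.Fubini'[OF m2])
    ultimately show ?thesis by simp
  qed
  also have "\<dots> = (\<integral>\<^sup>+ v. indicator E v * ennreal (capH (b v * sqrt (1 + (norm v)\<^sup>2)) / (4 * sqrt (1 + (norm v)\<^sup>2) ^ 3)) \<partial>lborel)"
  proof (rule nn_integral_cong)
    fix v :: "real \<times> real"
    have "0 < 1 + (norm v)\<^sup>2" by (simp add: add_pos_nonneg)
    note sl = slice_integral[OF this b(2)[of v]]
    show "(\<integral>\<^sup>+ a. \<integral>\<^sup>+ t. G a t v \<partial>lborel \<partial>lborel) =
      indicator E v * ennreal (capH (b v * sqrt (1 + (norm v)\<^sup>2)) / (4 * sqrt (1 + (norm v)\<^sup>2) ^ 3))"
      unfolding sl[symmetric] by (simp add: G_def indicator_def of_bool_def)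
  qed
  finally show ?thesis .
qed

section \<open>Cells\<close>

text \<open>A geodesic from \<open>c\<close> in the direction of p + v, with \<tau> the squared
  length of v, leaves the half space of \<open>p\<close> at an arc length whose tangent is
  \<open>\<rho> * sqrt (1 + \<tau>)\<close>. So this is the density of the tangent body.\<close>

lemma radial_profile_capH:
  assumes "0 < \<rho>" shows "radial_profile (\<lambda>\<tau>. capH (\<rho> * sqrt (1 + \<tau>)))"
proof
  show "continuous_on {0..} (\<lambda>\<tau>. capH (\<rho> * sqrt (1 + \<tau>)))"
    by (rule continuous_on_compose2[OF continuous_on_capH[of UNIV]]) (auto intro!: continuous_intros)
  show "capH (\<rho> * sqrt (1 + s)) < capH (\<rho> * sqrt (1 + t))" if "0 \<le> s" "s < t" for s t
    using that assms by (intro capH_strict_mono) auto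
qed

lemma AE_lborel_hyperplane:
  fixes a :: "'a::euclidean_space"
  assumes "a \<noteq> 0" shows "AE x in lborel. x \<bullet> a \<noteq> 0"
proof -
  have "negligible {x. a \<bullet> x = 0}" using assms by (intro negligible_hyperplane) auto
  moreover have "{x. a \<bullet> x = 0} \<in> sets borel" by (rule borel_closed[OF closed_hyperplane])
  ultimately have "{x. a \<bullet> x = 0} \<in> null_sets lborel"
    by (auto simp: negligible_iff_null_sets null_sets_def)
  from AE_not_in[OF this] show ?thesis by (simp add: inner_commute)
qed

text \<open>The Dirichlet cell of \<open>p\<close>. Strict inequalities make the cells disjoint; the
  ties they miss lie on hyperplanes and are null.\<close>

definition cell :: "(real^4) set \<Rightarrow> real^4 \<Rightarrow> (real^4) set" where
  "cell N p = {x. \<forall>q\<in>N - {p}. x \<bullet> q < x \<bullet> p}"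

lemma cell_borel: "finite N \<Longrightarrow> cell N p \<in> sets borel"
proof -
  assume "finite N"
  have "cell N p = (\<Inter>q\<in>N - {p}. {x. x \<bullet> q < x \<bullet> p})" by (auto simp: cell_def)
  also have "open \<dots>" using \<open>finite N\<close> by (intro open_INT) (auto intro!: open_Collect_less continuous_intros)
  finally show ?thesis by simp
qed

lemma measure_sum_cells:
  assumes N: "finite N" "N \<noteq> {}" and S: "S \<in> sets borel" "emeasure lborel S < \<infinity>"
  shows "measure lborel S = (\<Sum>p\<in>N. measure lborel (S \<inter> cell N p))"
proof -
  have c: "S \<inter> cell N p \<in> sets lborel" for p using S cell_borel[OF N(1), of p] by simp
  have fin: "emeasure lborel (S \<inter> cell N p) \<noteq> \<infinity>" for p
    using emeasure_mono[of "S \<inter> cell N p" S lborel] S by (auto simp: less_top[symmetric] top_unique)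
  have "AE x in lborel. \<forall>p\<in>N. \<forall>q\<in>N - {p}. x \<bullet> (p - q) \<noteq> 0"
    using N by (intro AE_finite_allI AE_lborel_hyperplane) auto
  then have "AE x in lborel. x \<in> S \<longleftrightarrow> x \<in> (\<Union>p\<in>N. S \<inter> cell N p)"
  proof eventually_elim
    case (elim x)
    obtain p where p: "p \<in> N" "\<And>q. q \<in> N \<Longrightarrow> x \<bullet> q \<le> x \<bullet> p"
    proof -
      have "Max ((\<lambda>p. x \<bullet> p) ` N) \<in> (\<lambda>p. x \<bullet> p) ` N" using N by (intro Max_in) auto
      then obtain p where "p \<in> N" "Max ((\<lambda>p. x \<bullet> p) ` N) = x \<bullet> p" by auto
      then show ?thesis using N Max_ge[of "(\<lambda>p. x \<bullet> p) ` N"] by (intro that[of p]) auto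
    qed
    have "x \<in> cell N p"
      using p elim by (fastforce simp: cell_def inner_diff_right order.strict_iff_order)
    then show ?case using p by auto
  qed
  moreover have "(\<Union>p\<in>N. S \<inter> cell N p) \<in> sets lborel" using N(1) c by (rule sets.finite_UN)
  ultimately have "measure lborel S = measure lborel (\<Union>p\<in>N. S \<inter> cell N p)"
    using S(1) by (intro measure_eq_AE) (simp_all del: UN_simps)
  also have "\<dots> = (\<Sum>p\<in>N. measure lborel (S \<inter> cell N p))"
  proof (rule measure_finite_Union)
    show "disjoint_family_on (\<lambda>p. S \<inter> cell N p) N"
    proof (unfold disjoint_family_on_def, intro ballI impI)
      fix p q assume "p \<in> N" "q \<in> N" "p \<noteq> q"
      then show "S \<inter> cell N p \<inter> (S \<inter> cell N q) = {}" by (auto simp: cell_def dest: less_asym)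
    qed
  qed (use N c fin in auto)
  finally show ?thesis .
qed

lemma emeasure_bounded_finite:
  fixes S :: "(real^4) set"
  assumes "\<And>x. x \<in> S \<Longrightarrow> norm x \<le> 1" shows "emeasure lborel S < \<infinity>"
proof -
  have "emeasure lborel S \<le> emeasure lborel (cball (0::real^4) 1)"
    using assms by (intro emeasure_mono) auto
  also have "\<dots> < \<infinity>" by (rule emeasure_lborel_cball_finite)
  finally show ?thesis .
qed

lemma unit_orthogonal_exists:
  fixes S :: "(real^4) set"
  assumes "finite S" "card S < 4"
  shows "\<exists>z. z \<bullet> z = 1 \<and> (\<forall>y\<in>S. y \<bullet> z = 0)"
proof -
  have "dim S < DIM(real^4)" using dim_le_card'[OF assms(1)] assms(2) by simp
  then obtain z where z: "z \<noteq> 0" "\<And>y. y \<in> span S \<Longrightarrow> orthogonal z y"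
    by (metis orthogonal_to_subspace_exists dim_span)
  show ?thesis
  proof (intro exI conjI ballI)
    show "(z /\<^sub>R norm z) \<bullet> (z /\<^sub>R norm z) = 1"
      using z(1) by (simp add: dot_square_norm power2_eq_square)
    show "y \<bullet> (z /\<^sub>R norm z) = 0" if "y \<in> S" for y
      using z(2)[OF span_base[OF that]] by (auto simp: orthogonal_def inner_commute)
  qed
qed

lemma orthonormal_extend:
  assumes "c \<bullet> c = 1" "p \<bullet> p = 1" "c \<bullet> p = 0"
  obtains d e where "orthonormal4 c p d e"
proof -
  have cp: "finite {c, p}" "card {c, p} < 4" by (auto simp: card_insert_if)
  obtain d where d: "d \<bullet> d = 1" "\<forall>y\<in>{c, p}. y \<bullet> d = 0"
    using unit_orthogonal_exists[OF cp] by blast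
  have cpd: "finite {c, p, d}" "card {c, p, d} < 4" by (auto simp: card_insert_if)
  obtain e where e: "e \<bullet> e = 1" "\<forall>y\<in>{c, p, d}. y \<bullet> e = 0"
    using unit_orthogonal_exists[OF cpd] by blast
  show ?thesis by (rule that[of d e]) (use assms d e in \<open>simp add: orthonormal4_def\<close>)
qed

section \<open>The tangent body, compared cell by cell with a body of revolution\<close>

locale tangent_body =
  fixes c :: "real^4" and \<rho> \<sigma> :: real
  assumes c_unit: "c \<bullet> c = 1" and \<rho>_pos: "0 < \<rho>"
    and cut: "cutoff_profile (\<lambda>\<tau>. capH (\<rho> * sqrt (1 + \<tau>))) \<sigma>"

sublocale tangent_body \<subseteq> cutoff_profile "\<lambda>\<tau>. capH (\<rho> * sqrt (1 + \<tau>))" \<sigma>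
  by (rule cut)

context tangent_body begin

definition half :: "(real^4) set" where "half = {x. 0 < x \<bullet> c \<and> norm x \<le> 1}"

text \<open>With \<rho> the tangent of the radius r and \<open>p\<close> a unit vector orthogonal to
  \<open>c\<close>, each constraint is the half space with unit normal (sin r) c - (cos r) p, whose
  boundary touches the ball.\<close>

definition body :: "(real^4) set \<Rightarrow> (real^4) set" where
  "body N = {x \<in> half. \<forall>p\<in>N. x \<bullet> p \<le> \<rho> * (x \<bullet> c)}"

text \<open>Subtracting \<open>ratio\<close> times this body amounts to subtracting \<open>\<mu>\<close> from the density; it is a solid of
  revolution about \<open>c\<close>, so the sum of its parts over the cells does not depend on the configuration.\<close>
definition reference :: "(real^4) set" where
  "reference = {x \<in> half. (norm x)\<^sup>2 - (x \<bullet> c)\<^sup>2 \<le> (3 * \<rho> * (x \<bullet> c))\<^sup>2}"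

text \<open>The reference body has the same density \<open>capH (3 * \<rho>)\<close> in every
  direction, so this factor scales it to \<mu>. Since 3 = sqrt (1 + 8), that density is
  \<open>k\<close> at the rim of the disc, which exceeds \<mu> and makes the factor less than
  1.\<close>

definition ratio :: real where "ratio = \<mu> / capH (3 * \<rho>)"

definition disc :: "(real \<times> real) set" where "disc = {v. (norm v)\<^sup>2 \<le> 8}"

lemma ratio_bounds: "0 < ratio" "ratio < 1" "ratio * capH (3 * \<rho>) = \<mu>"
proof -
  have "0 < capH (\<rho> * sqrt (1 + 2))" "0 < capH (3 * \<rho>)" using \<rho>_pos by (auto intro!: capH_pos)
  moreover have "\<rho> * sqrt (1 + 8) = 3 * \<rho>" by simp
  ultimately show "0 < ratio" "ratio < 1" "ratio * capH (3 * \<rho>) = \<mu>"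
    using k_between by (auto simp: ratio_def mult.commute)
qed

lemma half_borel: "half \<in> sets borel"
proof -
  have "half = {x. 0 < x \<bullet> c} \<inter> cball 0 1" by (auto simp: half_def)
  moreover have "open {x. 0 < x \<bullet> c}" by (intro open_Collect_less continuous_intros)
  ultimately show ?thesis by simp
qed

lemma body_borel: "finite N \<Longrightarrow> body N \<in> sets borel"
proof -
  assume "finite N"
  have "body N = half \<inter> (\<Inter>p\<in>N. {x. x \<bullet> p \<le> \<rho> * (x \<bullet> c)})" by (auto simp: body_def)
  moreover have "closed (\<Inter>p\<in>N. {x. x \<bullet> p \<le> \<rho> * (x \<bullet> c)})"
    by (intro closed_INT ballI closed_Collect_le continuous_intros)
  ultimately show ?thesis using half_borel by simp
qed

lemma reference_borel: "reference \<in> sets borel"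
proof -
  have "reference = half \<inter> {x. (norm x)\<^sup>2 - (x \<bullet> c)\<^sup>2 \<le> (3 * \<rho> * (x \<bullet> c))\<^sup>2}" by (auto simp: reference_def)
  moreover have "closed {x. (norm x)\<^sup>2 - (x \<bullet> c)\<^sup>2 \<le> (3 * \<rho> * (x \<bullet> c))\<^sup>2}"
    by (intro closed_Collect_le continuous_intros)
  ultimately show ?thesis using half_borel by simp
qed

lemma disc_borel: "disc \<in> sets borel"
  unfolding disc_def by (intro borel_closed closed_Collect_le continuous_intros)

lemma disc_eq_cball: "disc = cball 0 (sqrt 8)"
proof -
  have "(norm v)\<^sup>2 \<le> 8 \<longleftrightarrow> norm v \<le> sqrt 8" for v :: "real \<times> real"
    using power_mono_iff[of "norm v" "sqrt 8" 2] by simp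
  then show ?thesis by (simp add: disc_def cball_def dist_norm)
qed

lemma integrable_on_disc:
  fixes f :: "real \<Rightarrow> real"
  assumes f: "continuous_on {0..} f" and E: "E \<in> sets borel" "E \<subseteq> disc"
  shows "integrable lborel (\<lambda>v. indicator E v * f ((norm v)\<^sup>2))"
proof -
  have "continuous_on disc (\<lambda>v. f ((norm v)\<^sup>2))"
    by (rule continuous_on_compose2[OF f]) (auto intro!: continuous_intros)
  then have "integrable lborel (\<lambda>v. indicator disc v *\<^sub>R f ((norm v)\<^sup>2))"
    unfolding disc_eq_cball by (intro borel_integrable_compact) auto
  from integrable_mult_indicator[OF _ this, of E]
  have "integrable lborel (\<lambda>v. indicator E v *\<^sub>R indicator disc v *\<^sub>R f ((norm v)\<^sup>2))" using E by simp
  moreover have "indicator E v *\<^sub>R indicator disc v *\<^sub>R f ((norm v)\<^sup>2) = indicator E v * f ((norm v)\<^sup>2)" for v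
    using E by (auto simp: indicator_def)
  ultimately show ?thesis by (simp only:)
qed

text \<open>Both sets are chart regions, with the bounds \<rho> and 3 \<rho> / s(v), where s(v)^2 =
  1 + \<bar>v\<bar>^2. The second bound cancels the factor s inside \<open>capH\<close> and leaves a
  constant numerator, so the difference has density \<open>\<kappa>\<close> / 4.\<close>

lemma chart_measure:
  assumes o: "orthonormal4 c p d e" and E: "E \<in> sets borel" "E \<subseteq> disc"
    and R: "R = {x. 0 < x \<bullet> p \<and> (x \<bullet> d / (x \<bullet> p), x \<bullet> e / (x \<bullet> p)) \<in> E}"
  shows "measure lborel ({x \<in> half. x \<bullet> p \<le> \<rho> * (x \<bullet> c)} \<inter> R) - ratio * measure lborel (reference \<inter> R)
    = (\<integral>v. indicator E v * \<kappa> ((norm v)\<^sup>2) \<partial>lborel) / 4"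
proof -
  define s where "s = (\<lambda>v::real\<times>real. sqrt (1 + (norm v)\<^sup>2))"
  have s: "0 < s v" "(s v)\<^sup>2 = 1 + (norm v)\<^sup>2" for v by (simp_all add: s_def add_pos_nonneg)
  have s_meas: "s \<in> borel_measurable borel" unfolding s_def by measurable
  define f where "f = (\<lambda>b \<tau>. capH (b * sqrt (1 + \<tau>)) / (4 * sqrt (1 + \<tau>) ^ 3))"
  define f2 where "f2 = (\<lambda>\<tau>::real. capH (3 * \<rho>) / (4 * sqrt (1 + \<tau>) ^ 3))"
  have f_cont: "continuous_on {0..} (f \<rho>)" "continuous_on {0..} f2"
    unfolding f_def f2_def
    by (intro continuous_intros continuous_on_compose2[OF continuous_on_capH[of UNIV]]; simp)+
  have f_nonneg: "0 \<le> f \<rho> ((norm v)\<^sup>2)" "0 \<le> f2 ((norm v)\<^sup>2)" for v :: "real \<times> real"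
    unfolding f_def f2_def using \<rho>_pos s(1)[of v, unfolded s_def]
    by (auto intro!: divide_nonneg_nonneg less_imp_le[OF capH_pos])
  have m: "measure lborel S = (\<integral>v. indicator E v * g ((norm v)\<^sup>2) \<partial>lborel)"
    if "emeasure lborel S = (\<integral>\<^sup>+ v. indicator E v * ennreal (g ((norm v)\<^sup>2)) \<partial>lborel)"
      "continuous_on {0..} g" "\<And>v::real\<times>real. 0 \<le> g ((norm v)\<^sup>2)" for S :: "(real^4) set" and g
  proof -
    have "(\<integral>v. indicator E v * g ((norm v)\<^sup>2) \<partial>lborel) = enn2real (\<integral>\<^sup>+ v. ennreal (indicator E v * g ((norm v)\<^sup>2)) \<partial>lborel)"
      using borel_measurable_integrable[OF integrable_on_disc[OF that(2) E]] that(3)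
      by (intro integral_eq_nn_integral) auto
    also have "(\<integral>\<^sup>+ v. ennreal (indicator E v * g ((norm v)\<^sup>2)) \<partial>lborel) = emeasure lborel S"
      unfolding that(1) by (intro nn_integral_cong) (simp add: indicator_def)
    finally show ?thesis by (simp add: measure_def)
  qed
  have "{x \<in> half. x \<bullet> p \<le> \<rho> * (x \<bullet> c)} \<inter> R = {x. 0 < x \<bullet> c \<and> 0 < x \<bullet> p \<and> norm x \<le> 1 \<and>
        (x \<bullet> d / (x \<bullet> p), x \<bullet> e / (x \<bullet> p)) \<in> E \<and> x \<bullet> p \<le> \<rho> * (x \<bullet> c)}"
    by (auto simp: half_def R)
  then have "emeasure lborel ({x \<in> half. x \<bullet> p \<le> \<rho> * (x \<bullet> c)} \<inter> R) =
      (\<integral>\<^sup>+ v. indicator E v * ennreal (f \<rho> ((norm v)\<^sup>2)) \<partial>lborel)"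
    using emeasure_chart_region[OF o E(1), of "\<lambda>_. \<rho>"] \<rho>_pos by (simp add: f_def)
  from m[OF this f_cont(1) f_nonneg(1)]
  have m1: "measure lborel ({x \<in> half. x \<bullet> p \<le> \<rho> * (x \<bullet> c)} \<inter> R) =
      (\<integral>v. indicator E v * f \<rho> ((norm v)\<^sup>2) \<partial>lborel)" .
  have iff: "(norm x)\<^sup>2 - (x \<bullet> c)\<^sup>2 \<le> (3 * \<rho> * (x \<bullet> c))\<^sup>2 \<longleftrightarrow>
      x \<bullet> p \<le> 3 * \<rho> / s (x \<bullet> d / (x \<bullet> p), x \<bullet> e / (x \<bullet> p)) * (x \<bullet> c)"
    if x: "0 < x \<bullet> c" "0 < x \<bullet> p" for x
  proof -
    let ?v = "(x \<bullet> d / (x \<bullet> p), x \<bullet> e / (x \<bullet> p))"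
    have "(norm x)\<^sup>2 - (x \<bullet> c)\<^sup>2 = (x \<bullet> p * s ?v)\<^sup>2"
      using x unfolding power_mult_distrib s(2) orthonormal4_norm[OF o, of x]
      by (simp add: norm_Pair power_divide field_simps)
    also have "\<dots> \<le> (3 * \<rho> * (x \<bullet> c))\<^sup>2 \<longleftrightarrow> x \<bullet> p * s ?v \<le> 3 * \<rho> * (x \<bullet> c)"
      using x s(1)[of ?v] \<rho>_pos by (intro power_mono_iff) auto
    also have "\<dots> \<longleftrightarrow> x \<bullet> p \<le> 3 * \<rho> / s ?v * (x \<bullet> c)"
      using s(1)[of ?v] by (simp add: le_divide_eq)
    finally show ?thesis .
  qed
  have "reference \<inter> R = {x. 0 < x \<bullet> c \<and> 0 < x \<bullet> p \<and> norm x \<le> 1 \<and>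
        (x \<bullet> d / (x \<bullet> p), x \<bullet> e / (x \<bullet> p)) \<in> E \<and>
        x \<bullet> p \<le> 3 * \<rho> / s (x \<bullet> d / (x \<bullet> p), x \<bullet> e / (x \<bullet> p)) * (x \<bullet> c)}"
    using iff by (auto simp: half_def reference_def R)
  moreover have "emeasure lborel \<dots> = (\<integral>\<^sup>+ v. indicator E v * ennreal (f2 ((norm v)\<^sup>2)) \<partial>lborel)"
  proof (subst emeasure_chart_region[OF o E(1)])
    show "(\<lambda>v. 3 * \<rho> / s v) \<in> borel_measurable borel" using s_meas by measurable
    show "0 < 3 * \<rho> / s v" for v using s(1)[of v] \<rho>_pos by simp
    show "(\<integral>\<^sup>+ v. indicator E v * ennreal (capH (3 * \<rho> / s v * sqrt (1 + (norm v)\<^sup>2)) / (4 * sqrt (1 + (norm v)\<^sup>2) ^ 3)) \<partial>lborel)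
      = (\<integral>\<^sup>+ v. indicator E v * ennreal (f2 ((norm v)\<^sup>2)) \<partial>lborel)"
      using s(1) unfolding f2_def s_def by (intro nn_integral_cong) (simp add: less_imp_neq[symmetric])
  qed
  ultimately have "emeasure lborel (reference \<inter> R) = (\<integral>\<^sup>+ v. indicator E v * ennreal (f2 ((norm v)\<^sup>2)) \<partial>lborel)" by simp
  from m[OF this f_cont(2) f_nonneg(2)]
  have m2: "measure lborel (reference \<inter> R) = (\<integral>v. indicator E v * f2 ((norm v)\<^sup>2) \<partial>lborel)" .
  have "indicator E v * \<kappa> ((norm v)\<^sup>2) / 4 =
      indicator E v * f \<rho> ((norm v)\<^sup>2) - ratio * (indicator E v * f2 ((norm v)\<^sup>2))" for v
  proof -
    have "f \<rho> ((norm v)\<^sup>2) - ratio * f2 ((norm v)\<^sup>2) = \<kappa> ((norm v)\<^sup>2) / 4"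
      unfolding f_def f2_def \<kappa>_def ratio_bounds(3)[symmetric] by (simp add: diff_divide_distrib)
    then show ?thesis by (simp add: indicator_def)
  qed
  then have "(\<integral>v. indicator E v * \<kappa> ((norm v)\<^sup>2) \<partial>lborel) / 4 =
      (\<integral>v. indicator E v * f \<rho> ((norm v)\<^sup>2) - ratio * (indicator E v * f2 ((norm v)\<^sup>2)) \<partial>lborel)"
    by (simp only: integral_divide_zero[symmetric])
  also have "\<dots> = (\<integral>v. indicator E v * f \<rho> ((norm v)\<^sup>2) \<partial>lborel) - ratio * (\<integral>v. indicator E v * f2 ((norm v)\<^sup>2) \<partial>lborel)"
    using integrable_on_disc[OF f_cont(1) E] integrable_on_disc[OF f_cont(2) E] by simp
  finally show ?thesis using m1 m2 by simp
qed


text \<open>In the chart x = p + v this is the far side of the bisector, where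
  \<open>x \<bullet> q \<ge> x \<bullet> p\<close>.\<close>

definition wedge :: "real^4 \<Rightarrow> real^4 \<Rightarrow> real^4 \<Rightarrow> real^4 \<Rightarrow> (real \<times> real) set" where
  "wedge p d e q = {v. 1 - p \<bullet> q \<le> (q \<bullet> d, q \<bullet> e) \<bullet> v}"

definition cone_disc :: "real^4 \<Rightarrow> real^4 \<Rightarrow> real^4 \<Rightarrow> (real^4) set" where
  "cone_disc p d e = {x. 0 < x \<bullet> p \<and> (x \<bullet> d / (x \<bullet> p), x \<bullet> e / (x \<bullet> p)) \<in> disc}"

lemma wedge_borel: "wedge p d e q \<in> sets borel"
  unfolding wedge_def by (intro borel_closed closed_Collect_le continuous_intros)

lemma UN_wedge_borel: "finite J \<Longrightarrow> (\<Union>q\<in>J. wedge p d e q) \<in> sets borel"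
  using wedge_borel by (intro sets.finite_UN) auto

lemma cone_disc_iff:
  assumes o: "orthonormal4 c p d e"
  shows "x \<in> cone_disc p d e \<longleftrightarrow> 0 < x \<bullet> p \<and> (norm x)\<^sup>2 - (x \<bullet> c)\<^sup>2 \<le> 9 * (x \<bullet> p)\<^sup>2"
proof (cases "0 < x \<bullet> p")
  case True
  have "(norm (x \<bullet> d / (x \<bullet> p), x \<bullet> e / (x \<bullet> p)))\<^sup>2 = ((x \<bullet> d)\<^sup>2 + (x \<bullet> e)\<^sup>2) / (x \<bullet> p)\<^sup>2"
    by (simp add: norm_Pair power_divide add_divide_distrib)
  then show ?thesis using True orthonormal4_norm[OF o, of x]
    by (auto simp: cone_disc_def disc_def divide_le_eq)
qed (simp add: cone_disc_def)

lemma cone_disc_borel: "orthonormal4 c p d e \<Longrightarrow> cone_disc p d e \<in> sets borel"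
proof -
  assume o: "orthonormal4 c p d e"
  have "cone_disc p d e = {x. 0 < x \<bullet> p} \<inter> {x. (norm x)\<^sup>2 - (x \<bullet> c)\<^sup>2 \<le> 9 * (x \<bullet> p)\<^sup>2}"
    using cone_disc_iff[OF o] by auto
  moreover have "open {x. 0 < x \<bullet> p}" "closed {x. (norm x)\<^sup>2 - (x \<bullet> c)\<^sup>2 \<le> 9 * (x \<bullet> p)\<^sup>2}"
    by (intro open_Collect_less closed_Collect_le continuous_intros)+
  ultimately show ?thesis by simp
qed

definition config :: "(real^4) set \<Rightarrow> bool" where
  "config N \<longleftrightarrow> card N = 4 \<and> (\<forall>p\<in>N. p \<bullet> p = 1 \<and> p \<bullet> c = 0)"

lemma config_finite: "config N \<Longrightarrow> finite N"
  by (rule card_ge_0_finite) (simp add: config_def)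

definition cell_excess :: "(real^4) set \<Rightarrow> real^4 \<Rightarrow> real" where
  "cell_excess N p = measure lborel (body N \<inter> cell N p) - ratio * measure lborel (reference \<inter> cell N p)"

lemma body_cell: "p \<in> N \<Longrightarrow> body N \<inter> cell N p = {x \<in> half. x \<bullet> p \<le> \<rho> * (x \<bullet> c)} \<inter> cell N p"
proof -
  assume p: "p \<in> N"
  have "x \<bullet> q \<le> \<rho> * (x \<bullet> c)" if "x \<in> cell N p" "x \<bullet> p \<le> \<rho> * (x \<bullet> c)" "q \<in> N" for x q
  proof (cases "q = p")
    case False
    then have "x \<bullet> q < x \<bullet> p" using that by (simp add: cell_def)
    then show ?thesis using that by simp
  qed (use that in simp)
  then show ?thesis using p by (auto simp: body_def)
qed

lemma cell_cone_disc:
  assumes o: "orthonormal4 c p d e" and N: "config N" and p: "p \<in> N"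
  shows "cell N p \<inter> cone_disc p d e =
    {x. 0 < x \<bullet> p \<and> (x \<bullet> d / (x \<bullet> p), x \<bullet> e / (x \<bullet> p)) \<in> disc - (\<Union>q\<in>N - {p}. wedge p d e q)}"
proof -
  have "x \<bullet> q < x \<bullet> p \<longleftrightarrow> (x \<bullet> d / (x \<bullet> p), x \<bullet> e / (x \<bullet> p)) \<notin> wedge p d e q"
    if x: "0 < x \<bullet> p" and q: "q \<in> N" for x q
  proof -
    have "q \<bullet> c = 0" using N q by (simp add: config_def)
    then have "x \<bullet> q = (x \<bullet> p) * (p \<bullet> q + (q \<bullet> d, q \<bullet> e) \<bullet> (x \<bullet> d / (x \<bullet> p), x \<bullet> e / (x \<bullet> p)))"
      using x by (subst orthonormal4_inner[OF o]) (simp add: inner_Pair field_simps inner_commute[of q p])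
    also have "\<dots> < x \<bullet> p \<longleftrightarrow> p \<bullet> q + (q \<bullet> d, q \<bullet> e) \<bullet> (x \<bullet> d / (x \<bullet> p), x \<bullet> e / (x \<bullet> p)) < 1"
      using x by (simp add: mult_less_cancel_left_pos)
    finally show ?thesis unfolding wedge_def by auto
  qed
  then show ?thesis by (auto simp: cell_def cone_disc_def)
qed

text \<open>Beyond the cone over the disc, a point of the reference body satisfies the constraint of
  \<open>p\<close>: there \<bar>x\<bar>^2 - (x \<bullet> c)^2 exceeds 9 (x \<bullet> p)^2, or
  \<open>x \<bullet> p\<close> is not positive. So within the cell the body contains the reference
  there, and as \<open>ratio < 1\<close> that part contributes nonnegatively. It is absent when the
  cell stays over the disc.\<close>

lemma cell_excess_chart:
  assumes o: "orthonormal4 c p d e" and N: "config N" and p: "p \<in> N"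
  shows "(\<integral>v. indicator (disc - (\<Union>q\<in>N - {p}. wedge p d e q)) v * \<kappa> ((norm v)\<^sup>2) \<partial>lborel) / 4 \<le> cell_excess N p"
    and "half \<inter> cell N p \<subseteq> cone_disc p d e \<Longrightarrow>
      cell_excess N p = (\<integral>v. indicator (disc - (\<Union>q\<in>N - {p}. wedge p d e q)) v * \<kappa> ((norm v)\<^sup>2) \<partial>lborel) / 4"
proof -
  define A where "A = cone_disc p d e"
  let ?E = "disc - (\<Union>q\<in>N - {p}. wedge p d e q)"
  let ?C = "cell N p"
  have fin: "finite N" using N by (rule config_finite)
  have sets: "A \<in> sets lborel" "?C \<in> sets lborel" "body N \<in> sets lborel" "reference \<in> sets lborel"
    using cone_disc_borel[OF o] cell_borel[OF fin] body_borel[OF fin] reference_borel by (auto simp: A_def)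
  have E: "?E \<in> sets borel" "?E \<subseteq> disc" using disc_borel UN_wedge_borel[of "N - {p}" p d e] fin by auto
  have bounded: "norm x \<le> 1" if "x \<in> body N \<union> reference" for x
    using that by (auto simp: body_def reference_def half_def)
  have fm: "S \<inter> ?C \<in> fmeasurable lborel" if "S \<in> {body N, reference}" for S
    using that sets emeasure_bounded_finite[of "S \<inter> ?C"] bounded by (intro fmeasurableI) auto
  have split: "measure lborel (S \<inter> ?C) = measure lborel (S \<inter> (?C \<inter> A)) + measure lborel (S \<inter> ?C - A)"
    if "S \<in> {body N, reference}" for S
  proof -
    have "measure lborel (S \<inter> ?C) = measure lborel (S \<inter> ?C \<inter> A \<union> (S \<inter> ?C - A))"
      by (rule arg_cong[where f="measure lborel"]) auto
    also have "\<dots> = measure lborel (S \<inter> ?C \<inter> A) + measure lborel (S \<inter> ?C - A)"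
      using fm[OF that] sets by (intro measure_Un_AE) (auto intro: fmeasurable_Int_fmeasurable fmeasurable_Diff)
    finally show ?thesis by (simp add: Int_assoc)
  qed
  have main: "measure lborel (body N \<inter> (?C \<inter> A)) - ratio * measure lborel (reference \<inter> (?C \<inter> A))
      = (\<integral>v. indicator ?E v * \<kappa> ((norm v)\<^sup>2) \<partial>lborel) / 4"
  proof -
    have "body N \<inter> (?C \<inter> A) = {x \<in> half. x \<bullet> p \<le> \<rho> * (x \<bullet> c)} \<inter> (?C \<inter> A)"
      using body_cell[OF p] by auto
    then show ?thesis
      using chart_measure[OF o E, of "?C \<inter> A"] cell_cone_disc[OF o N p] by (simp add: A_def)
  qed
  have eq: "cell_excess N p = (\<integral>v. indicator ?E v * \<kappa> ((norm v)\<^sup>2) \<partial>lborel) / 4 +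
      (measure lborel (body N \<inter> ?C - A) - ratio * measure lborel (reference \<inter> ?C - A))"
    unfolding cell_excess_def main[symmetric] using split[of "body N"] split[of reference]
    by (simp add: algebra_simps)
  have "measure lborel (reference \<inter> ?C - A) \<le> measure lborel (body N \<inter> ?C - A)"
  proof (rule measure_mono_fmeasurable)
    show "reference \<inter> ?C - A \<subseteq> body N \<inter> ?C - A"
    proof
      fix x assume x: "x \<in> reference \<inter> ?C - A"
      have "x \<bullet> p \<le> \<rho> * (x \<bullet> c)"
      proof (cases "0 < x \<bullet> p")
        case True
        then have "9 * (x \<bullet> p)\<^sup>2 < (3 * \<rho> * (x \<bullet> c))\<^sup>2"
          using x cone_disc_iff[OF o, of x] by (auto simp: A_def reference_def)
        then have "(x \<bullet> p)\<^sup>2 < (\<rho> * (x \<bullet> c))\<^sup>2" by (simp add: power_mult_distrib)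
        moreover have "0 \<le> \<rho> * (x \<bullet> c)" using x \<rho>_pos by (auto simp: reference_def half_def)
        ultimately show ?thesis by (blast intro: less_imp_le power_less_imp_less_base)
      next
        case False
        moreover have "0 \<le> \<rho> * (x \<bullet> c)" using x \<rho>_pos by (auto simp: reference_def half_def)
        ultimately show ?thesis by linarith
      qed
      then show "x \<in> body N \<inter> ?C - A" using x body_cell[OF p] by (auto simp: reference_def)
    qed
    show "body N \<inter> ?C - A \<in> fmeasurable lborel" using fm[of "body N"] sets by (auto intro: fmeasurable_Diff)
    show "reference \<inter> ?C - A \<in> sets lborel" using sets by auto
  qed
  moreover have "ratio * measure lborel (reference \<inter> ?C - A) \<le> 1 * measure lborel (reference \<inter> ?C - A)"
    using ratio_bounds by (intro mult_right_mono) auto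
  ultimately show "(\<integral>v. indicator ?E v * \<kappa> ((norm v)\<^sup>2) \<partial>lborel) / 4 \<le> cell_excess N p"
    unfolding eq by simp
  assume sub: "half \<inter> cell N p \<subseteq> cone_disc p d e"
  then have e: "body N \<inter> ?C - A = {}" "reference \<inter> ?C - A = {}"
    by (auto simp: body_def reference_def A_def)
  show "cell_excess N p = (\<integral>v. indicator ?E v * \<kappa> ((norm v)\<^sup>2) \<partial>lborel) / 4"
    unfolding eq e by simp
qed

definition disc_integral :: real where
  "disc_integral = (\<integral>v. indicator disc v * \<kappa> ((norm (v::real\<times>real))\<^sup>2) \<partial>lborel)"

lemma disc_diff_integral:
  assumes U: "U \<in> sets borel"
  shows "(\<integral>v. indicator (disc - U) v * \<kappa> ((norm v)\<^sup>2) \<partial>lborel) =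
    disc_integral - (\<integral>v. indicator (disc \<inter> U) v * \<kappa> ((norm v)\<^sup>2) \<partial>lborel)"
proof -
  have "(\<integral>v. indicator (disc - U) v * \<kappa> ((norm v)\<^sup>2) \<partial>lborel) =
    (\<integral>v. indicator disc v * \<kappa> ((norm v)\<^sup>2) - indicator (disc \<inter> U) v * \<kappa> ((norm v)\<^sup>2) \<partial>lborel)"
    by (intro Bochner_Integration.integral_cong) (auto simp: indicator_def)
  also have "\<dots> = disc_integral - (\<integral>v. indicator (disc \<inter> U) v * \<kappa> ((norm v)\<^sup>2) \<partial>lborel)"
    unfolding disc_integral_def using U disc_borel
    by (intro Bochner_Integration.integral_diff integrable_on_disc[OF continuous_on_\<kappa>]) auto
  finally show ?thesis .
qed

text \<open>Truncation drops only points with \<tau> < \<sigma> < 2, where \<open>\<kappa>\<close>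
  is negative.\<close>

lemma disc_Int_integral_le:
  assumes U: "U \<in> sets borel"
  shows "(\<integral>v. indicator (disc \<inter> U) v * \<kappa> ((norm v)\<^sup>2) \<partial>lborel) \<le> (\<integral>v. indicator U v * \<kappa>p v \<partial>lborel)"
proof (rule integral_mono)
  show "integrable lborel (\<lambda>v. indicator (disc \<inter> U) v * \<kappa> ((norm v)\<^sup>2))"
    using U disc_borel by (intro integrable_on_disc[OF continuous_on_\<kappa>]) auto
  show "integrable lborel (\<lambda>v. indicator U v * \<kappa>p v)" by (rule integrable_\<kappa>p[OF U])
  fix v :: "real \<times> real"
  show "indicator (disc \<inter> U) v * \<kappa> ((norm v)\<^sup>2) \<le> indicator U v * \<kappa>p v"
    using \<kappa>_neg[of "(norm v)\<^sup>2"] \<sigma>_bounds by (auto simp: indicator_def \<kappa>c_def disc_def)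
qed

text \<open>With g = p \<bullet> q, the boundary line of the wedge has distance z from the centre
  with z^2 = (1 - g) / (1 + g), and z = sqrt 2 exactly for g = -1/3. The optimality of the half
  plane at sqrt 2 does the rest.\<close>

lemma wedge_integral_le:
  assumes o: "orthonormal4 c p d e" and N: "config N" and pq: "p \<in> N" "q \<in> N" "p \<noteq> q"
  shows "(\<integral>v. indicator (wedge p d e q) v * \<kappa>p v \<partial>lborel) \<le> halfplane (sqrt 2)"
    "p \<bullet> q \<noteq> - 1 / 3 \<Longrightarrow> (\<integral>v. indicator (wedge p d e q) v * \<kappa>p v \<partial>lborel) < halfplane (sqrt 2)"
    "p \<bullet> q = - 1 / 3 \<Longrightarrow> (\<integral>v. indicator (wedge p d e q) v * \<kappa>p v \<partial>lborel) = halfplane (sqrt 2)"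
proof -
  define g where "g = p \<bullet> q"
  define \<delta> where "\<delta> = (q \<bullet> d, q \<bullet> e)"
  have u: "p \<bullet> p = 1" "q \<bullet> q = 1" "q \<bullet> c = 0" using N pq by (auto simp: config_def)
  have "1 = g\<^sup>2 + (norm \<delta>)\<^sup>2"
    using orthonormal4_inner[OF o, of q q] u
    by (simp add: \<delta>_def g_def norm_Pair power2_eq_square inner_commute[of q p])
  then have n\<delta>: "(norm \<delta>)\<^sup>2 = (1 - g) * (1 + g)" by (simp add: power2_eq_square algebra_simps)
  have "0 < (p - q) \<bullet> (p - q)" using pq by simp
  then have g1: "g < 1" using u by (simp add: g_def inner_diff_left inner_diff_right inner_commute[of q p])
  have int: "(\<integral>v. indicator (wedge p d e q) v * \<kappa>p v \<partial>lborel) = (\<integral>v. indicator {v. 1 - g \<le> \<delta> \<bullet> v} v * \<kappa>p v \<partial>lborel)"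
    by (simp add: wedge_def g_def \<delta>_def)
  have "(\<integral>v. indicator (wedge p d e q) v * \<kappa>p v \<partial>lborel) \<le> halfplane (sqrt 2) \<and>
    (g \<noteq> - 1 / 3 \<longrightarrow> (\<integral>v. indicator (wedge p d e q) v * \<kappa>p v \<partial>lborel) < halfplane (sqrt 2)) \<and>
    (g = - 1 / 3 \<longrightarrow> (\<integral>v. indicator (wedge p d e q) v * \<kappa>p v \<partial>lborel) = halfplane (sqrt 2))"
  proof (cases "\<delta> = 0")
    case True
    then have "(1 - g) * (1 + g) = 0" using n\<delta> by simp
    \<comment> \<open>The antipodal case q = -p: the wedge is empty and has no boundary line, so the
      comparison uses that the optimal half plane has positive integral.\<close>
    then have "g = - 1" using g1 by auto
    moreover have "(\<integral>v. indicator (wedge p d e q) v * \<kappa>p v \<partial>lborel) = 0"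
      unfolding int using True g1 by simp
    ultimately show ?thesis using halfplane_sqrt2_pos by simp
  next
    case False
    define z where "z = (1 - g) / norm \<delta>"
    have "(norm \<delta>)\<^sup>2 > 0" using False by simp
    then have g2: "- 1 < g" using n\<delta> g1 by (simp add: zero_less_mult_iff)
    have z: "0 \<le> z" "z\<^sup>2 = (1 - g) / (1 + g)"
      using g1 g2 by (simp_all add: z_def power_divide n\<delta>) (simp add: power2_eq_square)
    have "z = sqrt 2 \<longleftrightarrow> z\<^sup>2 = 2" using z(1) by (metis real_sqrt_pow2 real_sqrt_unique zero_le_numeral)
    also have "\<dots> \<longleftrightarrow> g = - 1 / 3" unfolding z(2) using g2 by (simp add: divide_eq_eq) linarith
    finally have "z = sqrt 2 \<longleftrightarrow> g = - 1 / 3" .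
    then show ?thesis unfolding int rotated_halfplane[OF False] z_def[symmetric]
      using halfplane_le[OF z(1)] by auto
  qed
  then show "(\<integral>v. indicator (wedge p d e q) v * \<kappa>p v \<partial>lborel) \<le> halfplane (sqrt 2)"
    "p \<bullet> q \<noteq> - 1 / 3 \<Longrightarrow> (\<integral>v. indicator (wedge p d e q) v * \<kappa>p v \<partial>lborel) < halfplane (sqrt 2)"
    "p \<bullet> q = - 1 / 3 \<Longrightarrow> (\<integral>v. indicator (wedge p d e q) v * \<kappa>p v \<partial>lborel) = halfplane (sqrt 2)"
    by (simp_all add: g_def)
qed

lemma wedge_outward:
  assumes N: "config N" and pq: "p \<in> N" "q \<in> N" and v: "v \<in> wedge p d e q" and l: "1 \<le> l"
  shows "l *\<^sub>R v \<in> wedge p d e q"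
proof -
  have "p \<bullet> q \<le> norm p * norm q" by (rule norm_cauchy_schwarz)
  also have "\<dots> = 1" using N pq by (simp add: config_def norm_eq_sqrt_inner)
  finally have "0 \<le> 1 - p \<bullet> q" by simp
  moreover have "1 - p \<bullet> q \<le> (q \<bullet> d, q \<bullet> e) \<bullet> v" using v by (simp add: wedge_def)
  ultimately have "1 * (1 - p \<bullet> q) \<le> l * ((q \<bullet> d, q \<bullet> e) \<bullet> v)" using l by (intro mult_mono) auto
  then show ?thesis by (simp add: wedge_def)
qed

text \<open>Subtract from the disc the union of three wedges, truncate, use subadditivity, and bound
  each wedge by the regular one. A single pair with the wrong angle makes the last step
  strict.\<close>

lemma cell_excess_ge:
  assumes N: "config N" and p: "p \<in> N"
  shows "disc_integral - 3 * halfplane (sqrt 2) \<le> 4 * cell_excess N p"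
    "q \<in> N \<Longrightarrow> p \<noteq> q \<Longrightarrow> p \<bullet> q \<noteq> - 1 / 3 \<Longrightarrow> disc_integral - 3 * halfplane (sqrt 2) < 4 * cell_excess N p"
proof -
  have "c \<bullet> p = 0" "p \<bullet> p = 1" using N p by (simp_all add: config_def inner_commute[of c p])
  then obtain d e where o: "orthonormal4 c p d e" using orthonormal_extend[OF c_unit] by blast
  let ?I = "\<lambda>q. \<integral>v. indicator (wedge p d e q) v * \<kappa>p v \<partial>lborel"
  let ?U = "\<Union>q\<in>N - {p}. wedge p d e q"
  have fin: "finite (N - {p})" and card: "card (N - {p}) = 3"
    using config_finite[OF N] N p by (auto simp: config_def)
  have U: "?U \<in> sets borel" by (rule UN_wedge_borel[OF fin])
  have "(\<integral>v. indicator (disc \<inter> ?U) v * \<kappa> ((norm v)\<^sup>2) \<partial>lborel) \<le> (\<integral>v. indicator ?U v * \<kappa>p v \<partial>lborel)"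
    by (rule disc_Int_integral_le[OF U])
  also have "\<dots> \<le> (\<Sum>q\<in>N - {p}. ?I q)"
    using wedge_outward[OF N p] wedge_borel by (intro union_outward_integral_le[OF fin]) auto
  finally have 1: "disc_integral - (\<Sum>q\<in>N - {p}. ?I q) \<le> 4 * cell_excess N p"
    using cell_excess_chart(1)[OF o N p] disc_diff_integral[OF U] by simp
  have "(\<Sum>q\<in>N - {p}. ?I q) \<le> (\<Sum>q\<in>N - {p}. halfplane (sqrt 2))"
    using wedge_integral_le(1)[OF o N p] by (intro sum_mono) auto
  then show "disc_integral - 3 * halfplane (sqrt 2) \<le> 4 * cell_excess N p" using 1 card by simp
  assume q: "q \<in> N" "p \<noteq> q" "p \<bullet> q \<noteq> - 1 / 3"
  have "(\<Sum>q\<in>N - {p}. ?I q) < (\<Sum>q\<in>N - {p}. halfplane (sqrt 2))"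
    using wedge_integral_le(1)[OF o N p] wedge_integral_le(2)[OF o N p q] q fin
    by (intro sum_strict_mono_ex1) auto
  then show "disc_integral - 3 * halfplane (sqrt 2) < 4 * cell_excess N p" using 1 card by simp
qed

text \<open>The factor 1/4 of the chart formula cancels against the four cells.\<close>

definition minimum :: real where
  "minimum = ratio * measure lborel reference + disc_integral - 3 * halfplane (sqrt 2)"

lemma measure_body_cells:
  assumes N: "config N"
  shows "measure lborel (body N) = ratio * measure lborel reference + (\<Sum>p\<in>N. cell_excess N p)"
proof -
  have fin: "finite N" and ne: "N \<noteq> {}" using N config_finite[OF N] by (auto simp: config_def)
  have "emeasure lborel (body N) < \<infinity>" "emeasure lborel reference < \<infinity>"
    by (rule emeasure_bounded_finite; auto simp: body_def reference_def half_def)+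
  then show ?thesis
    using measure_sum_cells[OF fin ne body_borel[OF fin]] measure_sum_cells[OF fin ne reference_borel]
    by (simp add: cell_excess_def sum_subtractf sum_distrib_left)
qed

theorem measure_body_ge:
  assumes N: "config N"
  shows "minimum \<le> measure lborel (body N)"
    "p \<in> N \<Longrightarrow> q \<in> N \<Longrightarrow> p \<noteq> q \<Longrightarrow> p \<bullet> q \<noteq> - 1 / 3 \<Longrightarrow> minimum < measure lborel (body N)"
proof -
  let ?L = "(disc_integral - 3 * halfplane (sqrt 2)) / 4"
  have fin: "finite N" and card: "card N = 4" using N config_finite[OF N] by (auto simp: config_def)
  have m: "minimum = ratio * measure lborel reference + (\<Sum>p\<in>N. ?L)"
    using card by (simp add: minimum_def)
  have le: "?L \<le> cell_excess N p" if "p \<in> N" for p using cell_excess_ge(1)[OF N that] by simp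
  show "minimum \<le> measure lborel (body N)"
    unfolding m measure_body_cells[OF N] by (intro add_left_mono sum_mono le)
  assume "p \<in> N" "q \<in> N" "p \<noteq> q" "p \<bullet> q \<noteq> - 1 / 3"
  from cell_excess_ge(2)[OF N this] have "?L < cell_excess N p" by simp
  then show "minimum < measure lborel (body N)"
    unfolding m measure_body_cells[OF N] using le fin \<open>p \<in> N\<close>
    by (intro add_strict_left_mono sum_strict_mono_ex1) auto
qed


section \<open>Regular configurations attain the bound\<close>

definition regular_config :: "(real^4) set \<Rightarrow> bool" where
  "regular_config N \<longleftrightarrow> config N \<and> (\<forall>p\<in>N. \<forall>q\<in>N. p \<noteq> q \<longrightarrow> p \<bullet> q = - 1 / 3)"

lemma regular_config_sum:
  assumes "regular_config N" shows "(\<Sum>p\<in>N. p) = 0"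
proof -
  have N: "config N" and r: "\<And>p q. p \<in> N \<Longrightarrow> q \<in> N \<Longrightarrow> p \<noteq> q \<Longrightarrow> p \<bullet> q = - 1 / 3"
    using assms by (auto simp: regular_config_def)
  have fin: "finite N" by (rule config_finite[OF N])
  have "(\<Sum>q\<in>N. q \<bullet> p) = 0" if p: "p \<in> N" for p
  proof -
    have "(\<Sum>q\<in>N. q \<bullet> p) = p \<bullet> p + (\<Sum>q\<in>N - {p}. q \<bullet> p)" using fin p by (rule sum.remove)
    also have "(\<Sum>q\<in>N - {p}. q \<bullet> p) = (\<Sum>q\<in>N - {p}. - 1 / 3)" using p r by (intro sum.cong) auto
    finally show ?thesis using N p fin by (simp add: config_def)
  qed
  then have "(\<Sum>p\<in>N. p) \<bullet> (\<Sum>q\<in>N. q) = 0" unfolding inner_sum_left inner_sum_right by (intro sum.neutral) simp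
  then show ?thesis by simp
qed

lemma regular_config_enum:
  assumes R: "regular_config N" and "p \<in> N" "q \<in> N" "p \<noteq> q"
  obtains r s where "N = {p, q, r, s}" "distinct [p, q, r, s]"
proof -
  have N: "config N" using R by (simp add: regular_config_def)
  have "card (N - {p, q}) = 2" using N assms config_finite[OF N] by (simp add: card_Diff_subset config_def)
  then obtain r s where "N - {p, q} = {r, s}" "r \<noteq> s" by (auto simp: card_2_iff)
  then show ?thesis using assms by (intro that[of r s]) auto
qed

text \<open>The vertices of a regular tetrahedron form a tight frame of the hyperplane orthogonal to
  \<open>c\<close>; the constant is the number of vectors over the dimension.\<close>

lemma regular_config_frame:
  assumes R: "regular_config N"
  shows "(\<Sum>p\<in>N. (x \<bullet> p)\<^sup>2) = 4 / 3 * ((norm x)\<^sup>2 - (x \<bullet> c)\<^sup>2)"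
proof -
  have N: "config N" using R by (simp add: regular_config_def)
  obtain p q where pq: "p \<in> N" "q \<in> N" "p \<noteq> q"
  proof -
    have "\<not> (\<exists>p. N \<subseteq> {p})" using N card_mono[of "{p}" N for p] by (force simp: config_def)
    then show ?thesis using that by blast
  qed
  obtain r s where E: "N = {p, q, r, s}" "distinct [p, q, r, s]" by (rule regular_config_enum[OF R pq])
  have u: "p \<bullet> p = 1" "q \<bullet> q = 1" "r \<bullet> r = 1" "s \<bullet> s = 1" "c \<bullet> p = 0" "c \<bullet> q = 0" "c \<bullet> r = 0" "c \<bullet> s = 0"
    using N E by (auto simp: config_def inner_commute[of c])
  have g: "p \<bullet> q = - 1 / 3" "p \<bullet> r = - 1 / 3" "p \<bullet> s = - 1 / 3" "q \<bullet> r = - 1 / 3" "q \<bullet> s = - 1 / 3" "r \<bullet> s = - 1 / 3"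
    "q \<bullet> p = - 1 / 3" "r \<bullet> p = - 1 / 3" "s \<bullet> p = - 1 / 3" "r \<bullet> q = - 1 / 3" "s \<bullet> q = - 1 / 3" "s \<bullet> r = - 1 / 3"
    using R E by (auto simp: regular_config_def)
  \<comment> \<open>Gram-Schmidt: 3 q + p is orthogonal to p and has squared length 8; r - s is
    orthogonal to both p and q and has squared length 8/3.\<close>
  define d where "d = (1 / sqrt 8) *\<^sub>R (3 *\<^sub>R q + p)"
  define e where "e = (sqrt (3 / 8)) *\<^sub>R (r - s)"
  have sq: "sqrt (3/8) * sqrt (3/8) = 3 / 8" "(1 / sqrt 8) * (1 / sqrt 8) = (1 / 8 :: real)"
    by (simp_all add: real_sqrt_mult_self)
  have "d \<bullet> d = (1 / sqrt 8) * (1 / sqrt 8) * ((3 *\<^sub>R q + p) \<bullet> (3 *\<^sub>R q + p))" unfolding d_def inner_scaleR_left inner_scaleR_right by (rule mult.assoc[symmetric])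
  then have dd: "d \<bullet> d = 1" unfolding sq by (simp add: inner_add_left inner_add_right u g)
  have "e \<bullet> e = sqrt (3/8) * sqrt (3/8) * ((r - s) \<bullet> (r - s))" unfolding e_def inner_scaleR_left inner_scaleR_right by (rule mult.assoc[symmetric])
  then have ee: "e \<bullet> e = 1" unfolding sq by (simp add: inner_diff_left inner_diff_right u g)
  have o: "orthonormal4 c p d e"
    unfolding orthonormal4_def using dd ee c_unit u
    by (simp add: d_def e_def inner_add_left inner_add_right inner_diff_left inner_diff_right g)
  have "(\<Sum>p\<in>N. p) = 0" by (rule regular_config_sum[OF R])
  then have "x \<bullet> (p + q + r + s) = 0" using E by (simp add: add.assoc)
  then have s: "x \<bullet> s = - (x \<bullet> p) - (x \<bullet> q) - (x \<bullet> r)" by (simp add: inner_add_right)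
  have "(x \<bullet> d)\<^sup>2 = (1 / sqrt 8) * (1 / sqrt 8) * (3 * (x \<bullet> q) + x \<bullet> p)\<^sup>2"
    by (simp add: d_def inner_add_right power2_eq_square)
  then have xd: "(x \<bullet> d)\<^sup>2 = (3 * (x \<bullet> q) + x \<bullet> p)\<^sup>2 / 8" unfolding sq by simp
  have "(x \<bullet> e)\<^sup>2 = sqrt (3/8) * sqrt (3/8) * (x \<bullet> r - x \<bullet> s)\<^sup>2"
    by (simp only: e_def inner_scaleR_right inner_diff_right power_mult_distrib power2_eq_square[of "sqrt (3/8)"])
  then have xe: "(x \<bullet> e)\<^sup>2 = 3 * (x \<bullet> r - x \<bullet> s)\<^sup>2 / 8" unfolding sq by simp
  have "(norm x)\<^sup>2 - (x \<bullet> c)\<^sup>2 = (x \<bullet> p)\<^sup>2 + (3 * (x \<bullet> q) + x \<bullet> p)\<^sup>2 / 8 + 3 * (x \<bullet> r - x \<bullet> s)\<^sup>2 / 8"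
    using orthonormal4_norm[OF o, of x] xd xe by simp
  moreover have "(\<Sum>p\<in>N. (x \<bullet> p)\<^sup>2) = (x \<bullet> p)\<^sup>2 + (x \<bullet> q)\<^sup>2 + (x \<bullet> r)\<^sup>2 + (x \<bullet> s)\<^sup>2"
    using E by (simp add: add.assoc)
  ultimately show ?thesis unfolding s by (simp add: power2_eq_square field_simps)
qed

text \<open>The four products t = x \<bullet> q sum to zero and have maximum m = x \<bullet> p, so
  each lies between -3m and m. Summing (t + 3m)(t - m) \<le> 0 bounds the sum of squares by 12 m^2,
  and the frame identity turns 12 into 9. Cells of a regular configuration thus stay over the closed
  disc.\<close>

lemma regular_config_max:
  assumes R: "regular_config N" and p: "p \<in> N" and max: "\<And>q. q \<in> N \<Longrightarrow> x \<bullet> q \<le> x \<bullet> p"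
  shows "0 \<le> x \<bullet> p" "(norm x)\<^sup>2 - (x \<bullet> c)\<^sup>2 \<le> 9 * (x \<bullet> p)\<^sup>2"
proof -
  have N: "config N" using R by (simp add: regular_config_def)
  have fin: "finite N" and card: "card N = 4" using N config_finite[OF N] by (auto simp: config_def)
  let ?m = "x \<bullet> p"
  have sum0: "(\<Sum>q\<in>N. x \<bullet> q) = 0" using regular_config_sum[OF R] by (simp flip: inner_sum_right)
  have "(\<Sum>q\<in>N. x \<bullet> q) \<le> (\<Sum>q\<in>N. ?m)" by (rule sum_mono) (rule max)
  then show m0: "0 \<le> ?m" using sum0 card by simp
  have "(x \<bullet> q + 3 * ?m) * (x \<bullet> q - ?m) \<le> 0" if q: "q \<in> N" for q
  proof -
    have "(\<Sum>r\<in>N. x \<bullet> r) = x \<bullet> q + (\<Sum>r\<in>N - {q}. x \<bullet> r)" using fin q by (rule sum.remove)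
    also have "(\<Sum>r\<in>N - {q}. x \<bullet> r) \<le> (\<Sum>r\<in>N - {q}. ?m)" using max by (intro sum_mono) auto
    finally have "0 \<le> x \<bullet> q + 3 * ?m" using sum0 card fin q by simp
    then show ?thesis using max[OF q] by (intro mult_nonneg_nonpos) auto
  qed
  then have "(\<Sum>q\<in>N. (x \<bullet> q + 3 * ?m) * (x \<bullet> q - ?m)) \<le> 0" by (rule sum_nonpos)
  also have "(\<Sum>q\<in>N. (x \<bullet> q + 3 * ?m) * (x \<bullet> q - ?m)) =
      (\<Sum>q\<in>N. (x \<bullet> q)\<^sup>2 + 2 * ?m * (x \<bullet> q) - 3 * ?m\<^sup>2)"
    by (intro sum.cong) (auto simp: power2_eq_square algebra_simps)
  also have "\<dots> = (\<Sum>q\<in>N. (x \<bullet> q)\<^sup>2) + 2 * ?m * (\<Sum>q\<in>N. x \<bullet> q) - 4 * (3 * ?m\<^sup>2)"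
    using card by (simp add: sum.distrib sum_subtractf sum_distrib_left)
  finally show "(norm x)\<^sup>2 - (x \<bullet> c)\<^sup>2 \<le> 9 * ?m\<^sup>2"
    unfolding sum0 regular_config_frame[OF R] by simp
qed

text \<open>The vector y = p + v has product 1 with p and at least 1 with q and r; as the four
  products sum to zero, the one with s is at most -3. Over the disc \<bar>y\<bar> \<le> 3, so y = -3
  s: two wedges meet there at most in a cell vertex.\<close>

lemma regular_wedges_overlap:
  assumes R: "regular_config N" and o: "orthonormal4 c p d e"
    and p: "p \<in> N" and q: "q \<in> N" "q \<noteq> p" and r: "r \<in> N" "r \<noteq> p" "q \<noteq> r"
    and v: "v \<in> wedge p d e q" "v \<in> wedge p d e r" "v \<in> disc"
  shows "\<exists>s\<in>N. v = (- 3 * (s \<bullet> d), - 3 * (s \<bullet> e))"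
proof -
  have N: "config N" using R by (simp add: regular_config_def)
  obtain r' s where E: "N = {p, q, r', s}" "distinct [p, q, r', s]" by (rule regular_config_enum[OF R p q(1) q(2)[symmetric]])
  then obtain s where E: "N = {p, q, r, s}" "distinct [p, q, r, s]"
    using r by (cases "r = r'") (auto intro: that[of s] that[of r'])
  note oo = o[unfolded orthonormal4_def]
  have oo': "p \<bullet> c = 0" "d \<bullet> c = 0" "e \<bullet> c = 0" "d \<bullet> p = 0" "e \<bullet> p = 0" "e \<bullet> d = 0"
    using oo by (simp_all add: inner_commute)
  define y where "y = p + fst v *\<^sub>R d + snd v *\<^sub>R e"
  have yc: "y \<bullet> c = 0" "y \<bullet> p = 1" "y \<bullet> d = fst v" "y \<bullet> e = snd v"
    using oo oo' by (simp_all add: y_def inner_add_left)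
  have yq: "1 \<le> y \<bullet> t" if "v \<in> wedge p d e t" "t \<in> N" for t
  proof -
    have "y \<bullet> t = p \<bullet> t + (t \<bullet> d, t \<bullet> e) \<bullet> v"
      by (simp add: y_def inner_add_left inner_prod_def inner_commute[of d t] inner_commute[of e t] mult.commute)
    then show ?thesis using that by (simp add: wedge_def)
  qed
  have "(\<Sum>t\<in>N. y \<bullet> t) = 0" using regular_config_sum[OF R] by (simp flip: inner_sum_right)
  then have "y \<bullet> p + y \<bullet> q + y \<bullet> r + y \<bullet> s = 0" using E by (simp add: add.assoc)
  then have ys: "y \<bullet> s \<le> - 3" using yc yq[OF v(1) q(1)] yq[OF v(2) r(1)] by simp
  have "(norm y)\<^sup>2 = 1 + (norm v)\<^sup>2"
    unfolding orthonormal4_norm[OF o, of y] yc by (simp add: norm_prod_def)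
  then have "(norm y)\<^sup>2 \<le> 9" using v(3) by (simp add: disc_def)
  moreover have "s \<bullet> s = 1" using N E by (simp add: config_def)
  ultimately have "(y + 3 *\<^sub>R s) \<bullet> (y + 3 *\<^sub>R s) \<le> 0"
    using ys by (simp add: inner_add_left inner_add_right power2_norm_eq_inner inner_commute[of s y])
  then have "y + 3 *\<^sub>R s = 0" by (metis inner_ge_zero inner_eq_zero_iff order.antisym)
  then have "y = - 3 *\<^sub>R s" by (simp add: eq_neg_iff_add_eq_0)
  then have "v = (- 3 * (s \<bullet> d), - 3 * (s \<bullet> e))" using yc by (simp add: prod_eq_iff)
  then show ?thesis using E by auto
qed

text \<open>Each estimate behind the lower bound becomes an equality: the cells lie over the disc,
  the wedges overlap there in finitely many points only, and they have squared distance at least 2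
  from the centre, beyond the cutoff, so truncation changes nothing.\<close>

theorem measure_body_regular:
  assumes R: "regular_config N" shows "measure lborel (body N) = minimum"
proof -
  have N: "config N" using R by (simp add: regular_config_def)
  have "4 * cell_excess N p = disc_integral - 3 * halfplane (sqrt 2)" if p: "p \<in> N" for p
  proof -
    have "c \<bullet> p = 0" "p \<bullet> p = 1" using N p by (simp_all add: config_def inner_commute[of c p])
    then obtain d e where o: "orthonormal4 c p d e" using orthonormal_extend[OF c_unit] by blast
    let ?H = "wedge p d e"
    let ?I = "\<lambda>q. \<integral>v. indicator (?H q) v * \<kappa>p v \<partial>lborel"
    let ?J = "N - {p}"
    let ?U = "\<Union>q\<in>?J. ?H q"
    have fin: "finite ?J" and card: "card ?J = 3"
      using config_finite[OF N] N p by (auto simp: config_def)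
    have J: "?J \<noteq> {}" using card by force
    have U: "?U \<in> sets borel" by (rule UN_wedge_borel[OF fin])
    have sub: "half \<inter> cell N p \<subseteq> cone_disc p d e"
    proof
      fix x assume x: "x \<in> half \<inter> cell N p"
      then have "x \<bullet> q \<le> x \<bullet> p" if "q \<in> N" for q using that by (cases "q = p") (auto simp: cell_def less_imp_le)
      note m = regular_config_max[OF R p this]
      have "x \<bullet> p \<noteq> 0"
      proof
        assume "x \<bullet> p = 0"
        then have "(\<Sum>q\<in>?J. x \<bullet> q) < (\<Sum>q\<in>?J. 0)"
          using x fin J by (intro sum_strict_mono) (auto simp: cell_def)
        moreover have "(\<Sum>q\<in>N. x \<bullet> q) = 0" using regular_config_sum[OF R] by (simp flip: inner_sum_right)
        ultimately show False using \<open>x \<bullet> p = 0\<close> sum.remove[OF config_finite[OF N] p, of "\<lambda>q. x \<bullet> q"] by simp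
      qed
      then show "x \<in> cone_disc p d e" using m cone_disc_iff[OF o, of x] by simp
    qed
    have "(\<integral>v. indicator (disc \<inter> ?U) v * \<kappa> ((norm v)\<^sup>2) \<partial>lborel) =
        (\<integral>v. (\<Sum>q\<in>?J. indicator (?H q) v * \<kappa>p v) \<partial>lborel)"
    proof (rule integral_cong_AE)
      show "(\<lambda>v. indicator (disc \<inter> ?U) v * \<kappa> ((norm v)\<^sup>2)) \<in> borel_measurable lborel"
        using integrable_on_disc[OF continuous_on_\<kappa>, of "disc \<inter> ?U"] U disc_borel
        by (auto intro!: borel_measurable_integrable)
      show "(\<lambda>v. \<Sum>q\<in>?J. indicator (?H q) v * \<kappa>p v) \<in> borel_measurable lborel"
        using wedge_borel by (intro borel_measurable_integrable Bochner_Integration.integrable_sum integrable_\<kappa>p)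
      have "AE v in lborel. v \<notin> (\<lambda>s. (- 3 * (s \<bullet> d), - 3 * (s \<bullet> e))) ` N"
        using config_finite[OF N] by (intro AE_not_in finite_imp_null_set_lborel) auto
      then show "AE v in lborel. indicator (disc \<inter> ?U) v * \<kappa> ((norm v)\<^sup>2) = (\<Sum>q\<in>?J. indicator (?H q) v * \<kappa>p v)"
      proof eventually_elim
        case (elim v)
        show ?case
        proof (cases "v \<in> disc \<inter> ?U")
          case False
          have "indicator (?H q) v * \<kappa>p v = 0" if "q \<in> ?J" for q
            using False that \<kappa>c_support[of "(norm v)\<^sup>2"] by (auto simp: indicator_def disc_def)
          then show ?thesis using False by (simp add: sum.neutral)
        next
          case True
          then obtain q where q: "q \<in> ?J" "v \<in> ?H q" by auto
          have "indicator (?H r) v * \<kappa>p v = 0" if "r \<in> ?J - {q}" for r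
            using regular_wedges_overlap[OF R o p, of q r v] that q True elim by (auto simp: indicator_def)
          then have "(\<Sum>r\<in>?J. indicator (?H r) v * \<kappa>p v) = indicator (?H q) v * \<kappa>p v"
            using sum.remove[OF fin q(1), of "\<lambda>r. indicator (?H r) v * \<kappa>p v"] by (simp add: sum.neutral)
          moreover have "2 \<le> (norm v)\<^sup>2"
          proof -
            let ?\<delta> = "(q \<bullet> d, q \<bullet> e)"
            have g: "p \<bullet> q = - 1 / 3" and u: "q \<bullet> q = 1" "q \<bullet> c = 0"
              using R N p q by (auto simp: regular_config_def config_def)
            have "1 = 1 / 9 + (norm ?\<delta>)\<^sup>2"
              using orthonormal4_inner[OF o, of q q] u g
              by (simp add: norm_Pair power2_eq_square inner_commute[of q p])
            then have n: "(norm ?\<delta>)\<^sup>2 = 8 / 9" by simp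
            have "4 / 3 \<le> ?\<delta> \<bullet> v" using q(2) g by (simp add: wedge_def)
            also have "\<dots> \<le> norm ?\<delta> * norm v" by (rule norm_cauchy_schwarz)
            finally have "(4 / 3)\<^sup>2 \<le> (norm ?\<delta> * norm v)\<^sup>2" by (intro power_mono) auto
            then show ?thesis unfolding power_mult_distrib n by (simp add: power2_eq_square)
          qed
          ultimately show ?thesis using True q \<sigma>_bounds by (simp add: \<kappa>c_def disc_def)
        qed
      qed
    qed
    also have "\<dots> = (\<Sum>q\<in>?J. ?I q)"
      using wedge_borel by (intro Bochner_Integration.integral_sum integrable_\<kappa>p)
    also have "\<dots> = (\<Sum>q\<in>?J. halfplane (sqrt 2))"
      using R p wedge_integral_le(3)[OF o N p] by (intro sum.cong) (auto simp: regular_config_def)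
    finally have "(\<integral>v. indicator (disc \<inter> ?U) v * \<kappa> ((norm v)\<^sup>2) \<partial>lborel) = 3 * halfplane (sqrt 2)"
      using card by simp
    then show ?thesis using cell_excess_chart(2)[OF o N p sub] disc_diff_integral[OF U] by simp
  qed
  then have "(\<Sum>p\<in>N. cell_excess N p) = (\<Sum>p\<in>N. (disc_integral - 3 * halfplane (sqrt 2)) / 4)"
    by (intro sum.cong) (auto simp: field_simps)
  then show ?thesis using N unfolding measure_body_cells[OF N] by (simp add: minimum_def config_def)
qed

end

section \<open>Normals of a spherical tetrahedron\<close>

text \<open>Inward unit normals of the faces, that is, the dual basis up to positive factors. They
  turn the hull into an intersection of half spaces.\<close>

definition normals :: "(nat \<Rightarrow> real^4) \<Rightarrow> (nat \<Rightarrow> real^4) \<Rightarrow> bool" where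
  "normals v n \<longleftrightarrow> (\<forall>i<4. n i \<bullet> n i = 1 \<and> 0 < n i \<bullet> v i \<and> (\<forall>j<4. i \<noteq> j \<longrightarrow> n i \<bullet> v j = 0))"

lemma tet_vertices_combination:
  assumes "tet_vertices v"
  obtains a where "x = (\<Sum>i<4. a i *\<^sub>R v i)"
proof -
  have inj: "inj_on v {..<4}" and ind: "independent (v ` {..<4})" using assms by (auto simp: tet_vertices_def)
  have "dim (v ` {..<4}) = card (v ` {..<4})" using ind by (rule dim_eq_card_independent)
  also have "\<dots> = DIM(real^4)" using inj by (simp add: card_image)
  finally have "span (v ` {..<4}) = UNIV" using dim_eq_full by blast
  then have "x \<in> span (v ` {..<4})" by simp
  then obtain u where "x = (\<Sum>y\<in>v ` {..<4}. u y *\<^sub>R y)" by (auto simp: span_finite)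
  then have "x = (\<Sum>i<4. u (v i) *\<^sub>R v i)" using inj by (simp add: sum.reindex)
  then show ?thesis by (rule that[of "\<lambda>i. u (v i)"])
qed

lemma tet_vertices_separate:
  assumes "tet_vertices v" "\<And>i. i < 4 \<Longrightarrow> x \<bullet> v i = 0" shows "x = 0"
proof -
  obtain a where "x = (\<Sum>i<4. a i *\<^sub>R v i)" by (rule tet_vertices_combination[OF assms(1)])
  then have "x \<bullet> x = x \<bullet> (\<Sum>i<4. a i *\<^sub>R v i)" by simp
  also have "\<dots> = 0" using assms(2) by (simp add: inner_sum_right)
  finally show ?thesis by simp
qed

lemma normals_exist:
  assumes v: "tet_vertices v" obtains n where "normals v n"
proof -
  have "\<exists>z. z \<bullet> z = 1 \<and> 0 < z \<bullet> v i \<and> (\<forall>j<4. i \<noteq> j \<longrightarrow> z \<bullet> v j = 0)" if i: "i < 4" for i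
  proof -
    have "card (v ` ({..<4} - {i})) \<le> card ({..<4} - {i})" by (rule card_image_le) simp
    also have "\<dots> < 4" using i by simp
    finally obtain z where z: "z \<bullet> z = 1" "\<forall>y\<in>v ` ({..<4} - {i}). y \<bullet> z = 0"
      using unit_orthogonal_exists[of "v ` ({..<4} - {i})"] by auto
    have o: "z \<bullet> v j = 0" if "j < 4" "i \<noteq> j" for j using z(2) that by (auto simp: inner_commute)
    have "z \<bullet> v i \<noteq> 0"
    proof
      assume "z \<bullet> v i = 0"
      then have "z = 0" using o by (intro tet_vertices_separate[OF v]) metis
      then show False using z(1) by simp
    qed
    then consider "0 < z \<bullet> v i" | "0 < (- z) \<bullet> v i" by fastforce
    then show ?thesis
    proof cases
      case 1
      then show ?thesis using z(1) o by blast
    next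
      case 2
      then show ?thesis using z(1) o by (intro exI[of _ "- z"]) simp
    qed
  qed
  then obtain n where "\<forall>i<4. n i \<bullet> n i = 1 \<and> 0 < n i \<bullet> v i \<and> (\<forall>j<4. i \<noteq> j \<longrightarrow> n i \<bullet> v j = 0)"
    by metis
  then show ?thesis by (intro that[of n]) (simp add: normals_def)
qed

lemma normals_expansion:
  assumes v: "tet_vertices v" and n: "normals v n"
  shows "x = (\<Sum>i<4. ((x \<bullet> n i) / (n i \<bullet> v i)) *\<^sub>R v i)"
proof -
  obtain a where a: "x = (\<Sum>i<4. a i *\<^sub>R v i)" by (rule tet_vertices_combination[OF v])
  have "a j = (x \<bullet> n j) / (n j \<bullet> v j)" if j: "j < 4" for j
  proof -
    have "x \<bullet> n j = (\<Sum>i<4. a i *\<^sub>R v i) \<bullet> n j" using a by simp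
    also have "\<dots> = (\<Sum>i<4. a i * (n j \<bullet> v i))" by (simp add: inner_sum_left inner_commute[of "n j"])
    also have "\<dots> = (\<Sum>i<4. if i = j then a i * (n j \<bullet> v j) else 0)"
      using n j by (intro sum.cong) (auto simp: normals_def)
    also have "\<dots> = a j * (n j \<bullet> v j)" using j by simp
    finally show ?thesis using n j by (auto simp: normals_def)
  qed
  then show ?thesis by (intro trans[OF a] sum.cong) auto
qed

lemma normals_separate:
  assumes "tet_vertices v" "normals v n" "\<And>i. i < 4 \<Longrightarrow> x \<bullet> n i = 0" shows "x = 0"
  by (subst normals_expansion[OF assms(1,2)]) (simp add: assms(3))

lemma sph_hull_nonneg:
  assumes "\<And>y. y \<in> S \<Longrightarrow> 0 \<le> y \<bullet> n" and "x \<in> sph_hull S"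
  shows "0 \<le> x \<bullet> n"
proof -
  have "convex hull S \<subseteq> {y. 0 \<le> n \<bullet> y}"
    using assms(1) by (intro hull_minimal convex_halfspace_ge) (auto simp: inner_commute)
  then show ?thesis using assms(2) by (force simp: sph_hull_def inner_commute)
qed

lemma sph_hull_normals:
  assumes v: "tet_vertices v" and n: "normals v n"
  shows "sph_hull (v ` {..<4}) = {x. norm x = 1 \<and> (\<forall>i<4. 0 \<le> x \<bullet> n i)}"
proof (intro equalityI subsetI)
  fix x assume x: "x \<in> sph_hull (v ` {..<4})"
  have "0 \<le> v j \<bullet> n i" if "i < 4" "j < 4" for i j
    using n that by (cases "i = j") (auto simp: normals_def inner_commute[of "v j"])
  then have "0 \<le> x \<bullet> n i" if "i < 4" for i using that by (intro sph_hull_nonneg[OF _ x]) auto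
  then show "x \<in> {x. norm x = 1 \<and> (\<forall>i<4. 0 \<le> x \<bullet> n i)}" using x by (simp add: sph_hull_def)
next
  fix x assume x: "x \<in> {x. norm x = 1 \<and> (\<forall>i<4. 0 \<le> x \<bullet> n i)}"
  define a where "a = (\<lambda>i. (x \<bullet> n i) / (n i \<bullet> v i))"
  have a: "x = (\<Sum>i<4. a i *\<^sub>R v i)" unfolding a_def by (rule normals_expansion[OF v n])
  have a0: "0 \<le> a i" if "i < 4" for i
    using x n that by (auto simp: a_def normals_def intro!: divide_nonneg_pos)
  define s where "s = (\<Sum>i<4. a i)"
  have "0 < s"
  proof (rule ccontr)
    assume "\<not> 0 < s"
    moreover have "0 \<le> s" unfolding s_def using a0 by (intro sum_nonneg) auto
    ultimately have "s = 0" by simp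
    then have "\<forall>i\<in>{..<4}. a i = 0" unfolding s_def using a0 by (subst (asm) sum_nonneg_eq_0_iff) auto
    then have "x = 0" by (subst a) simp
    then show False using x by simp
  qed
  have "(\<Sum>i<4. (a i / s) *\<^sub>R v i) \<in> convex hull (v ` {..<4})"
  proof (rule convex_sum)
    show "(\<Sum>i<4. a i / s) = 1" using \<open>0 < s\<close> by (simp add: s_def flip: sum_divide_distrib)
  qed (use a0 \<open>0 < s\<close> in \<open>auto intro: hull_inc\<close>)
  moreover have "x = s *\<^sub>R (\<Sum>i<4. (a i / s) *\<^sub>R v i)"
    using \<open>0 < s\<close> by (subst a) (simp add: scaleR_sum_right)
  ultimately show "x \<in> sph_hull (v ` {..<4})" using x \<open>0 < s\<close> unfolding sph_hull_def
    by (auto intro: less_imp_le)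
qed

definition simplex_cone :: "(nat \<Rightarrow> real^4) \<Rightarrow> (real^4) set" where
  "simplex_cone n = {x. norm x \<le> 1 \<and> (\<forall>i<4. 0 \<le> x \<bullet> n i)}"

lemma cone_over_tet:
  assumes v: "tet_vertices v" and n: "normals v n"
  shows "{t *\<^sub>R x | t x. 0 \<le> t \<and> t \<le> 1 \<and> x \<in> sph_hull (v ` {..<4})} = simplex_cone n"
proof (intro equalityI subsetI)
  fix y assume "y \<in> {t *\<^sub>R x | t x. 0 \<le> t \<and> t \<le> 1 \<and> x \<in> sph_hull (v ` {..<4})}"
  then show "y \<in> simplex_cone n" by (auto simp: sph_hull_normals[OF v n] simplex_cone_def)
next
  fix y assume y: "y \<in> simplex_cone n"
  show "y \<in> {t *\<^sub>R x | t x. 0 \<le> t \<and> t \<le> 1 \<and> x \<in> sph_hull (v ` {..<4})}"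
  proof (cases "y = 0")
    case True
    have "v 0 \<in> sph_hull (v ` {..<4})"
      using v n unfolding sph_hull_normals[OF v n] by (auto simp: tet_vertices_def normals_def inner_commute[of "v 0"])
        (metis less_eq_real_def zero_less_numeral)
    then have "0 *\<^sub>R v 0 = y \<and> 0 \<le> (0::real) \<and> (0::real) \<le> 1 \<and> v 0 \<in> sph_hull (v ` {..<4})" using True by simp
    then show ?thesis by blast
  next
    case False
    have "y = norm y *\<^sub>R (y /\<^sub>R norm y)" using False by simp
    moreover have "y /\<^sub>R norm y \<in> sph_hull (v ` {..<4})"
      using y False by (simp add: sph_hull_normals[OF v n] simplex_cone_def)
    moreover have "norm y \<le> 1" using y by (simp add: simplex_cone_def)
    ultimately show ?thesis by (metis (mono_tags, lifting) mem_Collect_eq norm_ge_zero)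
  qed
qed

lemma simplex_cone_closed: "closed (simplex_cone n)"
proof -
  have "simplex_cone n = cball 0 1 \<inter> (\<Inter>i\<in>{..<4}. {x. 0 \<le> x \<bullet> n i})" by (auto simp: simplex_cone_def)
  moreover have "closed (\<Inter>i\<in>{..<4}. {x. 0 \<le> x \<bullet> n i})"
    by (intro closed_INT ballI closed_Collect_le continuous_intros)
  ultimately show ?thesis by (metis closed_Int closed_cball)
qed

lemma simplex_cone_lmeasurable: "simplex_cone n \<in> lmeasurable"
proof -
  have "bounded (simplex_cone n)" by (rule boundedI[of _ 1]) (simp add: simplex_cone_def)
  then show ?thesis using simplex_cone_closed by (intro lmeasurable_compact) (simp add: compact_eq_bounded_closed)
qed

lemma sph_vol_tet:
  assumes v: "tet_vertices v" and n: "normals v n"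
  shows "sph_vol (sph_hull (v ` {..<4})) = 4 * measure lborel (simplex_cone n)"
  unfolding sph_vol_def cone_over_tet[OF v n] using simplex_cone_closed by simp

lemma sph_vol_congruent:
  assumes "tet_vertices v" "sph_congruent (sph_hull (v ` {..<4})) S"
  shows "sph_vol S = sph_vol (sph_hull (v ` {..<4}))"
proof -
  obtain n where n: "normals v n" by (rule normals_exist[OF assms(1)])
  obtain f where f: "orthogonal_transformation f" "f ` sph_hull (v ` {..<4}) = S"
    using assms(2) by (auto simp: sph_congruent_def)
  let ?C = "{t *\<^sub>R x | t x. 0 \<le> t \<and> t \<le> 1 \<and> x \<in> sph_hull (v ` {..<4})}"
  have lin: "f (t *\<^sub>R x) = t *\<^sub>R f x" for t x
    using orthogonal_transformation_linear[OF f(1)] by (rule linear_scale)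
  have "{t *\<^sub>R x | t x. 0 \<le> t \<and> t \<le> 1 \<and> x \<in> S} = f ` ?C"
    unfolding f(2)[symmetric] by (auto simp: image_iff lin) (metis lin)+
  moreover have "?C \<in> lmeasurable" using cone_over_tet[OF assms(1) n] simplex_cone_lmeasurable by simp
  ultimately show ?thesis unfolding sph_vol_def using measure_orthogonal_image[OF f(1)] by simp
qed

text \<open>The bound on \<open>n i \<bullet> c\<close> comes from testing the point of the ball
  that lies lowest with respect to \<open>n i\<close>. It says that the sphere through face i keeps
  at least the distance r from \<open>c\<close>.\<close>

lemma ball_in_tet:
  assumes v: "tet_vertices v" and n: "normals v n" and c: "c \<bullet> c = 1" and r: "0 < r" "r < pi"
    and sub: "sph_ball c r \<subseteq> sph_hull (v ` {..<4})"
  shows "r < pi / 2" "\<And>i. i < 4 \<Longrightarrow> sin r \<le> n i \<bullet> c"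
proof -
  have in_ball: "0 \<le> x \<bullet> n i" if "x \<bullet> x = 1" "cos r \<le> c \<bullet> x" "i < 4" for x i
  proof -
    have "c \<bullet> x \<le> norm c * norm x" by (rule norm_cauchy_schwarz)
    also have "\<dots> = 1" using c that by (simp add: norm_eq_sqrt_inner)
    finally have "arccos (c \<bullet> x) \<le> arccos (cos r)"
      using that by (intro arccos_le_arccos) auto
    also have "\<dots> = r" using r by (simp add: arccos_cos)
    finally have "x \<in> sph_ball c r" using that by (simp add: sph_ball_def sph_dist_def norm_eq_sqrt_inner)
    then show ?thesis using sub that sph_hull_normals[OF v n] by auto
  qed
  show r2: "r < pi / 2"
  proof (rule ccontr)
    assume "\<not> r < pi / 2"
    then have "cos r \<le> cos (pi / 2)" using r by (intro cos_monotone_0_pi_le) auto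
    then have cr: "cos r \<le> 0" by simp
    \<comment> \<open>A ball of radius at least pi / 2 would contain both \<open>e\<close> and
      \<open>- e\<close>, so all normals would be orthogonal to \<open>e\<close>.\<close>
    obtain e where e: "e \<bullet> e = 1" "c \<bullet> e = 0" using unit_orthogonal_exists[of "{c}"] by auto
    have "e \<bullet> n i = 0" if "i < 4" for i
      using in_ball[of e i] in_ball[of "- e" i] e cr that by simp
    then have "e = 0" by (rule normals_separate[OF v n])
    then show False using e by simp
  qed
  show "sin r \<le> n i \<bullet> c" if i: "i < 4" for i
  proof -
    have cr: "0 < cos r" using r r2 by (intro cos_gt_zero) auto
    have sr: "0 < sin r" using r by (intro sin_gt_zero) auto
    have ni: "n i \<bullet> n i = 1" using n i by (simp add: normals_def)
    define s where "s = n i \<bullet> c"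
    have s0: "0 \<le> s" using in_ball[of c i] c i by (simp add: s_def inner_commute)
    have cs: "n i \<bullet> c = s" "c \<bullet> n i = s" by (simp_all add: s_def inner_commute[of c "n i"])
    define w where "w = n i - s *\<^sub>R c"
    have wc: "w \<bullet> c = 0" "c \<bullet> w = 0" using c cs by (simp_all add: w_def inner_diff_left inner_diff_right)
    have ww: "w \<bullet> w = 1 - s\<^sup>2" and wn: "w \<bullet> n i = 1 - s\<^sup>2"
      using c ni cs by (simp_all add: w_def inner_diff_left inner_diff_right power2_eq_square)
    show ?thesis
    proof (cases "w = 0")
      case True
      then have "s\<^sup>2 = 1\<^sup>2" using ww by simp
      then have "s = 1" using s0 by (auto simp: power2_eq_1_iff)
      then show ?thesis by (simp add: s_def)
    next
      case False
      \<comment> \<open>From \<open>c\<close> go the distance r against the part of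
        \<open>n i\<close> orthogonal to \<open>c\<close>.\<close>
      define x where "x = cos r *\<^sub>R c - (sin r / norm w) *\<^sub>R w"
      have nw: "norm w > 0" "(norm w)\<^sup>2 = w \<bullet> w" using False by (simp_all add: power2_norm_eq_inner)
      have "x \<bullet> x = (cos r)\<^sup>2 + (sin r / norm w)\<^sup>2 * (w \<bullet> w)"
        using c wc by (simp add: x_def inner_diff_left inner_diff_right power2_eq_square)
      also have "\<dots> = 1" using nw by (simp add: power_divide nw(2)[symmetric])
      finally have xx: "x \<bullet> x = 1" .
      have xc: "c \<bullet> x = cos r" using c wc by (simp add: x_def inner_diff_right)
      have "0 \<le> x \<bullet> n i" using in_ball[OF xx _ i] xc by simp
      also have "x \<bullet> n i = cos r * s - (sin r / norm w) * (norm w)\<^sup>2"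
        by (simp add: x_def inner_diff_left wn nw(2) ww cs)
      finally have "sin r * norm w \<le> cos r * s" using nw(1) by (simp add: power2_eq_square)
      then have "(sin r * norm w)\<^sup>2 \<le> (cos r * s)\<^sup>2" using sr by (intro power_mono) auto
      then have "(sin r)\<^sup>2 * (1 - s\<^sup>2) \<le> (1 - (sin r)\<^sup>2) * s\<^sup>2"
        by (simp add: power_mult_distrib nw(2) ww cos_squared_eq)
      then have "(sin r)\<^sup>2 \<le> s\<^sup>2" by (simp add: algebra_simps)
      then show ?thesis using s0 by (auto simp: s_def intro: power2_le_imp_le)
    qed
  qed
qed

text \<open>The common point x of face and ball is orthogonal to \<open>n i\<close>. Bessel's
  inequality for \<open>c\<close> and the orthonormal pair x, \<open>n i\<close> bounds (c \<bullet>
  n i)^2 by 1 - (c \<bullet> x)^2, hence by sin^2 r.\<close>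

lemma touching_face:
  assumes v: "tet_vertices v" and n: "normals v n" and c: "c \<bullet> c = 1" and r: "0 < r" "r < pi / 2"
    and i: "i < 4" and touch: "sph_hull (v ` ({..<4} - {i})) \<inter> sph_ball c r \<noteq> {}"
  shows "n i \<bullet> c \<le> sin r"
proof -
  obtain x where x: "x \<in> sph_hull (v ` ({..<4} - {i}))" "x \<in> sph_ball c r" using touch by auto
  have z: "y \<bullet> n i = 0" if "y \<in> v ` ({..<4} - {i})" for y
    using n i that by (auto simp: normals_def inner_commute[of _ "n i"])
  have "0 \<le> x \<bullet> n i" "0 \<le> x \<bullet> (- n i)"
    by (rule sph_hull_nonneg[OF _ x(1)]; simp add: z)+
  then have xn: "x \<bullet> n i = 0" by simp
  have xx: "x \<bullet> x = 1" using x by (simp add: sph_ball_def norm_eq_1)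
  have b: "\<bar>c \<bullet> x\<bar> \<le> 1" using Cauchy_Schwarz_ineq2[of c x] c xx by (simp add: norm_eq_sqrt_inner)
  have "cos r \<le> cos (arccos (c \<bullet> x))"
    using x r b by (intro cos_monotone_0_pi_le) (auto simp: sph_ball_def sph_dist_def arccos_lbound)
  then have cx: "cos r \<le> c \<bullet> x" using b by (simp add: cos_arccos abs_le_iff)
  have comm: "x \<bullet> c = c \<bullet> x" "n i \<bullet> c = c \<bullet> n i" "n i \<bullet> x = x \<bullet> n i" by (simp_all add: inner_commute)
  have nn: "n i \<bullet> n i = 1" using n i by (simp add: normals_def)
  define y where "y = c - (c \<bullet> x) *\<^sub>R x - (c \<bullet> n i) *\<^sub>R n i"
  have "0 \<le> y \<bullet> y" by simp
  also have "y \<bullet> y = 1 - (c \<bullet> x)\<^sup>2 - (c \<bullet> n i)\<^sup>2"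
    using c xx nn xn by (simp add: y_def inner_diff_left inner_diff_right power2_eq_square comm)
  finally have "(c \<bullet> n i)\<^sup>2 \<le> 1 - (c \<bullet> x)\<^sup>2" by simp
  also have "\<dots> \<le> 1 - (cos r)\<^sup>2" using cx r by (intro diff_left_mono power_mono) (auto intro: cos_ge_zero)
  also have "\<dots> = (sin r)\<^sup>2" by (simp add: sin_squared_eq)
  finally have "c \<bullet> n i \<le> sin r" by (rule power2_le_imp_le) (use r in \<open>auto intro: sin_ge_zero\<close>)
  then show ?thesis by (simp add: comm)
qed

text \<open>The face plane is moved inwards, keeping its direction as seen from \<open>c\<close>,
  until it touches the ball: u is the normalised negative of the part of N orthogonal to
  \<open>c\<close>. That part has length at most cos r, so the tangent half space implies the old
  one. If N = c, any direction serves.\<close>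

lemma horizontal_normal_exists:
  fixes c N :: "real^4"
  assumes c: "c \<bullet> c = 1" and N: "N \<bullet> N = 1" and s: "sin r \<le> N \<bullet> c" and r: "0 < r" "r < pi / 2"
  obtains u where "u \<bullet> u = 1" "u \<bullet> c = 0"
    "\<And>x. 0 < x \<bullet> c \<Longrightarrow> x \<bullet> u \<le> tan r * (x \<bullet> c) \<Longrightarrow> 0 \<le> x \<bullet> N"
proof -
  have sr: "0 < sin r" and cr: "0 < cos r" using r by (auto intro: sin_gt_zero cos_gt_zero)
  define a where "a = N \<bullet> c"
  have ac: "N \<bullet> c = a" "c \<bullet> N = a" by (simp_all add: a_def inner_commute[of c])
  define w where "w = a *\<^sub>R c - N"
  have wc: "w \<bullet> c = 0" and ww: "w \<bullet> w = 1 - a\<^sup>2"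
    using c N ac by (simp_all add: w_def inner_diff_left inner_diff_right power2_eq_square)
  have nw: "norm w \<le> cos r"
  proof (rule power2_le_imp_le)
    have "(sin r)\<^sup>2 \<le> a\<^sup>2" using s sr by (intro power_mono) (auto simp: ac)
    then show "(norm w)\<^sup>2 \<le> (cos r)\<^sup>2" by (simp add: power2_norm_eq_inner ww cos_squared_eq)
  qed (use cr in simp)
  obtain u where u: "u \<bullet> u = 1" "u \<bullet> c = 0" "w = norm w *\<^sub>R u"
  proof (cases "w = 0")
    case True
    obtain u where "u \<bullet> u = 1" "c \<bullet> u = 0" using unit_orthogonal_exists[of "{c}"] by auto
    then show ?thesis using True by (intro that[of u]) (simp_all add: inner_commute[of u c])
  next
    case False
    show ?thesis
    proof (rule that[of "w /\<^sub>R norm w"])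
      show "(w /\<^sub>R norm w) \<bullet> (w /\<^sub>R norm w) = 1"
        using False by (simp add: dot_square_norm power2_eq_square)
    qed (use False wc in simp_all)
  qed
  show ?thesis
  proof (rule that[OF u(1,2)])
    fix x assume x: "0 < x \<bullet> c" "x \<bullet> u \<le> tan r * (x \<bullet> c)"
    have "norm w * (x \<bullet> u) \<le> norm w * (tan r * (x \<bullet> c))" using x(2) by (intro mult_left_mono) auto
    also have "\<dots> \<le> cos r * (tan r * (x \<bullet> c))"
      using nw x(1) sr cr by (intro mult_right_mono) (auto simp: tan_def)
    also have "\<dots> = sin r * (x \<bullet> c)" using cr by (simp add: tan_def)
    also have "\<dots> \<le> a * (x \<bullet> c)" using s x(1) by (intro mult_right_mono) (auto simp: a_def)
    finally have "norm w * (x \<bullet> u) \<le> a * (x \<bullet> c)" .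
    moreover have "norm w * (x \<bullet> u) = x \<bullet> w" by (subst (2) u(3)) simp
    moreover have "x \<bullet> w = a * (x \<bullet> c) - x \<bullet> N" by (simp add: w_def inner_diff_right)
    ultimately show "0 \<le> x \<bullet> N" by simp
  qed
qed

lemma infinite_horizontal:
  fixes c :: "real^4"
  assumes c: "c \<bullet> c = 1" shows "infinite {u. u \<bullet> u = 1 \<and> u \<bullet> c = 0}"
proof -
  obtain p where p: "p \<bullet> p = 1" "c \<bullet> p = 0" using unit_orthogonal_exists[of "{c}"] by auto
  obtain d e where o: "orthonormal4 c p d e" by (rule orthonormal_extend[OF c p])
  define f where "f = (\<lambda>a::real. a *\<^sub>R p + sqrt (1 - a\<^sup>2) *\<^sub>R d)"
  have o': "d \<bullet> p = 0" "d \<bullet> c = 0" "p \<bullet> c = 0" "d \<bullet> d = 1" "p \<bullet> d = 0" "p \<bullet> p = 1"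
    using o by (simp_all add: orthonormal4_def inner_commute)
  have "inj_on f {0..1}"
  proof (rule inj_onI)
    fix a b assume "f a = f b"
    then have "f a \<bullet> p = f b \<bullet> p" by simp
    then show "a = b" using o' by (simp add: f_def inner_add_left)
  qed
  then have "infinite (f ` {0..1})" using infinite_Icc[of 0 "1::real"] by (simp add: finite_image_iff)
  moreover have "f ` {0..1} \<subseteq> {u. u \<bullet> u = 1 \<and> u \<bullet> c = 0}"
  proof clarify
    fix a :: real assume "a \<in> {0..1}"
    then have "a\<^sup>2 \<le> 1" by (simp add: power_le_one)
    then have "sqrt (1 - a\<^sup>2) * sqrt (1 - a\<^sup>2) = 1 - a * a" by (simp add: power2_eq_square)
    then show "f a \<bullet> f a = 1 \<and> f a \<bullet> c = 0"
      using o' by (simp add: f_def inner_add_left inner_add_right)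
  qed
  ultimately show ?thesis using finite_subset by blast
qed

lemma extend_card:
  assumes "finite A" "card A \<le> n" "A \<subseteq> X" "infinite X"
  shows "\<exists>B. A \<subseteq> B \<and> B \<subseteq> X \<and> card B = n"
proof -
  have "infinite (X - A)" using assms by simp
  then obtain D where D: "finite D" "card D = n - card A" "D \<subseteq> X - A"
    using infinite_arbitrarily_large by metis
  then have "card (A \<union> D) = n" using assms by (subst card_Un_disjoint) auto
  then show ?thesis using assms D by (intro exI[of _ "A \<union> D"]) auto
qed

section \<open>From tetrahedra to tangent bodies, and the equality case\<close>

context tangent_body begin

text \<open>Several faces may yield the same direction. Further constraints only shrink the body, so
  the set of directions is filled up to exactly four arbitrary distinct ones.\<close>

lemma simplex_contains_body:
  assumes n: "\<And>i. i < (4::nat) \<Longrightarrow> n i \<bullet> n i = 1" and s: "\<And>i. i < 4 \<Longrightarrow> sin r \<le> n i \<bullet> c"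
    and r: "0 < r" "r < pi / 2" "\<rho> = tan r"
  shows "\<exists>M. config M \<and> body M \<subseteq> simplex_cone n"
proof -
  have "\<exists>u. u \<bullet> u = 1 \<and> u \<bullet> c = 0 \<and> (\<forall>x. 0 < x \<bullet> c \<longrightarrow> x \<bullet> u \<le> tan r * (x \<bullet> c) \<longrightarrow> 0 \<le> x \<bullet> n i)"
    if "i < 4" for i
    using horizontal_normal_exists[OF c_unit n[OF that] s[OF that] r(1,2)] by metis
  then obtain u where u: "\<And>i. i < 4 \<Longrightarrow> u i \<bullet> u i = 1 \<and> u i \<bullet> c = 0 \<and>
      (\<forall>x. 0 < x \<bullet> c \<longrightarrow> x \<bullet> u i \<le> tan r * (x \<bullet> c) \<longrightarrow> 0 \<le> x \<bullet> n i)" by metis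
  have fin: "finite (u ` {..<4})" by simp
  have card: "card (u ` {..<4}) \<le> 4" using card_image_le[of "{..<4::nat}" u] by simp
  have sub: "u ` {..<4} \<subseteq> {u. u \<bullet> u = 1 \<and> u \<bullet> c = 0}" using u by auto
  obtain M where M: "u ` {..<4} \<subseteq> M" "M \<subseteq> {u. u \<bullet> u = 1 \<and> u \<bullet> c = 0}" "card M = 4"
    using extend_card[OF fin card sub infinite_horizontal[OF c_unit]] by (elim exE conjE)
  have "body M \<subseteq> simplex_cone n"
  proof
    fix x assume x: "x \<in> body M"
    have "0 \<le> x \<bullet> n i" if "i < 4" for i
      using x u[OF that, folded r(3)] M(1) that by (auto simp: body_def half_def)
    then show "x \<in> simplex_cone n" using x by (auto simp: body_def half_def simplex_cone_def)
  qed
  then show ?thesis using M by (intro exI[of _ M]) (auto simp: config_def)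
qed

text \<open>The condition \<open>0 < x \<bullet> c\<close> of \<open>body\<close> is dropped, to
  match the form of \<open>simplex_cone\<close>.\<close>

definition closed_body :: "(real^4) set \<Rightarrow> (real^4) set" where
  "closed_body M = {x. norm x \<le> 1 \<and> (\<forall>p\<in>M. x \<bullet> p \<le> \<rho> * (x \<bullet> c))}"

text \<open>Since the four points sum to zero, adding the constraints gives x \<bullet> c \<ge> 0.
  If x \<bullet> c = 0, all products with the points vanish and the frame identity forces x =
  0.\<close>

lemma closed_body_regular:
  assumes R: "regular_config M" shows "closed_body M = insert 0 (body M)"
proof -
  have M: "config M" using R by (simp add: regular_config_def)
  have "0 < x \<bullet> c \<or> x = 0" if x: "x \<in> closed_body M" for x
  proof -
    have card: "card M = 4" and fin: "finite M" using M config_finite by (auto simp: config_def)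
    have sum0: "(\<Sum>p\<in>M. x \<bullet> p) = 0" using regular_config_sum[OF R] by (simp flip: inner_sum_right)
    have "(\<Sum>p\<in>M. x \<bullet> p) \<le> (\<Sum>p\<in>M. \<rho> * (x \<bullet> c))" using x by (intro sum_mono) (simp add: closed_body_def)
    then have "0 \<le> x \<bullet> c" using sum0 card \<rho>_pos by (simp add: zero_le_mult_iff)
    moreover have "x = 0" if z: "x \<bullet> c = 0"
    proof -
      have "\<forall>p\<in>M. 0 \<le> - (x \<bullet> p)" using x z by (auto simp: closed_body_def)
      moreover have "(\<Sum>p\<in>M. - (x \<bullet> p)) = 0" using sum0 by (simp add: sum_negf)
      ultimately have "\<forall>p\<in>M. - (x \<bullet> p) = 0" using fin sum_nonneg_eq_0_iff[of M "\<lambda>p. - (x \<bullet> p)"] by auto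
      then have "(\<Sum>p\<in>M. (x \<bullet> p)\<^sup>2) = 0" by (intro sum.neutral) auto
      then show ?thesis using regular_config_frame[OF R, of x] z by simp
    qed
    ultimately show ?thesis by force
  qed
  then show ?thesis using \<rho>_pos by (auto simp: closed_body_def body_def half_def)
qed

lemma measure_closed_body_regular:
  assumes R: "regular_config M" shows "measure lborel (closed_body M) = minimum"
proof -
  have b: "body M \<in> sets lborel"
    using R body_borel config_finite by (simp add: regular_config_def)
  have "measure lborel (insert 0 (body M)) = measure lborel (body M)"
  proof (rule measure_eq_AE)
    have "AE x in lborel. x \<noteq> (0::real^4)" by (rule AE_lborel_singleton)
    then show "AE x in lborel. x \<in> insert 0 (body M) \<longleftrightarrow> x \<in> body M" by eventually_elim simp
    show "insert 0 (body M) \<in> sets lborel" using sets.Un[of "{0}" lborel "body M"] b by simp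
  qed (rule b)
  then show ?thesis using measure_body_regular[OF R] closed_body_regular[OF R] by simp
qed

text \<open>A point of the cone violating some constraint of \<open>M\<close> can be pushed slightly
  towards the interior; this yields a nonempty open set inside the cone and disjoint from the body,
  hence a surplus of volume.\<close>

lemma simplex_cone_eq_closed_body:
  assumes v: "tet_vertices v" and n: "normals v n" and M: "finite M" and sub: "body M \<subseteq> simplex_cone n"
    and eq: "measure lborel (simplex_cone n) = measure lborel (body M)"
  shows "simplex_cone n \<subseteq> closed_body M"
proof (rule ccontr)
  assume "\<not> ?thesis"
  then obtain x where x: "x \<in> simplex_cone n" "x \<notin> closed_body M" by blast
  then obtain p where p: "p \<in> M" "\<rho> * (x \<bullet> c) < x \<bullet> p"
    by (auto simp: closed_body_def simplex_cone_def not_le)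
  \<comment> \<open>The vertex sum lies strictly inside all four half spaces; the factor 1/8 brings
    its norm down to at most 1/2.\<close>
  define z where "z = (1 / 8) *\<^sub>R (\<Sum>i<4. v i)"
  have nv: "norm (v i) = 1" if "i < 4" for i using v that by (simp add: tet_vertices_def)
  have "norm (\<Sum>i<4. v i) \<le> (\<Sum>i<4. norm (v i))" by (rule norm_sum)
  also have "\<dots> = 4" using nv by simp
  finally have z1: "norm z < 1" by (simp add: z_def)
  have zn: "0 < z \<bullet> n i" if i: "i < 4" for i
  proof -
    have "(\<Sum>j<4. v j) \<bullet> n i = (\<Sum>j<4. if j = i then n i \<bullet> v i else 0)"
      unfolding inner_sum_left using n i by (intro sum.cong) (auto simp: normals_def inner_commute[of _ "n i"])
    then show ?thesis using n i by (simp add: z_def normals_def)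
  qed
  define U where "U = ball 0 1 \<inter> (\<Inter>i\<in>{..<4}. {y. 0 < y \<bullet> n i}) \<inter> {y. \<rho> * (y \<bullet> c) < y \<bullet> p}"
  have "open (\<Inter>i\<in>{..<4}. {y. 0 < y \<bullet> n i})" "open {y. \<rho> * (y \<bullet> c) < y \<bullet> p}"
    by (intro open_INT ballI open_Collect_less continuous_intros finite_lessThan)+
  then have U: "open U" by (auto simp: U_def)
  define y where "y = (\<lambda>\<epsilon>::real. (1 - \<epsilon>) *\<^sub>R x + \<epsilon> *\<^sub>R z)"
  have "((\<lambda>\<epsilon>. y \<epsilon> \<bullet> p - \<rho> * (y \<epsilon> \<bullet> c)) \<longlongrightarrow> y 0 \<bullet> p - \<rho> * (y 0 \<bullet> c)) (at_right 0)"
    unfolding y_def by (intro tendsto_intros)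
  then have "\<forall>\<^sub>F \<epsilon> in at_right 0. 0 < y \<epsilon> \<bullet> p - \<rho> * (y \<epsilon> \<bullet> c)"
    by (rule order_tendstoD) (use p in \<open>simp add: y_def\<close>)
  moreover have "\<forall>\<^sub>F \<epsilon> in at_right (0::real). \<epsilon> < 1" by (rule eventually_at_rightI[of 0 1]) auto
  moreover have "\<forall>\<^sub>F \<epsilon> in at_right (0::real). 0 < \<epsilon>" by (simp add: eventually_at_right_less)
  ultimately have "\<forall>\<^sub>F \<epsilon> in at_right 0. y \<epsilon> \<in> U"
  proof eventually_elim
    case (elim \<epsilon>)
    have "norm (y \<epsilon>) \<le> norm ((1 - \<epsilon>) *\<^sub>R x) + norm (\<epsilon> *\<^sub>R z)" unfolding y_def by (rule norm_triangle_ineq)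
    also have "\<dots> = (1 - \<epsilon>) * norm x + \<epsilon> * norm z" using elim by simp
    also have "\<dots> < (1 - \<epsilon>) * 1 + \<epsilon> * 1"
      using elim x z1 by (intro add_le_less_mono mult_left_mono mult_strict_left_mono) (auto simp: simplex_cone_def)
    finally have "norm (y \<epsilon>) < 1" by simp
    moreover have "0 < y \<epsilon> \<bullet> n i" if "i < 4" for i
      unfolding y_def inner_add_left using elim x zn[OF that] that
      by (intro add_nonneg_pos) (auto simp: simplex_cone_def)
    ultimately show ?case using elim by (simp add: U_def)
  qed
  then obtain \<epsilon> where "y \<epsilon> \<in> U" by (metis eventually_happens trivial_limit_at_right_real)
  then have "\<not> negligible U" using open_not_negligible[OF U] by blast
  then have U0: "measure lborel U \<noteq> 0"
  proof (rule contrapos_nn)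
    assume "measure lborel U = 0"
    moreover have "emeasure lborel U < \<infinity>" by (rule emeasure_bounded_finite) (auto simp: U_def)
    ultimately have "emeasure lborel U = 0" by (simp add: measure_eq_emeasure_eq_ennreal emeasure_eq_ennreal_measure)
    then show "negligible U" using U by (simp add: negligible_iff_null_sets null_sets_def)
  qed
  have fin: "emeasure lborel U \<noteq> \<infinity>" "emeasure lborel (body M) \<noteq> \<infinity>" "emeasure lborel (simplex_cone n) < \<infinity>"
    using emeasure_bounded_finite[of U] emeasure_bounded_finite[of "body M"] emeasure_bounded_finite[of "simplex_cone n"]
    by (auto simp: U_def body_def half_def simplex_cone_def)
  have bb: "body M \<in> sets borel" by (rule body_borel[OF M])
  have cc: "simplex_cone n \<in> sets borel" using simplex_cone_closed by simp
  have UC: "U \<subseteq> simplex_cone n" by (auto simp: U_def simplex_cone_def less_imp_le)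
  have "U \<inter> body M = {}" using p by (auto simp: U_def body_def)
  then have "measure lborel (U \<union> body M) = measure lborel U + measure lborel (body M)"
    using U bb fin by (intro measure_Union) auto
  moreover have "measure lborel (U \<union> body M) \<le> measure lborel (simplex_cone n)"
    using U bb cc fin UC sub by (intro measure_mono_fmeasurable fmeasurableI) auto
  moreover have "0 < measure lborel U" using U0 by (simp add: zero_less_measure_iff)
  ultimately show False using eq by simp
qed


lemma regular_config_isometry:
  assumes M: "regular_config M" and M': "regular_config M'"
  obtains f where "orthogonal_transformation f" "f ` closed_body M = closed_body M'"
proof -
  have fin: "finite M" "card M = 4" "finite M'" "card M' = 4"
    using M M' config_finite by (auto simp: regular_config_def config_def)
  then obtain \<tau> where \<tau>: "bij_betw \<tau> M M'" using finite_same_card_bij by metis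
  have \<tau>M: "\<tau> p \<in> M'" if "p \<in> M" for p using \<tau> that by (auto simp: bij_betw_def)
  \<comment> \<open>The factor 3/4 inverts the frame constant 4/3, so \<open>f\<close> fixes
    \<open>c\<close> and sends each p to \<open>\<tau> p\<close>. Any bijection works, because all
    pairs of distinct points have the same inner product.\<close>
  define f where "f = (\<lambda>x. (x \<bullet> c) *\<^sub>R c + (3 / 4) *\<^sub>R (\<Sum>p\<in>M. (x \<bullet> p) *\<^sub>R \<tau> p))"
  have gram: "\<tau> p \<bullet> \<tau> q = (if p = q then 1 else - 1 / 3)" if "p \<in> M" "q \<in> M" for p q
  proof -
    have "\<tau> p = \<tau> q \<longleftrightarrow> p = q" using \<tau> that by (auto simp: bij_betw_def inj_on_eq_iff)
    then show ?thesis using M' \<tau>M[OF that(1)] \<tau>M[OF that(2)] by (auto simp: regular_config_def config_def)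
  qed
  have \<tau>c: "\<tau> p \<bullet> c = 0" "c \<bullet> \<tau> p = 0" if "p \<in> M" for p
    using M' \<tau>M[OF that] by (auto simp: regular_config_def config_def inner_commute[of c "\<tau> p"])
  have sum0: "(\<Sum>p\<in>M. x \<bullet> p) = 0" for x using regular_config_sum[OF M] by (simp flip: inner_sum_right)
  have f\<tau>: "f x \<bullet> \<tau> q = x \<bullet> q" if q: "q \<in> M" for x q
  proof -
    have "(\<Sum>p\<in>M. (x \<bullet> p) *\<^sub>R \<tau> p) \<bullet> \<tau> q = (\<Sum>p\<in>M. (if p = q then 4 / 3 * (x \<bullet> q) else 0) - 1 / 3 * (x \<bullet> p))"
      unfolding inner_sum_left by (intro sum.cong) (auto simp: gram q)
    also have "\<dots> = 4 / 3 * (x \<bullet> q)" using q fin sum0[of x] by (simp add: sum_subtractf flip: sum_divide_distrib)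
    finally show ?thesis using q by (simp add: f_def inner_add_left \<tau>c)
  qed
  have fc: "f x \<bullet> c = x \<bullet> c" for x
    by (simp add: f_def inner_add_left inner_sum_left \<tau>c c_unit)
  have norm_f: "norm (f x) = norm x" for x
  proof -
    have "f x \<bullet> f x = f x \<bullet> ((x \<bullet> c) *\<^sub>R c + (3 / 4) *\<^sub>R (\<Sum>p\<in>M. (x \<bullet> p) *\<^sub>R \<tau> p))"
      by (subst (2) f_def) simp
    also have "\<dots> = (x \<bullet> c)\<^sup>2 + 3 / 4 * (\<Sum>p\<in>M. (x \<bullet> p)\<^sup>2)"
      unfolding inner_add_right inner_scaleR_right inner_sum_right fc
      by (simp add: f\<tau> power2_eq_square cong: sum.cong)
    also have "\<dots> = (norm x)\<^sup>2" unfolding regular_config_frame[OF M] by (simp add: field_simps)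
    finally show ?thesis by (simp add: norm_eq_sqrt_inner power2_norm_eq_inner)
  qed
  have lin: "linear f"
  proof (rule linearI)
    show "f (x + y) = f x + f y" for x y
      by (simp add: f_def inner_add_left scaleR_left_distrib sum.distrib scaleR_right_distrib)
    show "f (t *\<^sub>R x) = t *\<^sub>R f x" for t x
      by (simp add: f_def scaleR_right_distrib scaleR_sum_right mult_ac)
  qed
  have orth: "orthogonal_transformation f" using lin norm_f by (simp add: orthogonal_transformation)
  have iff: "f x \<in> closed_body M' \<longleftrightarrow> x \<in> closed_body M" for x
  proof -
    have "M' = \<tau> ` M" using \<tau> by (simp add: bij_betw_def)
    then show ?thesis by (simp add: closed_body_def norm_f fc f\<tau>)
  qed
  have "f ` (f -` closed_body M') = closed_body M'"
    by (rule surj_image_vimage_eq[OF orthogonal_transformation_surj[OF orth]])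
  moreover have "f -` closed_body M' = closed_body M" using iff by auto
  ultimately have "f ` closed_body M = closed_body M'" by simp
  then show ?thesis using orth that by blast
qed

end

text \<open>The dual vector \<open>w\<^sub>i\<close> of a regular vertex set is \<open>v\<^sub>i\<close> corrected by a multiple of the vertex sum.\<close>
lemma regular_normals_gram:
  assumes v: "tet_vertices v" and n: "normals v n" and reg: "regular_vertices v"
  obtains \<delta> where "\<And>i j. i < 4 \<Longrightarrow> j < 4 \<Longrightarrow> i \<noteq> j \<Longrightarrow> n i \<bullet> n j = \<delta>"
proof -
  define \<gamma> where "\<gamma> = v 0 \<bullet> v 1"
  have vv: "v i \<bullet> v i = 1" if "i < 4" for i using v that by (auto simp: tet_vertices_def norm_eq_1)
  have vg: "v i \<bullet> v j = \<gamma>" if "i < 4" "j < 4" "i \<noteq> j" for i j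
  proof -
    have b: "\<bar>v k \<bullet> v l\<bar> \<le> 1" if "k < 4" "l < 4" for k l
      using Cauchy_Schwarz_ineq2[of "v k" "v l"] vv[OF that(1)] vv[OF that(2)] by (simp add: norm_eq_sqrt_inner)
    have "arccos (v i \<bullet> v j) = arccos (v 0 \<bullet> v 1)"
      using reg[unfolded regular_vertices_def sph_dist_def, rule_format, of i j 0 1] that by simp
    then show ?thesis unfolding \<gamma>_def using b[of i j] b[of 0 1] that by (simp add: arccos_eq_iff)
  qed
  have g1: "\<gamma> < 1"
  proof -
    have "v 0 \<noteq> v 1" using v inj_onD[of v "{..<4}" 0 1] by (auto simp: tet_vertices_def)
    then have "0 < (v 0 - v 1) \<bullet> (v 0 - v 1)" by simp
    also have "\<dots> = 2 - 2 * \<gamma>" using vv[of 0] vv[of 1] vg[of 0 1] vg[of 1 0]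
      by (simp add: inner_diff_left inner_diff_right)
    finally show ?thesis by simp
  qed
  define m where "m = (\<Sum>i<4. v i)"
  define s where "s = 1 + 3 * \<gamma>"
  have mv: "m \<bullet> v j = s" if j: "j < 4" for j
  proof -
    have "m \<bullet> v j = (\<Sum>i<4. (if i = j then 1 - \<gamma> else 0) + \<gamma>)"
      unfolding m_def inner_sum_left using vv vg j by (intro sum.cong) auto
    then show ?thesis using j by (simp add: sum.distrib s_def)
  qed
  have mn: "0 < m \<bullet> n 0"
  proof -
    have "m \<bullet> n 0 = (\<Sum>j<4::nat. if j = 0 then n 0 \<bullet> v 0 else 0)"
      unfolding m_def inner_sum_left using n by (intro sum.cong) (auto simp: normals_def inner_commute[of _ "n 0"])
    then show ?thesis using n by (simp add: normals_def)
  qed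
  have "s \<noteq> 0"
  proof
    assume "s = 0"
    then have "m = 0" using mv by (intro tet_vertices_separate[OF v]) simp
    then show False using mn by simp
  qed
  define w where "w = (\<lambda>i. v i - (\<gamma> / s) *\<^sub>R m)"
  have wv: "w i \<bullet> v j = (if i = j then 1 - \<gamma> else 0)" if "i < 4" "j < 4" for i j
    using that vv vg mv \<open>s \<noteq> 0\<close> by (auto simp: w_def inner_diff_left)
  have wm: "w i \<bullet> m = 1 - \<gamma>" if "i < 4" for i
  proof -
    have "w i \<bullet> m = (\<Sum>j<4. w i \<bullet> v j)" by (simp add: m_def inner_sum_right)
    then show ?thesis using wv[OF that] that by (simp cong: sum.cong_simp)
  qed
  have ww: "w i \<bullet> w j = (if i = j then 1 - \<gamma> else 0) - \<gamma> / s * (1 - \<gamma>)" if "i < 4" "j < 4" for i j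
    using wv[OF that] wm[OF that(1)] by (simp add: w_def inner_diff_right)
  define h where "h = (\<lambda>i. (n i \<bullet> v i) / (1 - \<gamma>))"
  have nw: "n i = h i *\<^sub>R w i" if i: "i < 4" for i
  proof -
    have "n i - h i *\<^sub>R w i = 0"
    proof (rule tet_vertices_separate[OF v])
      fix j :: nat assume j: "j < 4"
      show "(n i - h i *\<^sub>R w i) \<bullet> v j = 0"
        using n i j g1 wv[OF i j] by (auto simp: inner_diff_left normals_def h_def)
    qed
    then show ?thesis by simp
  qed
  define W where "W = (1 - \<gamma>) - \<gamma> / s * (1 - \<gamma>)"
  have l2: "(h i)\<^sup>2 * W = 1" and l0: "0 < h i" if i: "i < 4" for i
  proof -
    have "n i \<bullet> n i = (h i)\<^sup>2 * (w i \<bullet> w i)" by (subst (1 2) nw[OF i]) (simp add: power2_eq_square)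
    then show "(h i)\<^sup>2 * W = 1" using n i ww[OF i i] by (simp add: W_def normals_def)
    show "0 < h i" using n i g1 by (simp add: h_def normals_def)
  qed
  \<comment> \<open>The dual vectors all have the same length, so normalising them uses one common
    factor and preserves the equality of inner products.\<close>
  have leq: "h i = h 0" if i: "i < 4" for i
  proof -
    have "W \<noteq> 0" using l2[of 0] by auto
    moreover have "(h i)\<^sup>2 * W = (h 0)\<^sup>2 * W" using l2[OF i] l2[of 0] by simp
    ultimately have "(h i)\<^sup>2 = (h 0)\<^sup>2" by simp
    then show ?thesis using l0[OF i] l0[of 0] by (simp add: power2_eq_iff_nonneg less_imp_le)
  qed
  have "n i \<bullet> n j = h 0 * h 0 * (- \<gamma> / s * (1 - \<gamma>))" if "i < 4" "j < 4" "i \<noteq> j" for i j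
    using ww[OF that(1,2)] that(3) by (simp add: nw[OF that(1)] nw[OF that(2)] leq[OF that(1)] leq[OF that(2)])
  then show ?thesis by (rule that)
qed

context tangent_body begin

text \<open>The normals have equal mutual products and equal products with \<open>c\<close>, so
  \<open>c\<close> is a multiple of their sum Q: a suitable multiple agrees with \<open>c\<close> on
  every normal. But Q = (4 sin r) c - (cos r) S, where S is the sum of the horizontal directions and
  orthogonal to \<open>c\<close>; hence 0 = c \<bullet> S forces S \<bullet> S = 0. Then S \<bullet>
  u j = 1 + 3 \<epsilon> vanishes, which gives -1/3.\<close>

lemma regular_tet_config:
  assumes v: "tet_vertices v" and n: "normals v n" and reg: "regular_vertices v"
    and nc: "\<And>i. i < (4::nat) \<Longrightarrow> n i \<bullet> c = sin r" and r: "0 < r" "r < pi / 2" "\<rho> = tan r"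
  obtains M where "regular_config M" "simplex_cone n = closed_body M"
proof -
  have sr: "0 < sin r" and cr: "0 < cos r" using r by (auto intro: sin_gt_zero cos_gt_zero)
  obtain \<delta> where \<delta>: "\<And>i j. i < 4 \<Longrightarrow> j < 4 \<Longrightarrow> i \<noteq> j \<Longrightarrow> n i \<bullet> n j = \<delta>" using regular_normals_gram[OF v n reg] by blast
  have nn: "n i \<bullet> n i = 1" if "i < 4" for i using n that by (simp add: normals_def)
  define u where "u = (\<lambda>i. (1 / cos r) *\<^sub>R (sin r *\<^sub>R c - n i))"
  have n_eq: "n i = sin r *\<^sub>R c - cos r *\<^sub>R u i" for i using cr by (simp add: u_def)
  have cn: "c \<bullet> n i = sin r" if "i < 4" for i using nc[OF that] by (simp add: inner_commute)
  have uc: "u i \<bullet> c = 0" if "i < 4" for i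
    using nc[OF that] c_unit by (simp add: u_def inner_diff_left)
  have uu: "u i \<bullet> u j = (n i \<bullet> n j - (sin r)\<^sup>2) / (cos r)\<^sup>2" if "i < 4" "j < 4" for i j
    using nc[OF that(1)] cn[OF that(2)] c_unit cr nc[OF that(2)] cn[OF that(1)]
    by (simp add: u_def inner_diff_left inner_diff_right power2_eq_square field_simps)
  define \<epsilon> where "\<epsilon> = (\<delta> - (sin r)\<^sup>2) / (cos r)\<^sup>2"
  have u1: "u i \<bullet> u i = 1" if "i < 4" for i
    using uu[OF that that] nn[OF that] cr by (simp add: cos_squared_eq[symmetric])
  have ue: "u i \<bullet> u j = \<epsilon>" if "i < 4" "j < 4" "i \<noteq> j" for i j
    using uu[OF that(1,2)] \<delta>[OF that] by (simp add: \<epsilon>_def)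
  define S where "S = (\<Sum>i<4. u i)"
  have Su: "S \<bullet> u j = 1 + 3 * \<epsilon>" if j: "j < 4" for j
  proof -
    have "S \<bullet> u j = (\<Sum>i<4. (if i = j then 1 - \<epsilon> else 0) + \<epsilon>)"
      unfolding S_def inner_sum_left using u1 ue j by (intro sum.cong) auto
    then show ?thesis using j by (simp add: sum.distrib)
  qed
  define Q where "Q = (\<Sum>i<4. n i)"
  have Qn: "Q \<bullet> n j = 1 + 3 * \<delta>" if j: "j < 4" for j
  proof -
    have "Q \<bullet> n j = (\<Sum>i<4. (if i = j then 1 - \<delta> else 0) + \<delta>)"
      unfolding Q_def inner_sum_left using nn \<delta> j by (intro sum.cong) auto
    then show ?thesis using j by (simp add: sum.distrib)
  qed
  have Qc: "Q \<bullet> c = 4 * sin r" unfolding Q_def inner_sum_left using nc by simp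
  have d0: "1 + 3 * \<delta> \<noteq> 0"
  proof
    assume "1 + 3 * \<delta> = 0"
    then have "Q = 0" using Qn by (intro normals_separate[OF v n]) simp
    then show False using Qc sr by simp
  qed
  have "c - (sin r / (1 + 3 * \<delta>)) *\<^sub>R Q = 0"
    using Qn cn d0 by (intro normals_separate[OF v n]) (simp add: inner_diff_left)
  then have cQ: "c = (sin r / (1 + 3 * \<delta>)) *\<^sub>R Q" by simp
  have Q_eq: "Q = (4 * sin r) *\<^sub>R c - cos r *\<^sub>R S"
  proof -
    have "Q = (\<Sum>i<4. sin r *\<^sub>R c - cos r *\<^sub>R u i)" unfolding Q_def by (intro sum.cong refl n_eq)
    then show ?thesis by (simp add: sum_subtractf scaleR_sum_right sum_constant_scaleR S_def del: sum_constant)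
  qed
  have cS: "c \<bullet> S = 0" unfolding S_def inner_sum_right using uc by (simp add: inner_commute[of c "u _"])
  have "0 = (sin r / (1 + 3 * \<delta>)) * (Q \<bullet> S)" using cQ cS by (metis inner_scaleR_left)
  also have "Q \<bullet> S = - (cos r * (S \<bullet> S))" unfolding Q_eq by (simp add: inner_diff_left cS)
  finally have "S = 0" using sr cr d0 by simp
  then have eps: "\<epsilon> = - 1 / 3" using Su[of 0] by simp
  have inj: "inj_on u {..<4}"
  proof (rule inj_onI)
    fix i j :: nat assume ij: "i \<in> {..<4}" "j \<in> {..<4}" "u i = u j"
    show "i = j"
    proof (rule ccontr)
      assume "i \<noteq> j"
      then show False using ue[of i j] u1[of i] ij eps by simp
    qed
  qed
  define M where "M = u ` {..<4}"
  have "card M = 4" unfolding M_def using card_image[OF inj] by simp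
  moreover have "p \<bullet> p = 1 \<and> p \<bullet> c = 0" if "p \<in> M" for p using that u1 uc by (auto simp: M_def)
  moreover have "p \<bullet> q = - 1 / 3" if "p \<in> M" "q \<in> M" "p \<noteq> q" for p q
    using that ue eps by (auto simp: M_def)
  ultimately have "regular_config M" by (simp add: regular_config_def config_def)
  moreover have "simplex_cone n = closed_body M"
  proof -
    have "0 \<le> x \<bullet> n i \<longleftrightarrow> x \<bullet> u i \<le> \<rho> * (x \<bullet> c)" for x i
    proof -
      have "x \<bullet> n i = sin r * (x \<bullet> c) - cos r * (x \<bullet> u i)" by (subst n_eq) (simp add: inner_diff_right)
      also have "\<dots> = cos r * (\<rho> * (x \<bullet> c) - x \<bullet> u i)" using cr by (simp add: r(3) tan_def right_diff_distrib)
      finally show ?thesis using cr by (simp add: zero_le_mult_iff)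
    qed
    then show ?thesis by (auto simp: simplex_cone_def closed_body_def M_def)
  qed
  ultimately show ?thesis by (rule that)
qed

end

lemma sph_hull_from_cone:
  assumes "tet_vertices v" "normals v n" shows "sph_hull (v ` {..<4}) = sphere 0 1 \<inter> simplex_cone n"
  unfolding sph_hull_normals[OF assms] by (auto simp: simplex_cone_def)

theorem mainTheorem9:
  fixes B Treg T :: "(real^4) set"
  assumes "is_sph_ball B"
    and "regular_circumscribed Treg B"
    and "sph_tetrahedron T"
    and "B \<subseteq> T"
  shows "sph_vol T \<ge> sph_vol Treg \<and> (sph_vol T = sph_vol Treg \<longleftrightarrow> sph_congruent T Treg)"
proof -
  obtain c r where c: "c \<in> sphere 0 1" and r: "0 < r" "r < pi" and B: "B = sph_ball c r"
    using assms(1) by (auto simp: is_sph_ball_def)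
  have cc: "c \<bullet> c = 1" using c by (simp add: norm_eq_1)
  obtain v where v: "tet_vertices v" "T = sph_hull (v ` {..<4})"
    using assms(3) by (auto simp: sph_tetrahedron_def)
  obtain w where w: "tet_vertices w" "regular_vertices w" "circumscribed_vertices w B" "Treg = sph_hull (w ` {..<4})"
    using assms(2) by (auto simp: regular_circumscribed_def)
  obtain n where n: "normals v n" by (rule normals_exist[OF v(1)])
  obtain m where m: "normals w m" by (rule normals_exist[OF w(1)])
  have subT: "sph_ball c r \<subseteq> sph_hull (v ` {..<4})" using assms(4) B v(2) by simp
  have subR: "sph_ball c r \<subseteq> sph_hull (w ` {..<4})" using w(3) B by (simp add: circumscribed_vertices_def)
  have r2: "r < pi / 2" by (rule ball_in_tet(1)[OF v(1) n cc r subT])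
  have nc: "sin r \<le> n i \<bullet> c" if "i < 4" for i by (rule ball_in_tet(2)[OF v(1) n cc r subT that])
  have mc: "m i \<bullet> c = sin r" if "i < 4" for i
  proof (rule order.antisym)
    show "sin r \<le> m i \<bullet> c" by (rule ball_in_tet(2)[OF w(1) m cc r subR that])
    show "m i \<bullet> c \<le> sin r"
      by (rule touching_face[OF w(1) m cc r(1) r2 that]) (use w(3) B that in \<open>auto simp: circumscribed_vertices_def\<close>)
  qed
  have rho: "0 < tan r" using r(1) r2 by (rule tan_gt_zero)
  \<comment> \<open>This interpretation serves to obtain \<sigma>, which depends on
    \<open>\<kappa>\<close> of this very profile and is a parameter of the next locale.\<close>
  interpret P: radial_profile "\<lambda>\<tau>. capH (tan r * sqrt (1 + \<tau>))" by (rule radial_profile_capH[OF rho])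
  obtain \<sigma> where \<sigma>: "0 \<le> \<sigma>" "\<sigma> < 2" "0 \<le> integral {\<sigma>..8} P.\<kappa>" "0 < \<sigma> \<Longrightarrow> integral {\<sigma>..8} P.\<kappa> = 0"
    using P.cutoff_exists by blast
  interpret tangent_body c "tan r" \<sigma>
    by unfold_locales (use cc rho \<sigma> in auto)
  obtain R where R: "regular_config R" "simplex_cone m = closed_body R"
    using regular_tet_config[OF w(1) m w(2) mc r(1) r2 refl] by blast
  have volR: "sph_vol Treg = 4 * minimum"
    unfolding w(4) sph_vol_tet[OF w(1) m] R(2) measure_closed_body_regular[OF R(1)] ..
  obtain M where M: "config M" "body M \<subseteq> simplex_cone n"
  proof -
    have "n i \<bullet> n i = 1" if "i < 4" for i using n that by (simp add: normals_def)
    from simplex_contains_body[where n=n, OF this nc r(1) r2 refl] show ?thesis using that by blast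
  qed
  have volT: "sph_vol T = 4 * measure lborel (simplex_cone n)"
    unfolding v(2) by (rule sph_vol_tet[OF v(1) n])
  have le1: "measure lborel (body M) \<le> measure lborel (simplex_cone n)"
  proof (rule measure_mono_fmeasurable[OF M(2)])
    show "body M \<in> sets lborel" using body_borel[OF config_finite[OF M(1)]] by simp
    show "simplex_cone n \<in> fmeasurable lborel"
      using simplex_cone_closed emeasure_bounded_finite[of "simplex_cone n"]
      by (intro fmeasurableI) (auto simp: simplex_cone_def)
  qed
  have le2: "minimum \<le> measure lborel (body M)" by (rule measure_body_ge(1)[OF M(1)])
  have "sph_congruent T Treg" if eq: "sph_vol T = sph_vol Treg"
  proof -
    \<comment> \<open>Equality of volumes closes the chain minimum \<le> body \<le> cone: the first
      link forces all angles of \<open>M\<close> to be regular, the second leaves no room between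
      the tangent body and T.\<close>
    have e: "measure lborel (simplex_cone n) = measure lborel (body M)" "measure lborel (body M) = minimum"
      using eq le1 le2 unfolding volT volR by auto
    have "p \<bullet> q = - 1 / 3" if "p \<in> M" "q \<in> M" "p \<noteq> q" for p q
      using measure_body_ge(2)[OF M(1) that] e(2) by auto
    then have RM: "regular_config M" using M(1) by (simp add: regular_config_def)
    have "simplex_cone n \<subseteq> closed_body M"
      by (rule simplex_cone_eq_closed_body[OF v(1) n config_finite[OF M(1)] M(2) e(1)])
    moreover have "closed_body M \<subseteq> simplex_cone n"
      using M(2) closed_body_regular[OF RM] by (auto simp: simplex_cone_def)
    ultimately have cone: "simplex_cone n = closed_body M" by (rule equalityI)
    obtain f where f: "orthogonal_transformation f" "f ` closed_body M = closed_body R"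
      by (rule regular_config_isometry[OF RM R(1)])
    have "f ` T = sphere 0 1 \<inter> f ` closed_body M"
      unfolding v(2) sph_hull_from_cone[OF v(1) n] cone
      by (auto simp: orthogonal_transformation_norm[OF f(1)])
    also have "\<dots> = Treg" unfolding f(2) w(4) sph_hull_from_cone[OF w(1) m] R(2) ..
    finally show ?thesis using f(1) by (auto simp: sph_congruent_def)
  qed
  moreover have "sph_vol T = sph_vol Treg" if "sph_congruent T Treg"
    using sph_vol_congruent[OF v(1), of Treg] that v(2) by simp
  moreover have "sph_vol Treg \<le> sph_vol T" unfolding volT volR using le1 le2 by simp
  ultimately show ?thesis by blast
qed

end
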